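(* Let $1\le\alpha\le N$ and $n\in\mathbb Z$. The operator $\mathcal D_{\alpha;n}$ is expressible as a homogeneous (noncommutative) polynomial of degree $\alpha$ in the operators $\mathcal D_{1;n-1},\mathcal D_{1;n},\mathcal D_{1;n+1}$, with coefficients in $\mathbb C(q,t)$.
   Context: $q,\theta$ are indeterminates, $t=\theta^2$. Operators act on symmetric rational functions of $x_1,\dots,x_N$ over $\mathbb C(q,\theta)$; $\Gamma_i$ is the shift $x_i\mapsto qx_i$ (other variables fixed). For $1\le\alpha\le N$, $n\in\mathbb Z$, $$\mathcal D_{\alpha;n}=\sum_{I\subset[1,N],\,|I|=\alpha}\Big(\prod_{i\in I}x_i\Big)^n\prod_{i\in I,\,j\notin I}\frac{\theta x_i-\theta^{-1}x_j}{x_i-x_j}\ \prod_{i\in I}\Gamma_i .$$ "Homogeneous polynomial of degree $\alpha$" means a linear combination of ordered products of exactly $\alpha$ of the listed operators. *)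

theory Defs
  imports
    Complex_Main
    "HOL-Library.Poly_Mapping"
    "HOL-Computational_Algebra.Polynomial"
    "HOL-Computational_Algebra.Fraction_Field"
    "HOL-Combinatorics.Permutations"
begin

section \<open>The ground field and its even subfield\<close>

text \<open>
  The field of rational functions in q and theta over the complex numbers is the fraction field
  of polynomials in theta over polynomials in q.
\<close>

type_synonym qfield = "complex poly poly fract"

definition qq :: qfield where
  "qq = Fract [:[:0, 1:]:] 1"

definition theta :: qfield where
  "theta = Fract [:0, 1:] 1"

text \<open>
  The subfield of rational functions in q and t, where t is the square of theta: quotients of
  polynomials \<open>a(q, t)\<close>, \<open>b(q, t)\<close> in which theta squared has been substituted for t.
\<close>

definition qt_subfield :: "qfield set" where
  "qt_subfield =
    {Fract (pcompose a (monom 1 2)) (pcompose b (monom 1 2)) | a b :: complex poly poly. b \<noteq> 0}"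


section \<open>Polynomials and rational functions in the variables \<open>x\<^sub>i\<close>\<close>

text \<open>
  A polynomial maps exponent vectors to coefficients. The variables are indexed by all natural
  numbers; only \<open>x\<^sub>1, \<dots>, x\<^sub>N\<close> are used in the set \<open>rat_funs N\<close>.
\<close>

type_synonym mpol = "(nat \<Rightarrow>\<^sub>0 nat) \<Rightarrow>\<^sub>0 qfield"
type_synonym ratfun = "mpol fract"

definition pconst :: "qfield \<Rightarrow> mpol" where
  "pconst c = Poly_Mapping.single 0 c"

definition pvar :: "nat \<Rightarrow> mpol" where
  "pvar i = Poly_Mapping.single (Poly_Mapping.single i 1) 1"

definition pvars :: "mpol \<Rightarrow> nat set" where
  "pvars p = (\<Union>m\<in>Poly_Mapping.keys p. Poly_Mapping.keys m)"

definition rconst :: "qfield \<Rightarrow> ratfun" where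
  "rconst c = Fract (pconst c) 1"

definition rvar :: "nat \<Rightarrow> ratfun" where
  "rvar i = Fract (pvar i) 1"

definition psubst :: "(nat \<Rightarrow> mpol) \<Rightarrow> mpol \<Rightarrow> mpol" where
  "psubst \<sigma> p = (\<Sum>m\<in>Poly_Mapping.keys p.
     pconst (Poly_Mapping.lookup p m) *
     (\<Prod>i\<in>Poly_Mapping.keys m. \<sigma> i ^ Poly_Mapping.lookup m i))"

text \<open>
  Substitution in numerator and denominator. The value does not depend on the chosen
  representation of the fraction whenever \<open>psubst \<sigma>\<close> is injective (lemma \<open>rsubst_Fract\<close> below);
  this holds for the rescalings and the permutations of variables used here
  (lemmas \<open>inj_psubst_scale\<close> and \<open>inj_psubst_perm\<close>).
\<close>

definition rsubst :: "(nat \<Rightarrow> mpol) \<Rightarrow> ratfun \<Rightarrow> ratfun" where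
  "rsubst \<sigma> f =
    (let (a, b) = (SOME (a, b). b \<noteq> 0 \<and> f = Fract a b) in Fract (psubst \<sigma> a) (psubst \<sigma> b))"

definition rat_funs :: "nat \<Rightarrow> ratfun set" where
  "rat_funs N = {Fract a b | a b. b \<noteq> 0 \<and> pvars a \<subseteq> {1..N} \<and> pvars b \<subseteq> {1..N}}"

definition sym_rat_funs :: "nat \<Rightarrow> ratfun set" where
  "sym_rat_funs N =
    {f \<in> rat_funs N. \<forall>\<pi>. \<pi> permutes {1..N} \<longrightarrow> rsubst (\<lambda>i. pvar (\<pi> i)) f = f}"


section \<open>The difference operators\<close>

definition qshift :: "nat \<Rightarrow> ratfun \<Rightarrow> ratfun" where
  "qshift i = rsubst (\<lambda>j. if j = i then pconst qq * pvar j else pvar j)"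

text \<open>
  The product of the shifts over \<open>I\<close> is formed in increasing order of the indices; the shifts
  commute (lemma \<open>qshift_commute\<close>), so the order is immaterial.
\<close>

definition DD :: "nat \<Rightarrow> nat \<Rightarrow> int \<Rightarrow> ratfun \<Rightarrow> ratfun" where
  "DD N \<alpha> n f =
    (\<Sum>I | I \<subseteq> {1..N} \<and> card I = \<alpha>.
      (\<Prod>i\<in>I. rvar i) powi n *
      (\<Prod>i\<in>I. \<Prod>j\<in>{1..N} - I.
         (rconst theta * rvar i - rconst (inverse theta) * rvar j) / (rvar i - rvar j)) *
      foldr qshift (sorted_list_of_set I) f)"

text \<open>
  The operator \<open>P\<close> agrees on \<open>V\<close> with a homogeneous noncommutative polynomial of degree \<open>d\<close>
  in the operators \<open>A k\<close>, \<open>k \<in> K\<close> (with \<open>K\<close> finite), with coefficients in \<open>C\<close>: a linear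
  combination, over the words of length \<open>d\<close> in the alphabet \<open>K\<close>, of the ordered composites.
\<close>

definition homogeneous_ncpoly_in ::
  "ratfun set \<Rightarrow> qfield set \<Rightarrow> nat \<Rightarrow> 'k set \<Rightarrow> ('k \<Rightarrow> ratfun \<Rightarrow> ratfun) \<Rightarrow> (ratfun \<Rightarrow> ratfun) \<Rightarrow> bool"
where
  "homogeneous_ncpoly_in V C d K A P \<longleftrightarrow>
    (\<exists>c :: 'k list \<Rightarrow> qfield. (\<forall>w. c w \<in> C) \<and>
      (\<forall>f\<in>V. P f = (\<Sum>w | set w \<subseteq> K \<and> length w = d. rconst (c w) * foldr A w f)))"


section \<open>Well-definedness of the substitutions\<close>

lemma psubst_superset:
  assumes "finite S" "Poly_Mapping.keys p \<subseteq> S"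
  shows "psubst \<sigma> p = (\<Sum>m\<in>S. pconst (Poly_Mapping.lookup p m) *
     (\<Prod>i\<in>Poly_Mapping.keys m. \<sigma> i ^ Poly_Mapping.lookup m i))"
  unfolding psubst_def
  by (rule sum.mono_neutral_left) (use assms in \<open>auto simp: in_keys_iff pconst_def\<close>)

lemma psubst_0 [simp]: "psubst \<sigma> 0 = 0"
  by (simp add: psubst_def)

lemma pconst_add: "pconst (a + b) = pconst a + pconst b"
  by (simp add: pconst_def single_add)

lemma pconst_mult: "pconst (a * b) = pconst a * pconst b"
  by (simp add: pconst_def mult_single)

lemma psubst_add: "psubst \<sigma> (p + r) = psubst \<sigma> p + psubst \<sigma> r"
proof -
  let ?S = "Poly_Mapping.keys p \<union> Poly_Mapping.keys r"
  have *: "Poly_Mapping.keys (p + r) \<subseteq> ?S" by (rule Poly_Mapping.keys_add)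
  show ?thesis
    by (subst (1 2 3) psubst_superset[of ?S])
       (use * in \<open>auto simp: lookup_add pconst_add algebra_simps sum.distrib\<close>)
qed

lemma psubst_sum: "psubst \<sigma> (sum g A) = (\<Sum>x\<in>A. psubst \<sigma> (g x))"
  by (induction A rule: infinite_finite_induct) (auto simp: psubst_add)

lemma psubst_single:
  "psubst \<sigma> (Poly_Mapping.single m c) =
    pconst c * (\<Prod>i\<in>Poly_Mapping.keys m. \<sigma> i ^ Poly_Mapping.lookup m i)"
  by (subst psubst_superset[of "{m}"]) auto

lemma poly_sum_singles:
  fixes p :: "'a \<Rightarrow>\<^sub>0 'b::comm_monoid_add"
  shows "p = (\<Sum>m\<in>Poly_Mapping.keys p. Poly_Mapping.single m (Poly_Mapping.lookup p m))"
  by (rule poly_mapping_eqI)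
     (auto simp: lookup_sum lookup_single when_def in_keys_iff sum.delta)

lemma monomial_eval_add:
  fixes \<sigma> :: "nat \<Rightarrow> 'r::comm_semiring_1"
  shows "(\<Prod>i\<in>Poly_Mapping.keys (m + k). \<sigma> i ^ Poly_Mapping.lookup (m + k) i) =
    (\<Prod>i\<in>Poly_Mapping.keys m. \<sigma> i ^ Poly_Mapping.lookup m i) *
    (\<Prod>i\<in>Poly_Mapping.keys k. \<sigma> i ^ Poly_Mapping.lookup k i)"
proof -
  let ?S = "Poly_Mapping.keys m \<union> Poly_Mapping.keys k"
  have *: "(\<Prod>i\<in>Poly_Mapping.keys u. \<sigma> i ^ Poly_Mapping.lookup u i) =
      (\<Prod>i\<in>?S. \<sigma> i ^ Poly_Mapping.lookup u i)" if "Poly_Mapping.keys u \<subseteq> ?S" for u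
    by (rule prod.mono_neutral_left) (use that in \<open>auto simp: in_keys_iff\<close>)
  show ?thesis
    by (subst (1 2 3) *)
       (auto simp: Poly_Mapping.keys_add lookup_add power_add prod.distrib)
qed

lemma psubst_mult: "psubst \<sigma> (p * r) = psubst \<sigma> p * psubst \<sigma> r"
proof -
  have "p * r = (\<Sum>m\<in>Poly_Mapping.keys p. \<Sum>k\<in>Poly_Mapping.keys r.
      Poly_Mapping.single (m + k) (Poly_Mapping.lookup p m * Poly_Mapping.lookup r k))"
    by (subst poly_sum_singles[of p], subst poly_sum_singles[of r])
       (simp add: sum_product mult_single)
  then have "psubst \<sigma> (p * r) = (\<Sum>m\<in>Poly_Mapping.keys p. \<Sum>k\<in>Poly_Mapping.keys r.
      psubst \<sigma> (Poly_Mapping.single (m + k) (Poly_Mapping.lookup p m * Poly_Mapping.lookup r k)))"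
    by (simp add: psubst_sum)
  also have "\<dots> = psubst \<sigma> p * psubst \<sigma> r"
    unfolding psubst_def[of \<sigma> p] psubst_def[of \<sigma> r] sum_product
    by (intro sum.cong refl) (simp add: psubst_single monomial_eval_add pconst_mult mult_ac)
  finally show ?thesis .
qed

lemma psubst_pconst [simp]: "psubst \<sigma> (pconst c) = pconst c"
  by (simp add: pconst_def psubst_single)

lemma psubst_1 [simp]: "psubst \<sigma> 1 = 1"
  using psubst_pconst[of \<sigma> 1] by (simp add: pconst_def)

lemma psubst_pvar [simp]: "psubst \<sigma> (pvar i) = \<sigma> i"
  by (simp add: pvar_def psubst_single pconst_def)

lemma psubst_power: "psubst \<sigma> (p ^ k) = psubst \<sigma> p ^ k"
  by (induction k) (auto simp: psubst_mult)

lemma psubst_prod: "psubst \<sigma> (prod g A) = (\<Prod>x\<in>A. psubst \<sigma> (g x))"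
  by (induction A rule: infinite_finite_induct) (auto simp: psubst_mult)

lemma psubst_psubst: "psubst \<tau> (psubst \<sigma> p) = psubst (\<lambda>i. psubst \<tau> (\<sigma> i)) p"
  by (simp add: psubst_def[of \<sigma> p] psubst_def[of "\<lambda>i. psubst \<tau> (\<sigma> i)"]
      psubst_sum psubst_mult psubst_prod psubst_power)

lemma pvar_power: "pvar i ^ k = Poly_Mapping.single (Poly_Mapping.single i k) 1"
  by (induction k) (auto simp: pvar_def mult_single single_add[symmetric])

lemma prod_single_1:
  "(\<Prod>i\<in>A. Poly_Mapping.single (g i) (1::qfield)) = Poly_Mapping.single (sum g A) 1"
  by (induction A rule: infinite_finite_induct) (auto simp: mult_single)

lemma psubst_pvar_id [simp]: "psubst pvar p = p"
proof -
  have "psubst pvar p = (\<Sum>m\<in>Poly_Mapping.keys p. Poly_Mapping.single m (Poly_Mapping.lookup p m))"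
    unfolding psubst_def
    by (intro sum.cong refl)
       (simp add: pvar_power prod_single_1 poly_sum_singles[symmetric] pconst_def mult_single)
  then show ?thesis using poly_sum_singles[of p] by simp
qed

lemma psubst_nonzero:
  assumes "inj (psubst \<sigma>)" "p \<noteq> 0"
  shows "psubst \<sigma> p \<noteq> 0"
proof
  assume "psubst \<sigma> p = 0"
  then have "psubst \<sigma> p = psubst \<sigma> 0" by simp
  then show False using injD[OF assms(1)] assms(2) by blast
qed

lemma rsubst_Fract:
  assumes "inj (psubst \<sigma>)" "b \<noteq> 0"
  shows "rsubst \<sigma> (Fract a b) = Fract (psubst \<sigma> a) (psubst \<sigma> b)"
proof -
  have nz: "psubst \<sigma> p \<noteq> 0" if "p \<noteq> 0" for p
    using psubst_nonzero[OF assms(1) that] .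
  define ab where "ab = (SOME (c, d). d \<noteq> 0 \<and> Fract a b = Fract c d)"
  obtain c d where cd: "ab = (c, d)" by fastforce
  have "case ab of (c, d) \<Rightarrow> d \<noteq> 0 \<and> Fract a b = Fract c d"
    unfolding ab_def by (rule someI[of _ "(a, b)"]) (use assms in auto)
  then have d: "d \<noteq> 0" "a * d = c * b"
    using assms cd by (auto simp: eq_fract)
  then have "psubst \<sigma> a * psubst \<sigma> d = psubst \<sigma> c * psubst \<sigma> b"
    by (metis psubst_mult)
  then have "Fract (psubst \<sigma> c) (psubst \<sigma> d) = Fract (psubst \<sigma> a) (psubst \<sigma> b)"
    using nz d assms by (simp add: eq_fract)
  then show ?thesis
    unfolding rsubst_def ab_def[symmetric] cd by simp
qed

lemma inj_psubst_scale:
  assumes "\<And>i. s i \<noteq> 0"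
  shows "inj (psubst (\<lambda>i. pconst (s i) * pvar i))"
proof (rule inj_on_inverseI)
  fix p
  have "pconst (s i) * (pconst (inverse (s i)) * pvar i) = pvar i" for i
    using assms[of i] by (simp flip: mult.assoc pconst_mult) (simp add: pconst_def)
  then show "psubst (\<lambda>i. pconst (inverse (s i)) * pvar i)
      (psubst (\<lambda>i. pconst (s i) * pvar i) p) = p"
    by (simp only: psubst_psubst psubst_mult psubst_pconst psubst_pvar psubst_pvar_id)
qed

lemma inj_psubst_perm:
  assumes "\<pi> permutes S"
  shows "inj (psubst (\<lambda>i. pvar (\<pi> i)))"
proof (rule inj_on_inverseI)
  show "psubst (\<lambda>i. pvar (inv \<pi> i)) (psubst (\<lambda>i. pvar (\<pi> i)) p) = p" for p
    using permutes_inverses[OF assms] by (simp add: psubst_psubst)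
qed

lemma qq_nonzero [simp]: "qq \<noteq> 0"
  by (simp add: qq_def Zero_fract_def eq_fract)

lemma theta_nonzero [simp]: "theta \<noteq> 0"
  by (simp add: theta_def Zero_fract_def eq_fract)

lemma rvar_eq_iff: "rvar i = rvar j \<longleftrightarrow> i = j"
  by (auto simp: rvar_def eq_fract pvar_def dest!: arg_cong[of _ _ Poly_Mapping.keys])

lemma inj_psubst_qshift: "inj (psubst (\<lambda>j. if j = i then pconst qq * pvar j else pvar j))"
proof -
  have "(\<lambda>j. if j = i then pconst qq * pvar j else pvar j) =
      (\<lambda>j. pconst (if j = i then qq else 1) * pvar j)"
    by (auto simp: pconst_def)
  then show ?thesis by (simp add: inj_psubst_scale)
qed

lemma qshift_Fract:
  "b \<noteq> 0 \<Longrightarrow> qshift i (Fract a b) =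
     Fract (psubst (\<lambda>j. if j = i then pconst qq * pvar j else pvar j) a)
           (psubst (\<lambda>j. if j = i then pconst qq * pvar j else pvar j) b)"
  unfolding qshift_def by (rule rsubst_Fract[OF inj_psubst_qshift])

lemma qshift_rvar: "qshift i (rvar j) = (if j = i then rconst qq * rvar j else rvar j)"
  by (simp add: rvar_def qshift_Fract rconst_def)

lemma qshift_commute: "qshift i (qshift k f) = qshift k (qshift i f)"
proof (cases f rule: Fract_cases)
  case (Fract a b)
  have nz: "psubst (\<lambda>j. if j = i then pconst qq * pvar j else pvar j) b \<noteq> 0" for i
    by (rule psubst_nonzero[OF inj_psubst_qshift Fract(2)])
  have "(\<lambda>j. psubst (\<lambda>l. if l = i then pconst qq * pvar l else pvar l)
           (if j = k then pconst qq * pvar j else pvar j)) =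
        (\<lambda>j. psubst (\<lambda>l. if l = k then pconst qq * pvar l else pvar l)
           (if j = i then pconst qq * pvar j else pvar j))"
    by (auto simp: psubst_mult)
  then show ?thesis using Fract nz by (simp add: qshift_Fract psubst_psubst)
qed

end

(*
  A product of operators D_{1;a} is a sum over words of shifts. The coefficient of a product of
  distinct shifts Gamma_i (i in I) is, up to a factor that depends on I only, the shuffle product
    sum over the orderings l of {x_i : i in I} of (monomial in l) * prod_{a<b} om(l_a, l_b),
    om(x,y) = (th x - y/th) (th y - q x/th) / ((x - y) (y - q x)),
  and the coefficient of a word with repeated shifts is the same sum with its poles at y = q x
  cleared, at points that form strings x, q x, q^2 x, ... So if a combination of these sums over
  monomials with exponents -1, 0, 1 is the constant 1, then the coefficients with repeated shifts
  vanish, and the same combination of the operators (with the exponents moved by n) is D_{k;n}.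

  That 1_k, the constant 1 in k variables, is such a combination is shown by induction on k. With
  e1 = sum x and e' = sum 1/x, the residue theorem gives 1_{k-1} * x - q x * 1_{k-1} = (1 - q) e1
  and similarly for e'. Let t = th^2 and {p, p'} = {1/t, t/q}, so that
  om(x,y) = (x - p y) (x - p' y) / ((x - y) (x - y/q)). The chain elements
    X_k[g] = sum over orderings l of g(l) * prod_a 1/(1 - p l_{a+1}/l_a) * prod_{a<b} om(l_a, l_b)
  satisfy
    1 - p'^k = sum_{m<k} (1 - p')^(k-m) p'^m 1_m * X_{k-m}[1],
  and multiplication by one factor 1 - p l_{a+1}/l_a decouples X_k into a product of two shorter
  chains, whence X_k[l_i/l_j] = p^(j-i) X_k[1] modulo combinations of monomials. Multiplying the
  displayed identity by e1 e' yields e1 e' = (sum_{i,j<k} p^(j-i)) 1_k modulo such combinations.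
  Exchanging p and p' gives a second, different constant, and hence 1_k itself.
*)

theory Submission
  imports Defs "HOL-Combinatorics.Multiset_Permutations"
begin

section \<open>Partial fractions of the pair factor\<close>

text \<open>The obstacle is circularity. Commutators with a single variable yield \<open>e1\<close>
  and \<open>e'\<close> in k variables, but not the constant 1, and the chain elements of length k
  are not combinations of monomials by construction. The congruence of \<open>e1 e'\<close> with a
  multiple of 1 is therefore arranged so that its correction terms are shuffle products of shorter
  elements only. Comparing the congruences for the two roots gives 1, and only then are the chain
  elements of length k recovered, from 1, \<open>e1\<close> and \<open>e'\<close>, for use at the
  next size. The comparison makes sense because \<open>om\<close> is symmetric in the roots, so both
  kinds of chain are measured against the same span.

  The coefficients lie in the subfield of functions of q and t, although every single factor of an
  operator contains theta: the two factors that belong to an ordered pair of shifts combine into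
  \<open>om\<close>, in which only even powers of theta are left.

  The points are elements of the field of rational functions itself, where no topology is at hand.
  The passage to strings x, q x, ... is therefore an algebraic deformation in one parameter.\<close>

lemma partial_fraction_combine:
  fixes c :: "'a::comm_ring_1"
  assumes "o1 = 1 + c * (A - B)" "o2 = 1 + c * (A' - B')"
    and "A * w = A' * w - A' * v" "B * w = B' * w - B' * u"
  shows "o1 * w = o2 * w - c * A' * v + c * B' * u"
proof -
  have "o1 * w = w + c * (A * w) - c * (B * w)" by (simp add: assms(1) algebra_simps)
  then show ?thesis unfolding assms(2-4) by (simp add: algebra_simps)
qed

lemma partial_fraction_combine':
  fixes c :: "'a::comm_ring_1"
  assumes "o1 = 1 + c * (A - B)" "w * A = - (x * v)" "w * B = - (y * u)"
  shows "w * o1 = w - c * x * v + c * y * u"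
proof -
  have "w * o1 = w + c * (w * A) - c * (w * B)" by (simp add: assms(1) algebra_simps)
  then show ?thesis unfolding assms(2-3) by (simp add: algebra_simps)
qed

lemma two_residues_combine:
  fixes c :: "'a::comm_ring_1"
  shows "P * (e * w - c * w1 + d * w2) - Q * (e * w' - c * w1' + d * w2') =
    e * (P * w - Q * w') - c * (P * w1 - Q * w1') + d * (P * w2 - Q * w2')"
  by (simp add: algebra_simps)

lemma residues_step:
  fixes c :: "'a::comm_ring_1"
  shows "c * (P * u - Q * v + (e * M - c * u * N + c * v * N')) =
    e * (c * M) + c * u * (P - c * N) - c * v * (Q - c * N')"
  by (simp add: algebra_simps)

lemma two_residues_combine':
  fixes c :: "'a::comm_ring_1"
  shows "P * (w - c * x * w1 + c * y * w2) - Q * (q * w - c * x * w1' + c * y * w2') =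
    w * (P - q * Q) - x * (c * (P * w1 - Q * w1')) + y * (c * (P * w2 - Q * w2'))"
  by (simp add: algebra_simps)

text \<open>\<open>C\<close> is a subfield that keeps track of the admissible coefficients. The
  numerator of \<open>om\<close> enters only through the sum \<open>s\<close> of its two roots, so
  everything built here is literally the same for chains made from either root.\<close>

locale shuffle =
  fixes C :: "'a::field set" and q s :: 'a
  assumes C_1: "1 \<in> C" and C_q: "q \<in> C"
    and C_add: "\<And>x y. x \<in> C \<Longrightarrow> y \<in> C \<Longrightarrow> x + y \<in> C"
    and C_uminus: "\<And>x. x \<in> C \<Longrightarrow> - x \<in> C"
    and C_mult: "\<And>x y. x \<in> C \<Longrightarrow> y \<in> C \<Longrightarrow> x * y \<in> C"
    and C_inverse: "\<And>x. x \<in> C \<Longrightarrow> inverse x \<in> C"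
    and q_nz: "q \<noteq> 0" and q_1: "q \<noteq> 1"
begin

lemma C_diff: "x \<in> C \<Longrightarrow> y \<in> C \<Longrightarrow> x - y \<in> C"
  using C_add[of x "- y"] C_uminus by simp

lemma C_0: "0 \<in> C"
  using C_diff[OF C_1 C_1] by simp

lemma C_power: "x \<in> C \<Longrightarrow> x ^ n \<in> C"
  by (induction n) (auto simp: C_1 C_mult)

lemma C_sum: "(\<And>x. x \<in> A \<Longrightarrow> g x \<in> C) \<Longrightarrow> sum g A \<in> C"
  by (induction A rule: infinite_finite_induct) (auto simp: C_0 C_add)

definition om_num :: "'a \<Rightarrow> 'a \<Rightarrow> 'a" where
  "om_num x y = x\<^sup>2 - s * x * y + y\<^sup>2 / q"

definition om :: "'a \<Rightarrow> 'a \<Rightarrow> 'a" where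
  "om x y = om_num x y / ((x - y) * (x - y / q))"

text \<open>Besides the poles of \<open>om\<close>, the zeros of its numerator are excluded: they
  are the poles of the chain links introduced later.\<close>

definition gen :: "'a set \<Rightarrow> bool" where
  "gen S \<longleftrightarrow> finite S \<and> 0 \<notin> S \<and> (\<forall>x\<in>S. \<forall>y\<in>S. x \<noteq> y \<longrightarrow> x \<noteq> q * y \<and> om_num x y \<noteq> 0)"

lemma gen_finite: "gen S \<Longrightarrow> finite S"
  by (simp add: gen_def)

lemma gen_subset: "gen S \<Longrightarrow> T \<subseteq> S \<Longrightarrow> gen T"
  unfolding gen_def by (meson finite_subset subset_iff)

text \<open>As a function of \<open>b\<close>, \<open>om x b\<close> has simple poles at
  \<open>x\<close> and \<open>q x\<close> and the value 1 both at 0 and at infinity; hence the two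
  pole terms have opposite weights.\<close>

lemma om_partial_fraction:
  assumes "x \<noteq> b" "q * x \<noteq> b"
  shows "om x b = 1 + (1 - s + 1/q) / (1 - 1/q) * (x / (x - b) - x / (x - b / q))"
proof -
  have *: "x - b \<noteq> 0" "x * q - b \<noteq> 0" "q - 1 \<noteq> 0"
    using assms q_1 by (auto simp: mult.commute)
  have 1: "x - b / q = (x * q - b) / q" "1 - 1/q = (q - 1) / q"
    using q_nz by (auto simp: field_simps)
  show ?thesis
    unfolding om_def om_num_def 1
    using * q_nz by (simp add: divide_simps) (simp add: algebra_simps power2_eq_square)
qed

lemma om_scale_right: "om x (q * y) = om y x"
proof -
  have "om_num x (q * y) = q * om_num y x"
    using q_nz by (simp add: om_num_def field_simps power2_eq_square)
  moreover have "(x - q * y) * (x - q * y / q) = q * ((y - x) * (y - x / q))"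
    using q_nz by (simp add: field_simps)
  ultimately show ?thesis
    using q_nz by (simp add: om_def)
qed

lemma om_inverse:
  assumes "x \<noteq> 0" "y \<noteq> 0"
  shows "om (inverse x) (inverse y) = om y x"
proof -
  have "om_num (inverse x) (inverse y) = om_num y x / (x * y)\<^sup>2"
    using assms q_nz by (simp add: om_num_def field_simps power2_eq_square)
  moreover have "(inverse x - inverse y) * (inverse x - inverse y / q) =
      ((y - x) * (y - x / q)) / (x * y)\<^sup>2"
    using assms q_nz by (simp add: divide_simps power2_eq_square algebra_simps)
  ultimately show ?thesis
    using assms by (simp add: om_def)
qed

text \<open>
  The two terms are the residues at \<open>b = x\<close> and at \<open>b = q x\<close>; the latter has the factors
  \<open>om x y\<close> by \<open>om_scale_right\<close>.
\<close>

lemma prod_om_partial_fraction: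
  fixes U :: "'a set"
  defines "c \<equiv> (1 - s + 1/q) / (1 - 1/q)"
  assumes "finite U" "\<And>x y. x \<in> U \<Longrightarrow> y \<in> U \<Longrightarrow> x \<noteq> y \<Longrightarrow> x \<noteq> q * y"
    "\<And>x. x \<in> U \<Longrightarrow> x \<noteq> b \<and> q * x \<noteq> b" "0 \<notin> U"
  shows "c * (\<Sum>x\<in>U. (\<Prod>y\<in>U - {x}. om y x) * (x / (x - b)) -
      (\<Prod>y\<in>U - {x}. om x y) * (x / (x - b / q))) = (\<Prod>y\<in>U. om y b) - 1"
  using assms(2-5)
proof (induction U arbitrary: b rule: finite_induct)
  case empty
  then show ?case by simp
next
  case (insert x U)
  let ?P = "\<lambda>z. \<Prod>y\<in>U - {z}. om y z" and ?Q = "\<lambda>z. \<Prod>y\<in>U - {z}. om z y"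
  let ?M = "\<lambda>b. \<Sum>z\<in>U. ?P z * (z / (z - b)) - ?Q z * (z / (z - b / q))"
  have IH: "c * ?M b = (\<Prod>y\<in>U. om y b) - 1"
    if "\<And>x. x \<in> U \<Longrightarrow> x \<noteq> b \<and> q * x \<noteq> b" for b
    by (rule insert.IH) (use insert.prems that in auto)
  have xU: "z \<noteq> x" "q * z \<noteq> x" "q * x \<noteq> z" "z \<noteq> b" "q * z \<noteq> b" if "z \<in> U" for z
  proof -
    have "x \<noteq> z" using insert.hyps that by auto
    then show "z \<noteq> x" "q * z \<noteq> x" "q * x \<noteq> z" "z \<noteq> b" "q * z \<noteq> b"
      using insert.prems(1)[of x z] insert.prems(1)[of z x] insert.prems(2)[of z] that by auto
  qed
  have xb: "x \<noteq> b" "q * x \<noteq> b" "x \<noteq> 0" using insert.prems by auto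
  have bq: "x - b / q \<noteq> 0" using xb q_nz by (auto simp: field_simps)
  have IHb: "c * ?M b = (\<Prod>y\<in>U. om y b) - 1" by (rule IH) (use xU in auto)
  have IHx: "c * ?M x = (\<Prod>y\<in>U. om y x) - 1" by (rule IH) (use xU in auto)
  have IHqx: "c * ?M (q * x) = (\<Prod>y\<in>U. om x y) - 1"
    using IH[of "q * x"] xU q_nz by (auto simp: om_scale_right)
  have ins: "insert x U - {z} = insert x (U - {z})" if "z \<in> U" for z
    using that insert.hyps by auto
  have P': "(\<Prod>y\<in>insert x U - {z}. om y z) = om x z * ?P z"
    and Q': "(\<Prod>y\<in>insert x U - {z}. om z y) = om z x * ?Q z" if "z \<in> U" for z
    using ins[OF that] insert.hyps by auto
  \<comment> \<open>A product of poles in \<open>z\<close> is split into single poles at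
    \<open>b\<close>, \<open>x\<close> and \<open>q x\<close>. Summed over \<open>U\<close>, the
    last two give the induction hypothesis at \<open>x\<close> and \<open>q x\<close>, which cancels
    the two new residues.\<close>
  have pf1: "om x z * (z / (z - b)) = om x b * (z / (z - b)) - c * (x / (x - b)) * (z / (z - x))
      + c * (x / (x - b / q)) * (z / (z - q * x))" if "z \<in> U" for z
  proof -
    have nz: "x - b \<noteq> 0" "z - b \<noteq> 0" "z - x \<noteq> 0" "z - q * x \<noteq> 0" "x * q - b \<noteq> 0" "x - z \<noteq> 0" "x * q - z \<noteq> 0"
      using xb xU[OF that] by (auto simp: mult.commute)
    have e: "x - b / q = (x * q - b) / q" "x - z / q = (x * q - z) / q"
      using q_nz by (auto simp: field_simps)
    have "x / (x - z) * (z / (z - b)) = x / (x - b) * (z / (z - b)) - x / (x - b) * (z / (z - x))"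
      using nz by (simp add: divide_simps) (simp add: algebra_simps)
    moreover have "x / (x - z / q) * (z / (z - b)) =
        x / (x - b / q) * (z / (z - b)) - x / (x - b / q) * (z / (z - q * x))"
      unfolding e using nz q_nz by (simp add: divide_simps) (simp add: algebra_simps)
    moreover have "om x z = 1 + c * (x / (x - z) - x / (x - z / q))"
      "om x b = 1 + c * (x / (x - b) - x / (x - b / q))"
      using om_partial_fraction[of x z] om_partial_fraction[of x b] xb xU[OF that]
      by (auto simp: c_def)
    ultimately show ?thesis
      by (intro partial_fraction_combine)
  qed
  have pf2: "om z x * (z / (z - b / q)) = om x b * (z / (z - b / q))
      - c * (x / (x - b)) * (z / (z - x / q)) + c * (x / (x - b / q)) * (z / (z - x))" if "z \<in> U" for z
  proof -
    let ?z = "q * z"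
    have nz: "x - b \<noteq> 0" "?z - b \<noteq> 0" "z - x \<noteq> 0" "?z - x \<noteq> 0" "x * q - b \<noteq> 0" "x - z \<noteq> 0" "x - ?z \<noteq> 0"
      using xb xU[OF that] by (auto simp: mult.commute)
    have e: "x - b / q = (x * q - b) / q" "z - b / q = (?z - b) / q" "z - x / q = (?z - x) / q"
      using q_nz by (auto simp: field_simps)
    have "x / (x - ?z) * (z / (z - b / q)) =
        x / (x - b) * (z / (z - b / q)) - x / (x - b) * (z / (z - x / q))"
      unfolding e using nz q_nz by (simp add: divide_simps) (simp add: algebra_simps)
    moreover have "x / (x - z) * (z / (z - b / q)) =
        x / (x - b / q) * (z / (z - b / q)) - x / (x - b / q) * (z / (z - x))"
      unfolding e using nz q_nz by (simp add: divide_simps) (simp add: algebra_simps)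
    moreover have "om z x = 1 + c * (x / (x - ?z) - x / (x - z))"
      using om_partial_fraction[of x ?z] xU[OF that] q_nz
      by (simp add: om_scale_right c_def)
    moreover have "om x b = 1 + c * (x / (x - b) - x / (x - b / q))"
      using om_partial_fraction[of x b] xb by (auto simp: c_def)
    ultimately show ?thesis
      by (intro partial_fraction_combine)
  qed
  have "(\<Sum>z\<in>insert x U. (\<Prod>y\<in>insert x U - {z}. om y z) * (z / (z - b)) -
      (\<Prod>y\<in>insert x U - {z}. om z y) * (z / (z - b / q))) =
      (\<Prod>y\<in>U. om y x) * (x / (x - b)) - (\<Prod>y\<in>U. om x y) * (x / (x - b / q)) +
      (\<Sum>z\<in>U. ?P z * (om x z * (z / (z - b))) - ?Q z * (om z x * (z / (z - b / q))))"
    using insert.hyps P' Q' by (simp add: mult_ac)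
  also have "(\<Sum>z\<in>U. ?P z * (om x z * (z / (z - b))) - ?Q z * (om z x * (z / (z - b / q)))) =
     (\<Sum>z\<in>U. om x b * (?P z * (z / (z - b)) - ?Q z * (z / (z - b / q)))
       - c * (x / (x - b)) * (?P z * (z / (z - x)) - ?Q z * (z / (z - x / q)))
       + c * (x / (x - b / q)) * (?P z * (z / (z - q * x)) - ?Q z * (z / (z - q * x / q))))"
  proof (intro sum.cong refl)
    have "q * x / q = x" using q_nz by simp
    then show "?P z * (om x z * (z / (z - b))) - ?Q z * (om z x * (z / (z - b / q))) =
      om x b * (?P z * (z / (z - b)) - ?Q z * (z / (z - b / q)))
       - c * (x / (x - b)) * (?P z * (z / (z - x)) - ?Q z * (z / (z - x / q)))
       + c * (x / (x - b / q)) * (?P z * (z / (z - q * x)) - ?Q z * (z / (z - q * x / q)))"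
      if "z \<in> U" for z
      by (simp only: pf1[OF that] pf2[OF that] two_residues_combine)
  qed
  also have "\<dots> = om x b * ?M b - c * (x / (x - b)) * ?M x + c * (x / (x - b / q)) * ?M (q * x)"
    by (simp only: sum_distrib_left) (simp only: sum.distrib sum_subtractf)
  finally have step: "(\<Sum>z\<in>insert x U. (\<Prod>y\<in>insert x U - {z}. om y z) * (z / (z - b)) -
      (\<Prod>y\<in>insert x U - {z}. om z y) * (z / (z - b / q))) =
      (\<Prod>y\<in>U. om y x) * (x / (x - b)) - (\<Prod>y\<in>U. om x y) * (x / (x - b / q)) +
      (om x b * ?M b - c * (x / (x - b)) * ?M x + c * (x / (x - b / q)) * ?M (q * x))" .
  have "c * (\<Sum>z\<in>insert x U. (\<Prod>y\<in>insert x U - {z}. om y z) * (z / (z - b)) -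
      (\<Prod>y\<in>insert x U - {z}. om z y) * (z / (z - b / q))) =
     om x b * (c * ?M b) + c * (x / (x - b)) * ((\<Prod>y\<in>U. om y x) - c * ?M x)
       - c * (x / (x - b / q)) * ((\<Prod>y\<in>U. om x y) - c * ?M (q * x))"
    unfolding step by (rule residues_step)
  also have "\<dots> = om x b * (\<Prod>y\<in>U. om y b) - om x b + c * (x / (x - b) - x / (x - b / q))"
    unfolding IHb IHx IHqx by (simp add: algebra_simps)
  also have "\<dots> = (\<Prod>y\<in>insert x U. om y b) - 1"
    using om_partial_fraction[of x b] xb insert.hyps by (simp add: c_def)
  finally show ?case .
qed

text \<open>For a nonzero weight \<open>(1 - s + 1/q) / (1 - 1/q)\<close> this is the coefficient of
  1/b at infinity in the preceding identity; the induction on \<open>U\<close> avoids expansions and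
  covers weight 0 as well. The two products belong to right and left shuffle multiplication by one
  variable.\<close>

lemma sum_om_commutator:
  assumes "finite U" "\<And>x y. x \<in> U \<Longrightarrow> y \<in> U \<Longrightarrow> x \<noteq> y \<Longrightarrow> x \<noteq> q * y" "0 \<notin> U"
  shows "(\<Sum>x\<in>U. x * ((\<Prod>y\<in>U - {x}. om y x) - q * (\<Prod>y\<in>U - {x}. om x y))) = (1 - q) * (\<Sum>x\<in>U. x)"
  using assms
proof (induction U rule: finite_induct)
  case empty
  then show ?case by simp
next
  case (insert x U)
  define c where "c = (1 - s + 1/q) / (1 - 1/q)"
  let ?P = "\<lambda>z. \<Prod>y\<in>U - {z}. om y z" and ?Q = "\<lambda>z. \<Prod>y\<in>U - {z}. om z y"
  let ?M = "\<lambda>b. \<Sum>z\<in>U. ?P z * (z / (z - b)) - ?Q z * (z / (z - b / q))"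
  have xU: "z \<noteq> x" "q * z \<noteq> x" "q * x \<noteq> z" if "z \<in> U" for z
  proof -
    have "x \<noteq> z" using insert.hyps that by auto
    then show "z \<noteq> x" "q * z \<noteq> x" "q * x \<noteq> z"
      using insert.prems(1)[of x z] insert.prems(1)[of z x] that by auto
  qed
  have M: "c * ?M b = (\<Prod>y\<in>U. om y b) - 1"
    if "\<And>x. x \<in> U \<Longrightarrow> x \<noteq> b \<and> q * x \<noteq> b" for b
    unfolding c_def by (rule prod_om_partial_fraction) (use insert.hyps insert.prems that in auto)
  have Mx: "c * ?M x = (\<Prod>y\<in>U. om y x) - 1" by (rule M) (use xU in auto)
  have Mqx: "c * ?M (q * x) = (\<Prod>y\<in>U. om x y) - 1"
    using M[of "q * x"] xU q_nz by (auto simp: om_scale_right)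
  have ins: "insert x U - {z} = insert x (U - {z})" if "z \<in> U" for z
    using that insert.hyps by auto
  have P': "(\<Prod>y\<in>insert x U - {z}. om y z) = om x z * ?P z"
    and Q': "(\<Prod>y\<in>insert x U - {z}. om z y) = om z x * ?Q z" if "z \<in> U" for z
    using ins[OF that] insert.hyps by auto
  have pf1: "z * om x z = z - c * x * (z / (z - x)) + c * (q * x) * (z / (z - q * x))" if "z \<in> U" for z
  proof -
    have nz: "x - z \<noteq> 0" "z - x \<noteq> 0" "z - q * x \<noteq> 0" "x * q - z \<noteq> 0"
      using xU[OF that] by (auto simp: mult.commute)
    have e: "x - z / q = (x * q - z) / q" using q_nz by (auto simp: field_simps)
    have "z * (x / (x - z)) = - (x * (z / (z - x)))" "z * (x / (x - z / q)) = - (q * x * (z / (z - q * x)))"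
      unfolding e using nz q_nz by (simp_all add: divide_simps) (simp_all add: algebra_simps)
    moreover have "om x z = 1 + c * (x / (x - z) - x / (x - z / q))"
      using om_partial_fraction[of x z] xU[OF that] by (auto simp: c_def)
    ultimately show ?thesis
      by (intro partial_fraction_combine')
  qed
  have pf2: "q * z * om z x = q * z - c * x * (z / (z - x / q)) + c * (q * x) * (z / (z - x))" if "z \<in> U" for z
  proof -
    have nz: "x - z \<noteq> 0" "z - x \<noteq> 0" "x - q * z \<noteq> 0" "q * z - x \<noteq> 0"
      using xU[OF that] by auto
    have e: "z - x / q = (q * z - x) / q" using q_nz by (auto simp: field_simps)
    have "q * z * (x / (x - q * z)) = - (x * (z / (z - x / q)))" "q * z * (x / (x - z)) = - (q * x * (z / (z - x)))"
      unfolding e using nz q_nz by (simp_all add: divide_simps) (simp_all add: algebra_simps)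
    moreover have "om z x = 1 + c * (x / (x - q * z) - x / (x - z))"
      using om_partial_fraction[of x "q * z"] xU[OF that] q_nz
      by (simp add: om_scale_right c_def)
    ultimately show ?thesis
      by (intro partial_fraction_combine')
  qed
  have "(\<Sum>z\<in>insert x U. z * ((\<Prod>y\<in>insert x U - {z}. om y z) - q * (\<Prod>y\<in>insert x U - {z}. om z y))) =
      x * ((\<Prod>y\<in>U. om y x) - q * (\<Prod>y\<in>U. om x y)) +
      (\<Sum>z\<in>U. ?P z * (z * om x z) - ?Q z * (q * z * om z x))"
    using insert.hyps P' Q' by (simp add: algebra_simps)
  also have "(\<Sum>z\<in>U. ?P z * (z * om x z) - ?Q z * (q * z * om z x)) =
     (\<Sum>z\<in>U. z * (?P z - q * ?Q z) - x * (c * (?P z * (z / (z - x)) - ?Q z * (z / (z - x / q))))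
       + q * x * (c * (?P z * (z / (z - q * x)) - ?Q z * (z / (z - q * x / q)))))"
  proof (intro sum.cong refl)
    have "q * x / q = x" using q_nz by simp
    then show "?P z * (z * om x z) - ?Q z * (q * z * om z x) =
      z * (?P z - q * ?Q z) - x * (c * (?P z * (z / (z - x)) - ?Q z * (z / (z - x / q))))
       + q * x * (c * (?P z * (z / (z - q * x)) - ?Q z * (z / (z - q * x / q))))"
      if "z \<in> U" for z
      by (simp only: pf1[OF that] pf2[OF that] two_residues_combine')
  qed
  also have "\<dots> = (\<Sum>z\<in>U. z * (?P z - q * ?Q z)) - x * (c * ?M x) + q * x * (c * ?M (q * x))"
    by (simp only: sum_distrib_left) (simp only: sum.distrib sum_subtractf)
  also have "\<dots> = (1 - q) * (\<Sum>z\<in>U. z) - x * (c * ?M x) + q * x * (c * ?M (q * x))"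
    using insert.IH insert.prems by simp
  finally show ?case
    unfolding Mx Mqx using insert.hyps by (simp add: algebra_simps)
qed

text \<open>Inverting all points exchanges the arguments of \<open>om\<close>, so the two products
  trade places.\<close>

lemma sum_om_commutator_inverse:
  assumes "finite U" "\<And>x y. x \<in> U \<Longrightarrow> y \<in> U \<Longrightarrow> x \<noteq> y \<Longrightarrow> x \<noteq> q * y" "0 \<notin> U"
  shows "(\<Sum>x\<in>U. inverse x * ((\<Prod>y\<in>U - {x}. om x y) - q * (\<Prod>y\<in>U - {x}. om y x))) =
    (1 - q) * (\<Sum>x\<in>U. inverse x)"
proof -
  have inj: "inj_on inverse A" for A :: "'a set" by (auto simp: inj_on_def)
  have im: "inverse ` U - {inverse x} = inverse ` (U - {x})" for x by auto
  have "(\<Sum>x\<in>inverse ` U. x * ((\<Prod>y\<in>inverse ` U - {x}. om y x) - q * (\<Prod>y\<in>inverse ` U - {x}. om x y))) =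
    (1 - q) * (\<Sum>x\<in>inverse ` U. x)"
  proof (rule sum_om_commutator)
    fix x y assume "x \<in> inverse ` U" "y \<in> inverse ` U" "x \<noteq> y"
    then obtain u v where uv: "u \<in> U" "v \<in> U" "x = inverse u" "y = inverse v" "u \<noteq> v" by auto
    then have "v \<noteq> q * u" "u \<noteq> 0" "v \<noteq> 0" using assms(2)[of v u] assms(3) by auto
    moreover have "v = q * u" if "inverse u = q * inverse v"
      using that \<open>u \<noteq> 0\<close> \<open>v \<noteq> 0\<close> by (simp add: field_simps)
    ultimately show "x \<noteq> q * y" unfolding uv(3,4) by blast
  qed (use assms in auto)
  also have "(\<Sum>x\<in>inverse ` U. x * ((\<Prod>y\<in>inverse ` U - {x}. om y x) - q * (\<Prod>y\<in>inverse ` U - {x}. om x y))) =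
     (\<Sum>x\<in>U. inverse x * ((\<Prod>y\<in>U - {x}. om x y) - q * (\<Prod>y\<in>U - {x}. om y x)))"
    unfolding sum.reindex[OF inj] o_def im prod.reindex[OF inj]
    by (intro sum.cong refl arg_cong2[where f = "(*)"] arg_cong2[where f = "(-)"] prod.cong)
       (use assms in \<open>auto intro!: om_inverse\<close>)
  finally show ?thesis by (simp add: sum.reindex[OF inj] o_def)
qed

end

section \<open>Shuffle products of symmetric functions\<close>

lemma sum_permutations_of_set_Cons:
  assumes "finite S" "S \<noteq> {}"
  shows "(\<Sum>l\<in>permutations_of_set S. f l) = (\<Sum>x\<in>S. \<Sum>l\<in>permutations_of_set (S - {x}). f (x # l))"
proof -
  have "(\<Sum>l\<in>permutations_of_set S. f l) =
      (\<Sum>x\<in>S. \<Sum>l\<in>(\<lambda>xs. x # xs) ` permutations_of_set (S - {x}). f l)"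
    unfolding permutations_of_set_nonempty[OF assms(2)]
    by (rule sum.UNION_disjoint) (use assms in auto)
  then show ?thesis by (simp add: sum.reindex o_def)
qed

lemma sum_permutations_of_set_append:
  assumes "finite S" "j \<le> card S"
  shows "(\<Sum>l\<in>permutations_of_set S. f l) =
    (\<Sum>I | I \<subseteq> S \<and> card I = j. \<Sum>l1\<in>permutations_of_set I. \<Sum>l2\<in>permutations_of_set (S - I). f (l1 @ l2))"
proof -
  let ?I = "{I. I \<subseteq> S \<and> card I = j}"
  have fin: "finite ?I" using assms by auto
  have "(\<Sum>I\<in>?I. \<Sum>l1\<in>permutations_of_set I. \<Sum>l2\<in>permutations_of_set (S - I). f (l1 @ l2)) =
     (\<Sum>I\<in>?I. \<Sum>(l1, l2)\<in>permutations_of_set I \<times> permutations_of_set (S - I). f (l1 @ l2))"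
    by (simp add: sum.cartesian_product)
  also have "\<dots> = (\<Sum>(I, l1, l2)\<in>(SIGMA I:?I. permutations_of_set I \<times> permutations_of_set (S - I)). f (l1 @ l2))"
    by (subst sum.Sigma) (use fin in auto)
  also have "\<dots> = (\<Sum>l\<in>permutations_of_set S. f l)"
  proof (rule sum.reindex_bij_witness[where i = "\<lambda>l. (set (take j l), take j l, drop j l)"
        and j = "\<lambda>(I, l1, l2). l1 @ l2"], goal_cases)
    case (1 a)
    then obtain I l1 l2 where a: "a = (I, l1, l2)" "I \<subseteq> S" "card I = j"
      "l1 \<in> permutations_of_set I" "l2 \<in> permutations_of_set (S - I)" by auto
    then have "length l1 = j" "set l1 = I"
      by (auto simp: length_finite_permutations_of_set permutations_of_set_def)
    then show ?case using a by auto
  next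
    case (2 a)
    then show ?case by (auto simp: permutations_of_set_def)
  next
    case (3 l)
    then show ?case by simp
  next
    case (4 l)
    then have l: "set l = S" "distinct l" by (auto simp: permutations_of_set_def)
    have "card (set (take j l)) = j"
      using l assms by (simp add: distinct_card flip: distinct_card[of l])
    moreover have "set l = set (take j l) \<union> set (drop j l)"
      by (metis append_take_drop_id set_append)
    moreover have "set (take j l) \<inter> set (drop j l) = {}"
      using l by (metis append_take_drop_id distinct_append)
    ultimately show ?case
      using l by (auto simp: permutations_of_set_def)
  next
    case (5 a)
    then show ?case by auto
  qed
  finally show ?thesis ..
qed

context shuffle
begin

text \<open>
  A symmetric function of \<open>k\<close> variables is represented by a function of \<open>k\<close>-element sets, and
  evaluated only at sets of pairwise distinct points satisfying \<open>gen\<close>.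
\<close>

fun Om :: "'a list \<Rightarrow> 'a" where
  "Om [] = 1"
| "Om (x # l) = (\<Prod>y\<in>set l. om x y) * Om l"

definition symm :: "('a list \<Rightarrow> 'a) \<Rightarrow> 'a set \<Rightarrow> 'a" where
  "symm K S = (\<Sum>l\<in>permutations_of_set S. K l * Om l)"

definition star :: "nat \<Rightarrow> ('a set \<Rightarrow> 'a) \<Rightarrow> ('a set \<Rightarrow> 'a) \<Rightarrow> 'a set \<Rightarrow> 'a" where
  "star j F G S = (\<Sum>I | I \<subseteq> S \<and> card I = j. F I * G (S - I) * (\<Prod>x\<in>I. \<Prod>y\<in>S - I. om x y))"

lemma Om_append:
  "distinct (l1 @ l2) \<Longrightarrow> Om (l1 @ l2) = Om l1 * Om l2 * (\<Prod>x\<in>set l1. \<Prod>y\<in>set l2. om x y)"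
  by (induction l1) (auto simp: prod.union_disjoint mult_ac)

lemma symm_cong: "(\<And>l. l \<in> permutations_of_set S \<Longrightarrow> K l = L l) \<Longrightarrow> symm K S = symm L S"
  by (auto simp: symm_def intro!: sum.cong)

lemma star_cong:
  assumes "\<And>I. I \<subseteq> S \<Longrightarrow> card I = j \<Longrightarrow> F I = F' I" "\<And>I. I \<subseteq> S \<Longrightarrow> card I = j \<Longrightarrow> G (S - I) = G' (S - I)"
  shows "star j F G S = star j F' G' S"
  unfolding star_def by (intro sum.cong refl) (use assms in auto)

text \<open>An ordering of \<open>S\<close> is a \<open>j\<close>-subset with orderings of both
  halves, and \<open>Om\<close> of a concatenation supplies exactly the cross factors. Shuffle
  multiplication is thus concatenation before symmetrising.\<close>

lemma star_symm:
  assumes "finite S" "j \<le> card S"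
  shows "star j (symm K) (symm L) S = symm (\<lambda>l. K (take j l) * L (drop j l)) S"
proof -
  have "symm (\<lambda>l. K (take j l) * L (drop j l)) S =
     (\<Sum>I | I \<subseteq> S \<and> card I = j. \<Sum>l1\<in>permutations_of_set I. \<Sum>l2\<in>permutations_of_set (S - I).
        K l1 * Om l1 * (L l2 * Om l2) * (\<Prod>x\<in>I. \<Prod>y\<in>S - I. om x y))"
    unfolding symm_def sum_permutations_of_set_append[OF assms]
  proof (intro sum.cong refl, goal_cases)
    case (1 I l1 l2)
    then have *: "set l1 = I" "set l2 = S - I" "distinct l1" "distinct l2" "length l1 = j"
      by (auto simp: permutations_of_set_def distinct_card[symmetric])
    then show ?case by (simp add: Om_append mult_ac)
  qed
  also have "\<dots> = star j (symm K) (symm L) S"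
    unfolding star_def symm_def sum_product
    by (simp add: sum_distrib_right)
  finally show ?thesis ..
qed

lemma star_0: "finite S \<Longrightarrow> star 0 F G S = F {} * G S"
proof -
  assume "finite S"
  then have "{I. I \<subseteq> S \<and> card I = 0} = {{}}" by (auto dest: finite_subset)
  then show ?thesis by (simp add: star_def)
qed

lemma star_1:
  assumes "finite S"
  shows "star 1 F G S = (\<Sum>x\<in>S. F {x} * G (S - {x}) * (\<Prod>y\<in>S - {x}. om x y))"
proof -
  have *: "{I. I \<subseteq> S \<and> card I = 1} = (\<lambda>x. {x}) ` S" by (auto simp: card_1_singleton_iff)
  show ?thesis unfolding star_def * by (simp add: sum.reindex)
qed

lemma star_card_minus_1:
  assumes "finite S" "card S = Suc j"
  shows "star j F G S = (\<Sum>x\<in>S. F (S - {x}) * G {x} * (\<Prod>y\<in>S - {x}. om y x))"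
proof -
  have "(\<Sum>x\<in>S. F (S - {x}) * G {x} * (\<Prod>y\<in>S - {x}. om y x)) =
    (\<Sum>I\<in>(\<lambda>x. S - {x}) ` S. F I * G (S - I) * (\<Prod>x\<in>I. \<Prod>y\<in>S - I. om x y))"
    by (subst sum.reindex) (auto simp: inj_on_def Diff_Diff_Int Int_absorb1 intro!: sum.cong)
  also have "(\<lambda>x. S - {x}) ` S = {I. I \<subseteq> S \<and> card I = j}"
  proof (intro equalityI subsetI)
    fix I assume "I \<in> {I. I \<subseteq> S \<and> card I = j}"
    then have I: "I \<subseteq> S" "card (S - I) = 1" using assms by (auto simp: card_Diff_subset finite_subset)
    then obtain x where "S - I = {x}" by (auto simp: card_1_singleton_iff)
    then have "I = S - {x}" "x \<in> S" using I by auto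
    then show "I \<in> (\<lambda>x. S - {x}) ` S" by blast
  qed (use assms in auto)
  finally show ?thesis unfolding star_def ..
qed

section \<open>The span of the symmetrised monomials\<close>

definition mon :: "int list \<Rightarrow> 'a list \<Rightarrow> 'a" where
  "mon w l = (\<Prod>(a, x)\<leftarrow>zip w l. x powi a)"

definition words :: "nat \<Rightarrow> int list set" where
  "words k = {w. set w \<subseteq> {-1, 0, 1} \<and> length w = k}"

text \<open>The coefficients are chosen before the set of points. The same combination can therefore
  be evaluated at deformed points and at the points of every multiset of shifts.\<close>

definition inA :: "nat \<Rightarrow> ('a set \<Rightarrow> 'a) \<Rightarrow> bool" where
  "inA k F \<longleftrightarrow> (\<exists>c. (\<forall>w. c w \<in> C) \<and>
     (\<forall>S. gen S \<and> card S = k \<longrightarrow> F S = (\<Sum>w\<in>words k. c w * symm (mon w) S)))"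

lemma finite_words: "finite (words k)"
  unfolding words_def by (rule finite_lists_length_eq) auto

lemma inA_cong:
  assumes "inA k F" "\<And>S. gen S \<Longrightarrow> card S = k \<Longrightarrow> F S = G S"
  shows "inA k G"
  using assms unfolding inA_def by metis

lemma inA_0: "inA k (\<lambda>_. 0)"
  unfolding inA_def by (rule exI[of _ "\<lambda>_. 0"]) (auto simp: C_0)

lemma inA_add:
  assumes "inA k F" "inA k G"
  shows "inA k (\<lambda>S. F S + G S)"
proof -
  from assms obtain c d where
    "\<forall>w. c w \<in> C" "\<forall>S. gen S \<and> card S = k \<longrightarrow> F S = (\<Sum>w\<in>words k. c w * symm (mon w) S)"
    "\<forall>w. d w \<in> C" "\<forall>S. gen S \<and> card S = k \<longrightarrow> G S = (\<Sum>w\<in>words k. d w * symm (mon w) S)"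
    unfolding inA_def by blast
  then show ?thesis
    unfolding inA_def
    by (intro exI[of _ "\<lambda>w. c w + d w"]) (auto simp: C_add sum.distrib algebra_simps)
qed

lemma inA_scale:
  assumes "inA k F" "a \<in> C"
  shows "inA k (\<lambda>S. a * F S)"
proof -
  from assms obtain c where
    "\<forall>w. c w \<in> C" "\<forall>S. gen S \<and> card S = k \<longrightarrow> F S = (\<Sum>w\<in>words k. c w * symm (mon w) S)"
    unfolding inA_def by blast
  then show ?thesis
    unfolding inA_def using assms(2)
    by (intro exI[of _ "\<lambda>w. a * c w"]) (auto simp: C_mult sum_distrib_left mult_ac)
qed

lemma inA_diff:
  assumes "inA k F" "inA k G"
  shows "inA k (\<lambda>S. F S - G S)"
  using inA_add[OF assms(1) inA_scale[OF assms(2) C_uminus[OF C_1]]] by simp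

lemma inA_scaleD:
  assumes "inA k (\<lambda>S. a * F S)" "a \<in> C" "a \<noteq> 0"
  shows "inA k F"
  using inA_scale[OF assms(1) C_inverse[OF assms(2)]] assms(3)
  by (simp flip: mult.assoc)

lemma inA_sum: "(\<And>i. i \<in> A \<Longrightarrow> inA k (F i)) \<Longrightarrow> inA k (\<lambda>S. \<Sum>i\<in>A. F i S)"
  by (induction A rule: infinite_finite_induct) (auto intro: inA_0 inA_add)

lemma mon_append:
  "mon (w1 @ w2) l = mon w1 (take (length w1) l) * mon w2 (drop (length w1) l)"
  by (simp add: mon_def zip_append1)

lemma inA_star:
  assumes "inA j F" "inA m G"
  shows "inA (j + m) (star j F G)"
proof -
  from assms obtain c d where c: "\<And>w. c w \<in> C"
    "\<And>S. gen S \<Longrightarrow> card S = j \<Longrightarrow> F S = (\<Sum>w\<in>words j. c w * symm (mon w) S)" and d: "\<And>w. d w \<in> C"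
    "\<And>S. gen S \<Longrightarrow> card S = m \<Longrightarrow> G S = (\<Sum>w\<in>words m. d w * symm (mon w) S)"
    unfolding inA_def by blast
  have "star j F G S = (\<Sum>w\<in>words (j + m). (c (take j w) * d (drop j w)) * symm (mon w) S)"
    if S: "gen S" "card S = j + m" for S
  proof -
    have "star j F G S = star j (\<lambda>S. \<Sum>w\<in>words j. c w * symm (mon w) S) (\<lambda>S. \<Sum>w\<in>words m. d w * symm (mon w) S) S"
    proof (rule star_cong, goal_cases)
      case (1 I)
      show ?case by (rule c(2)[OF gen_subset[OF S(1) 1(1)] 1(2)])
    next
      case (2 I)
      have "card (S - I) = m"
        using 2 S gen_finite[OF S(1)] by (simp add: card_Diff_subset finite_subset)
      then show ?case by (intro d(2) gen_subset[OF S(1)]) auto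
    qed
    also have "\<dots> = (\<Sum>w1\<in>words j. \<Sum>w2\<in>words m. c w1 * d w2 * star j (symm (mon w1)) (symm (mon w2)) S)"
    proof -
      let ?I = "{I. I \<subseteq> S \<and> card I = j}"
      let ?t = "\<lambda>I w1 w2. c w1 * d w2 * (symm (mon w1) I * symm (mon w2) (S - I) * (\<Prod>x\<in>I. \<Prod>y\<in>S - I. om x y))"
      have "(\<Sum>I\<in>?I. (\<Sum>w\<in>words j. c w * symm (mon w) I) * (\<Sum>w\<in>words m. d w * symm (mon w) (S - I)) *
          (\<Prod>x\<in>I. \<Prod>y\<in>S - I. om x y)) = (\<Sum>I\<in>?I. \<Sum>w1\<in>words j. \<Sum>w2\<in>words m. ?t I w1 w2)"
        unfolding sum_distrib_right by (intro sum.cong refl) (simp add: sum_distrib_left mult_ac)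
      also have "\<dots> = (\<Sum>w1\<in>words j. \<Sum>I\<in>?I. \<Sum>w2\<in>words m. ?t I w1 w2)" by (rule sum.swap)
      also have "\<dots> = (\<Sum>w1\<in>words j. \<Sum>w2\<in>words m. \<Sum>I\<in>?I. ?t I w1 w2)"
        by (intro sum.cong refl sum.swap)
      finally show ?thesis unfolding star_def sum_distrib_left .
    qed
    also have "\<dots> = (\<Sum>w1\<in>words j. \<Sum>w2\<in>words m. c w1 * d w2 * symm (mon (w1 @ w2)) S)"
    proof (intro sum.cong refl arg_cong2[where f = "(*)"], goal_cases)
      case (1 w1 w2)
      then have "length w1 = j" by (simp add: words_def)
      then show ?case using S gen_finite[OF S(1)] by (auto simp: star_symm mon_append[abs_def])
    qed
    also have "\<dots> = (\<Sum>(w1, w2)\<in>words j \<times> words m. c w1 * d w2 * symm (mon (w1 @ w2)) S)"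
      by (simp add: sum.cartesian_product)
    also have "\<dots> = (\<Sum>w\<in>words (j + m). (c (take j w) * d (drop j w)) * symm (mon w) S)"
      by (rule sum.reindex_bij_witness[where i = "\<lambda>w. (take j w, drop j w)" and j = "\<lambda>(w1, w2). w1 @ w2"])
         (auto simp: words_def dest: in_set_takeD in_set_dropD)
    finally show ?thesis .
  qed
  then show ?thesis
    unfolding inA_def using c(1) d(1)
    by (intro exI[of _ "\<lambda>w. c (take j w) * d (drop j w)"]) (auto simp: C_mult)
qed

lemma inA_star':
  assumes "inA j F" "inA m G" "j + m = k"
  shows "inA k (star j F G)"
  using inA_star[OF assms(1,2)] assms(3) by simp

lemma inA_letter:
  assumes "a \<in> {-1, 0, 1}"
  shows "inA 1 (\<lambda>S. \<Sum>x\<in>S. x powi a)"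
proof -
  have "(\<Sum>x\<in>S. x powi a) = (\<Sum>w\<in>words 1. (if w = [a] then 1 else 0) * symm (mon w) S)"
    if "card S = 1" for S
  proof -
    from that obtain x where "S = {x}" by (auto simp: card_1_singleton_iff)
    moreover have "[a] \<in> words 1" using assms by (simp add: words_def)
    then have "(\<Sum>w\<in>words 1. (if w = [a] then 1 else 0) * symm (mon w) S) = symm (mon [a]) S"
      using finite_words by (simp add: if_distrib[of "\<lambda>c. c * _"] if_distribR sum.delta' cong: if_cong)
    ultimately show ?thesis by (simp add: symm_def mon_def)
  qed
  then show ?thesis
    unfolding inA_def by (intro exI[of _ "\<lambda>w. if w = [a] then 1 else 0"]) (auto simp: C_0 C_1)
qed

definition e1 :: "'a set \<Rightarrow> 'a" where "e1 S = (\<Sum>x\<in>S. x)"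
definition e' :: "'a set \<Rightarrow> 'a" where "e' S = (\<Sum>x\<in>S. inverse x)"

lemma inA_base: "inA 1 (\<lambda>_. 1)" "inA 1 e1" "inA 1 e'"
proof -
  show "inA 1 (\<lambda>_. 1)" by (rule inA_cong[OF inA_letter[of 0]]) auto
  show "inA 1 e1" by (rule inA_cong[OF inA_letter[of 1]]) (auto simp: e1_def)
  show "inA 1 e'"
    by (rule inA_cong[OF inA_letter[of "-1"]]) (auto simp: e'_def power_int_minus)
qed

text \<open>Multiplying the constant 1 by one variable from the left and from the right gives two
  elements of the span whose \<open>q\<close>-commutator is \<open>(1 - q) * e1\<close>. For
  \<open>e'\<close> the factor \<open>q\<close> sits on the other product, since inversion swaps the
  sides.\<close>

lemma inA_e1_step:
  assumes "inA j (\<lambda>_. 1)"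
  shows "inA (Suc j) e1" "inA (Suc j) e'"
proof -
  have A: "inA (Suc j) (star j (\<lambda>_. 1) e1)" "inA (Suc j) (star 1 e1 (\<lambda>_. 1))"
    "inA (Suc j) (star j (\<lambda>_. 1) e')" "inA (Suc j) (star 1 e' (\<lambda>_. 1))"
    using assms inA_base by (auto intro!: inA_star' simp del: One_nat_def)
  have C': "1 - q \<in> C" by (intro C_diff C_1 C_q)
  have gen': "finite S" "0 \<notin> S" "\<And>x y. x \<in> S \<Longrightarrow> y \<in> S \<Longrightarrow> x \<noteq> y \<Longrightarrow> x \<noteq> q * y" if "gen S" for S
    using that by (auto simp: gen_def)
  have "inA (Suc j) (\<lambda>S. (1 - q) * e1 S)"
  proof (rule inA_cong[OF inA_diff[OF A(1) inA_scale[OF A(2) C_q]]], goal_cases)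
    case (1 S)
    show ?case
      using sum_om_commutator[of S] gen'[OF 1(1)] 1
      by (simp add: star_1[unfolded One_nat_def] star_card_minus_1 e1_def sum_distrib_left algebra_simps flip: sum_subtractf)
  qed
  then show "inA (Suc j) e1" by (rule inA_scaleD) (use q_1 C' in auto)
  have "inA (Suc j) (\<lambda>S. (1 - q) * e' S)"
  proof (rule inA_cong[OF inA_diff[OF A(4) inA_scale[OF A(3) C_q]]], goal_cases)
    case (1 S)
    show ?case
      using sum_om_commutator_inverse[of S] gen'[OF 1(1)] 1
      by (simp add: star_1[unfolded One_nat_def] star_card_minus_1 e'_def sum_distrib_left algebra_simps flip: sum_subtractf)
  qed
  then show "inA (Suc j) e'" by (rule inA_scaleD) (use q_1 C' in auto)
qed

end

section \<open>Chains\<close>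

text \<open>
  The residue theorem for \<open>(\<Prod>i\<in>U. (i - a w) / (i - w)) / (w - b)\<close> as a function of \<open>w\<close>.
\<close>

lemma sum_one_sided_residues:
  fixes a b :: "'a::field"
  assumes "finite U" "b \<notin> U"
  shows "(1 - a) * (\<Sum>x\<in>U. (\<Prod>i\<in>U - {x}. (i - a * x) / (i - x)) * (x / (x - b))) =
    (\<Prod>i\<in>U. (i - a * b) / (i - b)) - a ^ card U"
  using assms
proof (induction U arbitrary: b rule: finite_induct)
  case empty
  then show ?case by simp
next
  case (insert x U)
  let ?P = "\<lambda>z. \<Prod>i\<in>U - {z}. (i - a * z) / (i - z)" and ?R = "\<lambda>b. \<Prod>i\<in>U. (i - a * b) / (i - b)"
  let ?L = "\<lambda>b. \<Sum>z\<in>U. ?P z * (z / (z - b))"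
  have ins: "insert x U - {z} = insert x (U - {z})" if "z \<in> U" for z
    using that insert.hyps by auto
  have xb: "x - b \<noteq> 0" using insert.prems by auto
  let ?A = "(x - a * b) / (x - b)" and ?B = "x / (x - b)"
  have pf: "?P z * ((x - a * z) / (x - z) * (z / (z - b))) =
      ?A * (?P z * (z / (z - b))) - (1 - a) * ?B * (?P z * (z / (z - x)))" if "z \<in> U" for z
  proof -
    have nz: "x - z \<noteq> 0" "z - x \<noteq> 0" "z - b \<noteq> 0" using that insert by auto
    have "(x - a * z) / (x - z) * (z / (z - b)) = ?A * (z / (z - b)) - (1 - a) * ?B * (z / (z - x))"
      using nz xb by (simp add: divide_simps) (simp add: algebra_simps)
    then show ?thesis by (simp only: right_diff_distrib mult_ac)
  qed
  have "(\<Sum>z\<in>insert x U. (\<Prod>i\<in>insert x U - {z}. (i - a * z) / (i - z)) * (z / (z - b))) =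
      ?R x * ?B + (\<Sum>z\<in>U. ?P z * ((x - a * z) / (x - z) * (z / (z - b))))"
    using insert.hyps ins by (simp add: mult_ac)
  also have "(\<Sum>z\<in>U. ?P z * ((x - a * z) / (x - z) * (z / (z - b)))) = ?A * ?L b - (1 - a) * ?B * ?L x"
    using pf by (simp only: sum_distrib_left sum_subtractf[symmetric] cong: sum.cong)
  finally have step: "(\<Sum>z\<in>insert x U. (\<Prod>i\<in>insert x U - {z}. (i - a * z) / (i - z)) * (z / (z - b))) =
     ?R x * ?B + (?A * ?L b - (1 - a) * ?B * ?L x)" .
  have alg: "(1 - a) * (R * B + (A * L - (1 - a) * B * M)) =
      A * ((1 - a) * L) + (1 - a) * B * (R - (1 - a) * M)" for R B A L M :: 'a
    by (simp add: algebra_simps)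
  have IH: "(1 - a) * ?L b = ?R b - a ^ card U" "(1 - a) * ?L x = ?R x - a ^ card U"
    by (intro insert.IH; use insert in auto)+
  have AB: "?A - (1 - a) * ?B = a"
    using xb by (simp add: divide_simps) (simp add: algebra_simps)
  have "(1 - a) * (?R x * ?B + (?A * ?L b - (1 - a) * ?B * ?L x)) =
      ?A * ?R b - (?A - (1 - a) * ?B) * a ^ card U"
    unfolding alg IH by (simp only: left_diff_distrib right_diff_distrib) simp
  then show ?case
    unfolding step AB using insert.hyps by simp
qed

text \<open>The two roots play different roles from here on: \<open>p\<close> sits in the links of a
  chain, \<open>p'\<close> in the one-sided factors. That no power of them is 1 allows division by
  \<open>1 - p' ^ k\<close> and by the geometric sums in \<open>p\<close>.\<close>

locale chain = shuffle C q s for C :: "'a::field set" and q s +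
  fixes p p' :: 'a
  assumes s_eq: "s = p + p'" and ppq: "p * p' * q = 1"
    and p_C: "p \<in> C" and p'_C: "p' \<in> C"
    and p_power: "\<And>k. k \<ge> 1 \<Longrightarrow> p ^ k \<noteq> 1" and p'_power: "\<And>k. k \<ge> 1 \<Longrightarrow> p' ^ k \<noteq> 1"
begin

lemma p_nz: "p \<noteq> 0" and p'_nz: "p' \<noteq> 0" using ppq by auto

lemma om_num_factor: "om_num x y = (x - p * y) * (x - p' * y)"
proof -
  have "p * p' = 1 / q" using ppq q_nz by (simp add: field_simps)
  then have "p * p' * y\<^sup>2 = y\<^sup>2 / q" by simp
  then show ?thesis
    unfolding om_num_def unfolding s_eq by (simp add: algebra_simps power2_eq_square)
qed

lemma gen_p: "gen S \<Longrightarrow> x \<in> S \<Longrightarrow> y \<in> S \<Longrightarrow> x \<noteq> y \<Longrightarrow> x \<noteq> p * y"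
  by (auto simp: gen_def om_num_factor)

definition link :: "'a \<Rightarrow> 'a \<Rightarrow> 'a" where
  "link x b = x / (x - b)"

fun chain_prod :: "'a list \<Rightarrow> 'a" where
  "chain_prod [] = 1"
| "chain_prod [x] = 1"
| "chain_prod (x # y # l) = link x (p * y) * chain_prod (y # l)"

definition X :: "('a list \<Rightarrow> 'a) \<Rightarrow> 'a set \<Rightarrow> 'a" where
  "X g = symm (\<lambda>l. g l * chain_prod l)"

abbreviation X1 :: "'a set \<Rightarrow> 'a" where
  "X1 \<equiv> X (\<lambda>_. 1)"

lemma chain_prod_append:
  "l1 \<noteq> [] \<Longrightarrow> l2 \<noteq> [] \<Longrightarrow> chain_prod (l1 @ l2) = link (last l1) (p * hd l2) * chain_prod l1 * chain_prod l2"
proof (induction l1 rule: chain_prod.induct)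
  case (2 x)
  then show ?case by (cases l2) auto
qed auto

lemma X_decouple:
  assumes S: "gen S" "card S = k" and m: "0 < m" "m < k"
    and g: "\<And>l. l \<in> permutations_of_set S \<Longrightarrow> g l = g1 (take m l) * g2 (drop m l)"
    and g': "\<And>l. l \<in> permutations_of_set S \<Longrightarrow> g' l = g l * (l ! m / l ! (m - 1))"
  shows "X g S - p * X g' S = star m (X g1) (X g2) S"
proof -
  have "star m (X g1) (X g2) S =
      symm (\<lambda>l. g1 (take m l) * chain_prod (take m l) * (g2 (drop m l) * chain_prod (drop m l))) S"
    unfolding X_def by (rule star_symm) (use S m gen_finite in auto)
  also have "\<dots> = symm (\<lambda>l. g l * chain_prod l - p * (g' l * chain_prod l)) S"
  proof (rule symm_cong)
    fix l assume l: "l \<in> permutations_of_set S"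
    then have len: "length l = k" "set l = S" "distinct l"
      using S by (auto simp: permutations_of_set_def distinct_card[symmetric])
    let ?x = "l ! (m - 1)" and ?y = "l ! m"
    have last: "last (take m l) = ?x" using len m by (subst last_conv_nth) auto
    have hd: "hd (drop m l) = ?y" using len m by (simp add: hd_drop_conv_nth)
    have xy: "?x \<in> S" "?y \<in> S" "?x \<noteq> ?y"
      using len m by (auto simp: nth_eq_iff_index_eq simp flip: len(2))
    have nz: "?x \<noteq> 0" "?x - p * ?y \<noteq> 0" using S(1) xy gen_p[OF S(1) xy] by (auto simp: gen_def)
    have "chain_prod l = link ?x (p * ?y) * chain_prod (take m l) * chain_prod (drop m l)"
    proof -
      have "take m l \<noteq> []" "drop m l \<noteq> []" using len m by auto
      from chain_prod_append[OF this] show ?thesis unfolding last hd by simp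
    qed
    moreover have "link ?x (p * ?y) * (1 - p * (?y / ?x)) = 1"
      using nz by (simp add: link_def field_simps)
    ultimately have "chain_prod l * (1 - p * (?y / ?x)) = chain_prod (take m l) * chain_prod (drop m l)"
      by (simp add: mult_ac)
    then have "g l * (chain_prod l * (1 - p * (?y / ?x))) = g l * (chain_prod (take m l) * chain_prod (drop m l))" by simp
    then show "g1 (take m l) * chain_prod (take m l) * (g2 (drop m l) * chain_prod (drop m l)) =
        g l * chain_prod l - p * (g' l * chain_prod l)"
      by (simp add: g[OF l] g'[OF l] algebra_simps)
  qed
  also have "\<dots> = X g S - p * X g' S"
    by (simp add: symm_def X_def sum_subtractf sum_distrib_left algebra_simps)
  finally show ?thesis ..
qed

section \<open>The expansion of the constant 1 in chain elements\<close>

definition coupling :: "'a set \<Rightarrow> 'a list \<Rightarrow> 'a" where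
  "coupling I l = (case l of [] \<Rightarrow> 1 | c # r \<Rightarrow>
     (\<Prod>i\<in>I. (i - p' * c) / (i - c)) * (\<Prod>i\<in>I. \<Prod>y\<in>set r. om i y))"

text \<open>Interpolates between \<open>X1\<close> for \<open>m = 0\<close> and the constant 1 for
  \<open>m = card S\<close>: the points of \<open>I\<close> have already been summed out as heads of
  the chain and see its present head through one-sided factors only.\<close>

definition Z :: "nat \<Rightarrow> 'a set \<Rightarrow> 'a" where
  "Z m S = (\<Sum>I | I \<subseteq> S \<and> card I = m. \<Sum>l\<in>permutations_of_set (S - I). coupling I l * chain_prod l * Om l)"

text \<open>Groups the free points together with the head of the chain, so that the choice of the
  head within \<open>U\<close> becomes a sum of residues.\<close>

lemma sum_subset_insert:
  fixes f :: "'b set \<Rightarrow> 'b \<Rightarrow> 'c::comm_monoid_add"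
  assumes "finite S"
  shows "(\<Sum>I | I \<subseteq> S \<and> card I = m. \<Sum>x\<in>S - I. f I x) =
    (\<Sum>U | U \<subseteq> S \<and> card U = Suc m. \<Sum>x\<in>U. f (U - {x}) x)"
proof -
  have fin: "finite I" if "I \<subseteq> S" for I using that assms by (rule finite_subset)
  have "(\<Sum>I | I \<subseteq> S \<and> card I = m. \<Sum>x\<in>S - I. f I x) =
      (\<Sum>(I, x)\<in>(SIGMA I:{I. I \<subseteq> S \<and> card I = m}. S - I). f I x)"
    by (subst sum.Sigma) (use assms in auto)
  also have "\<dots> = (\<Sum>(U, x)\<in>(SIGMA U:{U. U \<subseteq> S \<and> card U = Suc m}. U). f (U - {x}) x)"
    by (rule sum.reindex_bij_witness[where i = "\<lambda>(U, x). (U - {x}, x)" and j = "\<lambda>(I, x). (insert x I, x)"])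
       (auto simp: insert_absorb fin card_insert_if)
  also have "\<dots> = (\<Sum>U | U \<subseteq> S \<and> card U = Suc m. \<Sum>x\<in>U. f (U - {x}) x)"
    by (subst sum.Sigma) (use assms fin in auto)
  finally show ?thesis .
qed

text \<open>
  Summing over the position of the head of the chain inside \<open>U\<close>: the residue at \<open>p c\<close>, where
  \<open>c\<close> is the next element of the chain, turns \<open>om i c\<close> into the one-sided factor
  \<open>(i - p' c) / (i - c)\<close>, because \<open>p p' q = 1\<close>.
\<close>

lemma Z_step:
  assumes "gen S" "m < card S"
  shows "(1 - p') * Z m S = Z (Suc m) S - p' ^ Suc m * star (Suc m) (\<lambda>_. 1) X1 S"
proof -
  have fin: "finite S" using assms(1) by (rule gen_finite)
  \<comment> \<open>An empty remainder is treated as a next element at 0. Link and one-sided factors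
    are then 1, in agreement with \<open>chain_prod [x]\<close> and with \<open>coupling\<close> at
    the empty list.\<close>
  let ?b = "\<lambda>r. if r = [] then 0 else p * hd r"
  let ?h = "\<lambda>U x. \<Prod>i\<in>U - {x}. (i - p' * x) / (i - x)"
  have body: "(1 - p') * (\<Sum>x\<in>U. coupling (U - {x}) (x # r) * chain_prod (x # r) * Om (x # r)) =
      coupling U r * chain_prod r * Om r - p' ^ Suc m * ((\<Prod>i\<in>U. \<Prod>y\<in>set r. om i y) * chain_prod r * Om r)"
    if U: "U \<subseteq> S" "card U = Suc m" and r: "r \<in> permutations_of_set (S - U)" for U r
  proof -
    have r': "set r = S - U" "distinct r" using r by (auto simp: permutations_of_set_def)
    have finU: "finite U" using U(1) fin by (rule finite_subset)
    have hd: "hd r \<in> S - U" if "r \<noteq> []" using r'(1) hd_in_set[OF that] by simp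
    have U0: "0 \<notin> U" using assms(1) U by (auto simp: gen_def)
    have b: "?b r \<notin> U"
    proof (cases "r = []")
      case True
      with U0 show ?thesis by simp
    next
      case False
      show ?thesis
      proof
        assume "?b r \<in> U"
        then have "p * hd r \<in> U" using False by simp
        moreover from this have "p * hd r \<noteq> hd r" "p * hd r \<in> S" using hd[OF False] U(1) by auto
        ultimately show False using gen_p[OF assms(1), of "p * hd r" "hd r"] hd[OF False] by blast
      qed
    qed
    have chain_prod: "chain_prod (x # r) = x / (x - ?b r) * chain_prod r" if "x \<in> U" for x
      using that U0 by (cases r) (auto simp: link_def)
    have "(\<Sum>x\<in>U. coupling (U - {x}) (x # r) * chain_prod (x # r) * Om (x # r)) =
        (\<Sum>x\<in>U. (?h U x * (x / (x - ?b r))) * ((\<Prod>i\<in>U. \<Prod>y\<in>set r. om i y) * chain_prod r * Om r))"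
    proof (intro sum.cong refl)
      fix x assume x: "x \<in> U"
      have "(\<Prod>i\<in>U. \<Prod>y\<in>set r. om i y) = (\<Prod>y\<in>set r. om x y) * (\<Prod>i\<in>U - {x}. \<Prod>y\<in>set r. om i y)"
        by (rule prod.remove) (use finU x in auto)
      then show "coupling (U - {x}) (x # r) * chain_prod (x # r) * Om (x # r) =
          (?h U x * (x / (x - ?b r))) * ((\<Prod>i\<in>U. \<Prod>y\<in>set r. om i y) * chain_prod r * Om r)"
        unfolding chain_prod[OF x] by (simp only: coupling_def list.case Om.simps mult_ac)
    qed
    then have "(1 - p') * (\<Sum>x\<in>U. coupling (U - {x}) (x # r) * chain_prod (x # r) * Om (x # r)) =
      (1 - p') * (\<Sum>x\<in>U. ?h U x * (x / (x - ?b r))) * ((\<Prod>i\<in>U. \<Prod>y\<in>set r. om i y) * chain_prod r * Om r)"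
      by (simp only: sum_distrib_right mult.assoc)
    also have "\<dots> = ((\<Prod>i\<in>U. (i - p' * ?b r) / (i - ?b r)) - p' ^ Suc m) *
        ((\<Prod>i\<in>U. \<Prod>y\<in>set r. om i y) * chain_prod r * Om r)"
      by (simp only: sum_one_sided_residues[OF finU b] U(2))
    also have "(\<Prod>i\<in>U. (i - p' * ?b r) / (i - ?b r)) * (\<Prod>i\<in>U. \<Prod>y\<in>set r. om i y) = coupling U r"
    proof (cases r)
      case Nil
      have "(\<Prod>i\<in>U. i / i) = 1" using U0 by (intro prod.neutral) auto
      then show ?thesis using Nil by (simp add: coupling_def)
    next
      case (Cons c r'')
      have c: "c \<in> S - U" "c \<notin> set r''" using hd r' Cons by auto
      have "(i - p' * (p * c)) / (i - p * c) * om i c = (i - p' * c) / (i - c)" if "i \<in> U" for i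
      proof -
        have ic: "i \<noteq> c" "i \<in> S" "c \<in> S" using that c U by auto
        then have "c \<noteq> q * i" using assms(1) by (simp add: gen_def)
        then have nz: "i - c \<noteq> 0" "i - p * c \<noteq> 0" "i - c / q \<noteq> 0"
          using gen_p[OF assms(1) ic(2,3,1)] ic q_nz by (auto simp: field_simps)
        have "p' * (p * c) = c / q" using ppq q_nz by (simp add: field_simps)
        then show ?thesis
          using nz unfolding om_def om_num_factor by simp
      qed
      then have "(\<Prod>i\<in>U. (i - p' * (p * c)) / (i - p * c) * om i c) = (\<Prod>i\<in>U. (i - p' * c) / (i - c))"
        by (rule prod.cong[OF refl])
      moreover have "(\<Prod>y\<in>set r. om i y) = om i c * (\<Prod>y\<in>set r''. om i y)" for i
        using Cons c by simp
      ultimately show ?thesis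
        using Cons by (simp only: coupling_def prod.distrib list.case list.sel list.distinct if_False flip: mult.assoc)
    qed
    then have "((\<Prod>i\<in>U. (i - p' * ?b r) / (i - ?b r)) - p' ^ Suc m) *
        ((\<Prod>i\<in>U. \<Prod>y\<in>set r. om i y) * chain_prod r * Om r) =
        coupling U r * chain_prod r * Om r - p' ^ Suc m * ((\<Prod>i\<in>U. \<Prod>y\<in>set r. om i y) * chain_prod r * Om r)"
      by (simp only: left_diff_distrib flip: mult.assoc)
    finally show ?thesis .
  qed
  have "Z m S = (\<Sum>I | I \<subseteq> S \<and> card I = m. \<Sum>x\<in>S - I. \<Sum>r\<in>permutations_of_set (S - I - {x}).
      coupling I (x # r) * chain_prod (x # r) * Om (x # r))"
    unfolding Z_def
  proof (intro sum.cong refl sum_permutations_of_set_Cons)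
    fix I assume "I \<in> {I. I \<subseteq> S \<and> card I = m}"
    then show "S - I \<noteq> {}" using assms(2) by auto
  qed (use fin in auto)
  also have "\<dots> = (\<Sum>U | U \<subseteq> S \<and> card U = Suc m. \<Sum>x\<in>U. \<Sum>r\<in>permutations_of_set (S - (U - {x}) - {x}).
      coupling (U - {x}) (x # r) * chain_prod (x # r) * Om (x # r))"
    by (rule sum_subset_insert[OF fin])
  also have "\<dots> = (\<Sum>U | U \<subseteq> S \<and> card U = Suc m. \<Sum>x\<in>U. \<Sum>r\<in>permutations_of_set (S - U).
      coupling (U - {x}) (x # r) * chain_prod (x # r) * Om (x # r))"
  proof (intro sum.cong refl arg_cong[where f = permutations_of_set])
  qed auto
  also have "\<dots> = (\<Sum>U | U \<subseteq> S \<and> card U = Suc m. \<Sum>r\<in>permutations_of_set (S - U). \<Sum>x\<in>U.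
      coupling (U - {x}) (x # r) * chain_prod (x # r) * Om (x # r))"
    by (intro sum.cong refl sum.swap)
  finally have "(1 - p') * Z m S = (\<Sum>U | U \<subseteq> S \<and> card U = Suc m. \<Sum>r\<in>permutations_of_set (S - U).
      (1 - p') * (\<Sum>x\<in>U. coupling (U - {x}) (x # r) * chain_prod (x # r) * Om (x # r)))"
    by (simp only: sum_distrib_left)
  also have "\<dots> = (\<Sum>U | U \<subseteq> S \<and> card U = Suc m. \<Sum>r\<in>permutations_of_set (S - U).
      coupling U r * chain_prod r * Om r - p' ^ Suc m * ((\<Prod>i\<in>U. \<Prod>y\<in>set r. om i y) * chain_prod r * Om r))"
    by (intro sum.cong refl body) auto
  also have "\<dots> = Z (Suc m) S - p' ^ Suc m * (\<Sum>U | U \<subseteq> S \<and> card U = Suc m.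
      \<Sum>r\<in>permutations_of_set (S - U). (\<Prod>i\<in>U. \<Prod>y\<in>set r. om i y) * chain_prod r * Om r)"
    unfolding Z_def by (simp only: sum_subtractf sum_distrib_left)
  also have "(\<Sum>U | U \<subseteq> S \<and> card U = Suc m.
      \<Sum>r\<in>permutations_of_set (S - U). (\<Prod>i\<in>U. \<Prod>y\<in>set r. om i y) * chain_prod r * Om r) =
      star (Suc m) (\<lambda>_. 1) X1 S"
    unfolding star_def X_def symm_def
  proof (intro sum.cong refl)
    fix U
    show "(\<Sum>r\<in>permutations_of_set (S - U). (\<Prod>i\<in>U. \<Prod>y\<in>set r. om i y) * chain_prod r * Om r) =
      1 * (\<Sum>l\<in>permutations_of_set (S - U). 1 * chain_prod l * Om l) * (\<Prod>x\<in>U. \<Prod>y\<in>S - U. om x y)"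
      unfolding sum_distrib_left sum_distrib_right
      by (intro sum.cong refl) (simp add: permutations_of_set_def mult_ac)
  qed
  finally show ?thesis .
qed

lemma sum_subset_full:
  assumes "finite S" "card S = k"
  shows "{I. I \<subseteq> S \<and> card I = k} = {S}"
  using card_subset_eq[OF assms(1)] assms(2) by auto

theorem one_eq_sum_star_X:
  assumes "gen S" "card S = k" "k \<ge> 1"
  shows "1 - p' ^ k = (\<Sum>m<k. (1 - p') ^ (k - m) * p' ^ m * star m (\<lambda>_. 1) X1 S)"
proof -
  have fin: "finite S" using assms(1) by (rule gen_finite)
  have "Z m S = (1 - p') ^ m * X1 S + (\<Sum>j\<in>{1..m}. (1 - p') ^ (m - j) * p' ^ j * star j (\<lambda>_. 1) X1 S)"
    if "m \<le> k" for m
    using that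
  proof (induction m)
    case 0
    have "{I. I \<subseteq> S \<and> card I = 0} = {{}}" using fin by (auto dest: finite_subset)
    moreover have "coupling {} l = 1" for l by (cases l) (auto simp: coupling_def)
    ultimately show ?case by (simp add: Z_def X_def symm_def)
  next
    case (Suc m)
    have "Z (Suc m) S = (1 - p') * Z m S + p' ^ Suc m * star (Suc m) (\<lambda>_. 1) X1 S"
      using Z_step[OF assms(1), of m] Suc assms by (simp add: algebra_simps)
    also have "\<dots> = (1 - p') ^ Suc m * X1 S + (\<Sum>j\<in>{1..m}. (1 - p') * ((1 - p') ^ (m - j) * p' ^ j * star j (\<lambda>_. 1) X1 S)) +
        p' ^ Suc m * star (Suc m) (\<lambda>_. 1) X1 S"
      using Suc by (simp add: algebra_simps sum_distrib_left)
    also have "(\<Sum>j\<in>{1..m}. (1 - p') * ((1 - p') ^ (m - j) * p' ^ j * star j (\<lambda>_. 1) X1 S)) =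
       (\<Sum>j\<in>{1..m}. (1 - p') ^ (Suc m - j) * p' ^ j * star j (\<lambda>_. 1) X1 S)"
      by (intro sum.cong refl) (simp add: Suc_diff_le)
    finally show ?case by simp
  qed
  then have Zk: "Z k S = (1 - p') ^ k * X1 S + (\<Sum>j\<in>{1..k}. (1 - p') ^ (k - j) * p' ^ j * star j (\<lambda>_. 1) X1 S)"
    by blast
  have "Z k S = 1"
    unfolding Z_def sum_subset_full[OF fin assms(2)] by (simp add: coupling_def)
  \<comment> \<open>The last term of the iteration, with all variables in the left factor, is
    \<open>p' ^ k\<close> itself and moves to the other side.\<close>
  moreover have "star k (\<lambda>_. 1) X1 S = 1"
    unfolding star_def sum_subset_full[OF fin assms(2)] by (simp add: X_def symm_def)
  moreover have "{1..k} = insert k {1..<k}" "{..<k} = insert 0 {1..<k}" using assms(3) by auto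
  moreover have "star 0 (\<lambda>_. 1) X1 S = X1 S" using fin by (simp add: star_0)
  ultimately show ?thesis using Zk by (simp add: algebra_simps)
qed

end

section \<open>The constant function as a combination of monomials\<close>

context shuffle
begin

lemma inA_sub_trans:
  assumes "inA k (\<lambda>S. F S - G S)" "inA k (\<lambda>S. G S - H S)"
  shows "inA k (\<lambda>S. F S - H S)"
  using inA_add[OF assms] by simp

lemma inA_geometric:
  assumes "\<And>i. Suc i < k \<Longrightarrow> inA n (\<lambda>S. Y i S - r * Y (Suc i) S)" "r \<in> C" "i < k"
  shows "inA n (\<lambda>S. Y 0 S - r ^ i * Y i S)"
  using assms(3)
proof (induction i)
  case 0
  then show ?case using inA_0 by simp
next
  case (Suc i)
  have "inA n (\<lambda>S. r ^ i * (Y i S - r * Y (Suc i) S))"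
    by (intro inA_scale assms(1) C_power assms(2) Suc.prems)
  then have "inA n (\<lambda>S. r ^ i * Y i S - r ^ Suc i * Y (Suc i) S)"
    by (rule inA_cong) (simp add: algebra_simps)
  moreover have "inA n (\<lambda>S. Y 0 S - r ^ i * Y i S)"
    by (rule Suc.IH) (use Suc.prems in simp)
  ultimately show ?case by (rule inA_sub_trans[rotated])
qed

text \<open>Modulo the span every \<open>Y i\<close> is a multiple of \<open>Y 0\<close>, so one
  relation with nonzero total coefficient, namely the sum, brings all of them into the span.\<close>

lemma inA_geometric_sum:
  assumes Y: "\<And>i. Suc i < k \<Longrightarrow> inA n (\<lambda>S. Y i S - r * Y (Suc i) S)" and r: "r \<in> C" "r \<noteq> 0"
    and sum: "inA n (\<lambda>S. \<Sum>i<k. Y i S)" and nz: "(\<Sum>i<k. inverse r ^ i) \<noteq> 0" and i: "i < k"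
  shows "inA n (Y i)"
proof -
  have Y0: "inA n (\<lambda>S. Y 0 S - r ^ j * Y j S)" if "j < k" for j
    using inA_geometric[of k n Y r j] Y r that by auto
  have "inA n (\<lambda>S. inverse r ^ j * (Y 0 S - r ^ j * Y j S))" if "j < k" for j
    by (intro inA_scale Y0 that C_power C_inverse r)
  then have *: "inA n (\<lambda>S. inverse r ^ j * Y 0 S - Y j S)" if "j < k" for j
    using that r(2) by (simp add: right_diff_distrib flip: mult.assoc power_mult_distrib)
  have "inA n (\<lambda>S. (\<Sum>j<k. inverse r ^ j * Y 0 S - Y j S) + (\<Sum>i<k. Y i S))"
    by (intro inA_add sum inA_sum *) auto
  then have "inA n (\<lambda>S. (\<Sum>j<k. inverse r ^ j) * Y 0 S)"
    by (simp add: sum_subtractf sum_distrib_right)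
  then have Y0': "inA n (Y 0)"
    by (rule inA_scaleD) (auto intro!: C_sum C_power C_inverse r nz)
  have "inA n (\<lambda>S. inverse r ^ i * Y 0 S - (inverse r ^ i * Y 0 S - Y i S))"
    by (intro inA_diff * i inA_scale Y0' C_power C_inverse r)
  then show ?thesis by simp
qed

definition ee :: "'a set \<Rightarrow> 'a" where "ee S = e1 S * e' S"

text \<open>\<open>ee\<close> is carried along because splitting it over two blocks of variables
  produces \<open>ee\<close> of each block.\<close>

definition inA_elementary :: "nat \<Rightarrow> bool" where
  "inA_elementary k \<longleftrightarrow> inA k (\<lambda>_. 1) \<and> inA k e1 \<and> inA k e' \<and> inA k ee"

end

context chain
begin

definition inA_chain :: "nat \<Rightarrow> bool" where
  "inA_chain k \<longleftrightarrow> inA k X1 \<and>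
    (\<forall>i<k. inA k (X (\<lambda>l. l ! i)) \<and> inA k (X (\<lambda>l. inverse (l ! i))) \<and>
      (\<forall>j<k. inA k (X (\<lambda>l. l ! i * inverse (l ! j)))))"

text \<open>The multiple of \<open>X1\<close> to which \<open>ee * X1\<close> is congruent modulo
  the span: the sum of all \<open>p\<close> to the power j - i.\<close>

definition chain_const :: "nat \<Rightarrow> 'a" where
  "chain_const k = (\<Sum>i<k. \<Sum>j<k. inverse p ^ i * p ^ j)"

lemma sum_powers_nz:
  assumes "k \<ge> 1"
  shows "(\<Sum>i<k. p ^ i) \<noteq> 0" "(\<Sum>i<k. inverse p ^ i) \<noteq> 0"
proof -
  have 1: "(\<Sum>i<k. x ^ i) \<noteq> 0" if "x ^ k \<noteq> 1" for x :: 'a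
    using that power_diff_1_eq[of x k] by auto
  have "inverse p ^ k \<noteq> 1" using p_power[OF assms] by (simp add: power_inverse)
  with 1 p_power[OF assms] show "(\<Sum>i<k. p ^ i) \<noteq> 0" "(\<Sum>i<k. inverse p ^ i) \<noteq> 0" by blast+
qed

lemma perm_nth:
  assumes "gen S" "card S = k" "l \<in> permutations_of_set S"
  shows "length l = k" "set l = S" "distinct l" "i < k \<Longrightarrow> l ! i \<noteq> 0"
proof -
  show "length l = k" "set l = S" "distinct l"
    using assms by (auto simp: permutations_of_set_def distinct_card[symmetric])
  then show "i < k \<Longrightarrow> l ! i \<noteq> 0" using assms(1) nth_mem[of i l] by (auto simp: gen_def)
qed

text \<open>The conditions on \<open>g\<close> and \<open>g'\<close> concern only lists with nonzero
  entries, so that quotients of entries simplify. The ratio is right neighbour over left neighbour,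
  the one that cancels the link at the cut.\<close>

lemma inA_decouple:
  assumes "0 < m" "m < k" "inA m (X g1)" "inA (k - m) (X g2)"
    and "\<And>l. length l = k \<Longrightarrow> (\<And>i. i < k \<Longrightarrow> l ! i \<noteq> 0) \<Longrightarrow> g l = g1 (take m l) * g2 (drop m l)"
    and "\<And>l. length l = k \<Longrightarrow> (\<And>i. i < k \<Longrightarrow> l ! i \<noteq> 0) \<Longrightarrow> g' l = g l * (l ! m / l ! (m - 1))"
  shows "inA k (\<lambda>S. X g S - p * X g' S)"
proof (rule inA_cong[OF inA_star'[OF assms(3,4)]])
  show "m + (k - m) = k" using assms by simp
next
  fix S assume S: "gen S" "card S = k"
  show "star m (X g1) (X g2) S = X g S - p * X g' S"
    by (rule X_decouple[symmetric, OF S assms(1,2)])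
       (use perm_nth[OF S] assms(5,6) in auto)
qed

lemma sum_perm_nth:
  assumes "l \<in> permutations_of_set S" "card S = k"
  shows "sum f S = (\<Sum>i<k. f (l ! i))"
proof -
  have l: "distinct l" "set l = S" "length l = k"
    using assms by (auto simp: permutations_of_set_def distinct_card[symmetric])
  have "bij_betw ((!) l) {..<k} S" by (rule bij_betw_nth) (use l in auto)
  from sum.reindex_bij_betw[OF this, of f] show ?thesis by simp
qed

lemma e1_X1: "finite S \<Longrightarrow> card S = k \<Longrightarrow> e1 S * X1 S = (\<Sum>i<k. X (\<lambda>l. l ! i) S)"
  and e'_X1: "finite S \<Longrightarrow> card S = k \<Longrightarrow> e' S * X1 S = (\<Sum>i<k. X (\<lambda>l. inverse (l ! i)) S)"
  and ee_X1: "finite S \<Longrightarrow> card S = k \<Longrightarrow> ee S * X1 S = (\<Sum>i<k. \<Sum>j<k. X (\<lambda>l. l ! i * inverse (l ! j)) S)"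
proof -
  assume S: "finite S" "card S = k"
  note sum_nth = sum_perm_nth[OF _ S(2)]
  show "e1 S * X1 S = (\<Sum>i<k. X (\<lambda>l. l ! i) S)"
    unfolding X_def symm_def sum_distrib_left
    by (subst sum.swap, intro sum.cong refl) (simp add: e1_def sum_nth sum_distrib_left mult_ac)
  show "e' S * X1 S = (\<Sum>i<k. X (\<lambda>l. inverse (l ! i)) S)"
    unfolding X_def symm_def sum_distrib_left
    by (subst sum.swap, intro sum.cong refl) (simp add: e'_def sum_nth sum_distrib_left mult_ac)
  have "ee S * X1 S = (\<Sum>l\<in>permutations_of_set S. \<Sum>i<k. \<Sum>j<k. l ! i * inverse (l ! j) * chain_prod l * Om l)"
    unfolding X_def symm_def sum_distrib_left
    proof (intro sum.cong refl)
    fix l assume "l \<in> permutations_of_set S"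
    then show "ee S * (1 * chain_prod l * Om l) = (\<Sum>i<k. \<Sum>j<k. l ! i * inverse (l ! j) * chain_prod l * Om l)"
      by (simp only: ee_def e1_def e'_def sum_nth sum_distrib_left sum_distrib_right mult_1_left mult.assoc)
        (rule sum.swap)
  qed
  also have "\<dots> = (\<Sum>i<k. \<Sum>l\<in>permutations_of_set S. \<Sum>j<k. l ! i * inverse (l ! j) * chain_prod l * Om l)"
    by (rule sum.swap)
  also have "\<dots> = (\<Sum>i<k. \<Sum>j<k. \<Sum>l\<in>permutations_of_set S. l ! i * inverse (l ! j) * chain_prod l * Om l)"
    by (intro sum.cong refl sum.swap)
  finally show "ee S * X1 S = (\<Sum>i<k. \<Sum>j<k. X (\<lambda>l. l ! i * inverse (l ! j)) S)"
    unfolding X_def symm_def .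
qed

section \<open>The induction step for one root\<close>

context
  fixes k :: nat
  assumes k: "k \<ge> 1" and IH: "\<And>m. 1 \<le> m \<Longrightarrow> m < k \<Longrightarrow> inA_elementary m \<and> inA_chain m"
begin

lemma X_ratio:
  assumes "i < k" "j < k"
  shows "inA k (\<lambda>S. X (\<lambda>l. l ! i * inverse (l ! j)) S - inverse p ^ i * p ^ j * X1 S)"
proof -
  let ?Y = "\<lambda>i. X (\<lambda>l. l ! i * inverse (l ! j))"
  \<comment> \<open>The cut between positions i and i + 1 replaces \<open>l ! i\<close> by its right
    neighbour. Entry \<open>j\<close> lies in the left block if \<open>j \<le> i\<close>, otherwise
    in the right block with its index lowered by i + 1; both blocks are shorter than k.\<close>
  have step: "inA k (\<lambda>S. ?Y i S - p * ?Y (Suc i) S)" if i: "Suc i < k" for i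
  proof (cases "j \<le> i")
    case True
    show ?thesis
    proof (rule inA_decouple[of "Suc i"])
      show "inA (Suc i) (X (\<lambda>l. l ! i * inverse (l ! j)))" "inA (k - Suc i) X1"
        using IH[of "Suc i"] IH[of "k - Suc i"] i True by (auto simp: inA_chain_def)
    qed (use i True in auto)
  next
    case False
    show ?thesis
    proof (rule inA_decouple[of "Suc i"])
      have "j - Suc i < k - Suc i" using False assms(2) i by auto
      then show "inA (Suc i) (X (\<lambda>l. l ! i))" "inA (k - Suc i) (X (\<lambda>l. inverse (l ! (j - Suc i))))"
        using IH[of "Suc i"] IH[of "k - Suc i"] i False assms(2) by (auto simp: inA_chain_def)
    qed (use i False in auto)
  qed
  have *: "inA k (\<lambda>S. ?Y 0 S - p ^ n * ?Y n S)" if "n < k" for n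
    using inA_geometric[of k k ?Y p n] step p_C that by blast
  \<comment> \<open>The quotient is 1 at \<open>i = j\<close>, which expresses the whole geometric
    sequence through \<open>X1\<close>.\<close>
  have Yj: "?Y j S = X1 S" if "gen S" "card S = k" for S
    unfolding X_def by (rule symm_cong) (use perm_nth[OF that] assms in auto)
  have "inA k (\<lambda>S. inverse p ^ i * ((?Y 0 S - p ^ j * ?Y j S) - (?Y 0 S - p ^ i * ?Y i S)))"
    by (intro inA_scale inA_diff * assms C_power C_inverse p_C)
  then show ?thesis
  proof (rule inA_cong)
    fix S assume S: "gen S" "card S = k"
    have "inverse p ^ i * p ^ i = 1" using p_nz by (simp flip: power_mult_distrib)
    moreover have "inverse p ^ i * ((?Y 0 S - p ^ j * ?Y j S) - (?Y 0 S - p ^ i * ?Y i S)) =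
       (inverse p ^ i * p ^ i) * ?Y i S - inverse p ^ i * p ^ j * ?Y j S"
      by (simp add: algebra_simps)
    ultimately show "inverse p ^ i * ((?Y 0 S - p ^ j * ?Y j S) - (?Y 0 S - p ^ i * ?Y i S)) =
       ?Y i S - inverse p ^ i * p ^ j * X1 S"
      by (simp add: Yj[OF S])
  qed
qed

lemma X_letter: "Suc i < k \<Longrightarrow> inA k (\<lambda>S. X (\<lambda>l. l ! i) S - p * X (\<lambda>l. l ! Suc i) S)"
proof -
  assume i: "Suc i < k"
  show ?thesis
  proof (rule inA_decouple[of "Suc i"])
    show "inA (Suc i) (X (\<lambda>l. l ! i))" "inA (k - Suc i) X1"
      using IH[of "Suc i"] IH[of "k - Suc i"] i by (auto simp: inA_chain_def)
  qed (use i in auto)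
qed

text \<open>The neighbour ratio turns \<open>inverse (l ! Suc i)\<close> into
  \<open>inverse (l ! i)\<close>, so decoupling gives the relation in the reverse direction. Scaling
  it by -1/p makes it a geometric relation with ratio \<open>inverse p\<close>.\<close>

lemma X_inverse_letter:
  "Suc i < k \<Longrightarrow> inA k (\<lambda>S. X (\<lambda>l. inverse (l ! i)) S - inverse p * X (\<lambda>l. inverse (l ! Suc i)) S)"
proof -
  assume i: "Suc i < k"
  have "inA k (\<lambda>S. X (\<lambda>l. inverse (l ! Suc i)) S - p * X (\<lambda>l. inverse (l ! i)) S)"
  proof (rule inA_decouple[of "Suc i"])
    show "inA (Suc i) X1" "inA (k - Suc i) (X (\<lambda>l. inverse (l ! 0)))"
      using IH[of "Suc i"] IH[of "k - Suc i"] i by (auto simp: inA_chain_def)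
  qed (use i in \<open>auto simp: divide_inverse\<close>)
  from inA_scale[OF this C_uminus[OF C_inverse[OF p_C]]] show ?thesis
    by (rule inA_cong) (use p_nz in \<open>simp add: algebra_simps\<close>)
qed

lemma IH_X1:
  assumes "1 \<le> m" "m < k"
  shows "inA m X1" "inA m (\<lambda>S. e1 S * X1 S)" "inA m (\<lambda>S. e' S * X1 S)" "inA m (\<lambda>S. ee S * X1 S)"
proof -
  have c: "inA_chain m" using IH assms by blast
  then show "inA m X1" by (simp add: inA_chain_def)
  show "inA m (\<lambda>S. e1 S * X1 S)"
    by (rule inA_cong[of _ "\<lambda>S. \<Sum>i<m. X (\<lambda>l. l ! i) S"])
       (use c in \<open>auto intro!: inA_sum simp: inA_chain_def e1_X1 gen_finite\<close>)
  show "inA m (\<lambda>S. e' S * X1 S)"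
    by (rule inA_cong[of _ "\<lambda>S. \<Sum>i<m. X (\<lambda>l. inverse (l ! i)) S"])
       (use c in \<open>auto intro!: inA_sum simp: inA_chain_def e'_X1 gen_finite\<close>)
  show "inA m (\<lambda>S. ee S * X1 S)"
    by (rule inA_cong[of _ "\<lambda>S. \<Sum>i<m. \<Sum>j<m. X (\<lambda>l. l ! i * inverse (l ! j)) S"])
       (use c in \<open>auto intro!: inA_sum simp: inA_chain_def ee_X1 gen_finite\<close>)
qed

text \<open>In the expansion of 1 multiplied by \<open>F\<close>, only the term
  \<open>m = 0\<close>, which is a multiple of \<open>F * X1\<close>, remains modulo the
  span.\<close>

lemma inA_reduce_to_X1:
  assumes "\<And>m. 1 \<le> m \<Longrightarrow> m < k \<Longrightarrow> inA k (\<lambda>S. F S * star m (\<lambda>_. 1) X1 S)"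
  shows "inA k (\<lambda>S. (1 - p' ^ k) * F S - (1 - p') ^ k * (F S * X1 S))"
proof -
  have "inA k (\<lambda>S. \<Sum>m\<in>{1..<k}. ((1 - p') ^ (k - m) * p' ^ m) * (F S * star m (\<lambda>_. 1) X1 S))"
    by (intro inA_sum inA_scale assms C_mult C_power C_diff C_1 p'_C) auto
  then show ?thesis
  proof (rule inA_cong)
    fix S assume S: "gen S" "card S = k"
    have "{..<k} = insert 0 {1..<k}" using k by auto
    then have "1 - p' ^ k = (1 - p') ^ k * X1 S +
        (\<Sum>m\<in>{1..<k}. ((1 - p') ^ (k - m) * p' ^ m) * star m (\<lambda>_. 1) X1 S)"
      using one_eq_sum_star_X[OF S k] star_0[OF gen_finite[OF S(1)]] by simp
    moreover have "((1 - p') ^ k * X1 S +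
        (\<Sum>m\<in>{1..<k}. ((1 - p') ^ (k - m) * p' ^ m) * star m (\<lambda>_. 1) X1 S)) * F S =
       (1 - p') ^ k * (F S * X1 S) +
       (\<Sum>m\<in>{1..<k}. ((1 - p') ^ (k - m) * p' ^ m) * (F S * star m (\<lambda>_. 1) X1 S))"
      by (simp add: algebra_simps sum_distrib_left)
    ultimately show "(\<Sum>m\<in>{1..<k}. ((1 - p') ^ (k - m) * p' ^ m) * (F S * star m (\<lambda>_. 1) X1 S)) =
      (1 - p' ^ k) * F S - (1 - p') ^ k * (F S * X1 S)" by simp
  qed
qed

lemma e_split:
  assumes "finite S" "I \<subseteq> S"
  shows "e1 S = e1 I + e1 (S - I)" "e' S = e' I + e' (S - I)"
  unfolding e1_def e'_def
  by (subst sum.subset_diff[OF assms(2,1)], rule add.commute)+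

text \<open>On a disjoint union \<open>e1\<close> and \<open>e'\<close> are additive and
  \<open>ee\<close> splits into four products. Multiplying a shuffle product by any of them
  therefore gives shuffle products of elements of sizes m and k - m, both below k.\<close>

lemma inA_reduce_cases:
  shows "inA k (\<lambda>S. (1 - p' ^ k) - (1 - p') ^ k * X1 S)"
    and "inA k (\<lambda>S. (1 - p' ^ k) * e1 S - (1 - p') ^ k * (e1 S * X1 S))"
    and "inA k (\<lambda>S. (1 - p' ^ k) * e' S - (1 - p') ^ k * (e' S * X1 S))"
    and "inA k (\<lambda>S. (1 - p' ^ k) * ee S - (1 - p') ^ k * (ee S * X1 S))"
proof -
  have good: "inA m (\<lambda>_. 1)" "inA m e1" "inA m e'" "inA m ee" if "1 \<le> m" "m < k" for m
    using IH[OF that] by (auto simp: inA_elementary_def)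
  have star: "inA k (star m F (\<lambda>S. G S * X1 S))"
    if "1 \<le> m" "m < k" "inA m F" "inA (k - m) (\<lambda>S. G S * X1 S)" for m F G
    by (rule inA_star'[OF that(3,4)]) (use that in auto)
  have "inA k (\<lambda>S. (1 - p' ^ k) * 1 - (1 - p') ^ k * (1 * X1 S))"
  proof (rule inA_reduce_to_X1)
    fix m assume m: "1 \<le> m" "m < k"
    show "inA k (\<lambda>S. 1 * star m (\<lambda>_. 1) X1 S)"
      using inA_star'[OF good(1)[OF m] IH_X1(1)[of "k - m"]] m by auto
  qed
  then show "inA k (\<lambda>S. (1 - p' ^ k) - (1 - p') ^ k * X1 S)" by simp
  show "inA k (\<lambda>S. (1 - p' ^ k) * e1 S - (1 - p') ^ k * (e1 S * X1 S))"
  proof (rule inA_reduce_to_X1)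
    fix m assume m: "1 \<le> m" "m < k"
    then have "inA k (\<lambda>S. star m e1 (\<lambda>S. 1 * X1 S) S + star m (\<lambda>_. 1) (\<lambda>S. e1 S * X1 S) S)"
      by (intro inA_add star good) (auto intro!: IH_X1)
    then show "inA k (\<lambda>S. e1 S * star m (\<lambda>_. 1) X1 S)"
    proof (rule inA_cong)
      fix S assume "gen S" "card S = k"
      then show "star m e1 (\<lambda>S. 1 * X1 S) S + star m (\<lambda>_. 1) (\<lambda>S. e1 S * X1 S) S =
        e1 S * star m (\<lambda>_. 1) X1 S"
        unfolding star_def sum_distrib_left sum.distrib[symmetric]
        by (intro sum.cong refl) (auto simp: e_split(1) gen_finite algebra_simps)
    qed
  qed
  show "inA k (\<lambda>S. (1 - p' ^ k) * e' S - (1 - p') ^ k * (e' S * X1 S))"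
  proof (rule inA_reduce_to_X1)
    fix m assume m: "1 \<le> m" "m < k"
    then have "inA k (\<lambda>S. star m e' (\<lambda>S. 1 * X1 S) S + star m (\<lambda>_. 1) (\<lambda>S. e' S * X1 S) S)"
      by (intro inA_add star good) (auto intro!: IH_X1)
    then show "inA k (\<lambda>S. e' S * star m (\<lambda>_. 1) X1 S)"
    proof (rule inA_cong)
      fix S assume "gen S" "card S = k"
      then show "star m e' (\<lambda>S. 1 * X1 S) S + star m (\<lambda>_. 1) (\<lambda>S. e' S * X1 S) S =
        e' S * star m (\<lambda>_. 1) X1 S"
        unfolding star_def sum_distrib_left sum.distrib[symmetric]
        by (intro sum.cong refl) (auto simp: e_split(2) gen_finite algebra_simps)
    qed
  qed
  show "inA k (\<lambda>S. (1 - p' ^ k) * ee S - (1 - p') ^ k * (ee S * X1 S))"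
  proof (rule inA_reduce_to_X1)
    fix m assume m: "1 \<le> m" "m < k"
    then have "inA k (\<lambda>S. star m ee (\<lambda>S. 1 * X1 S) S + star m e1 (\<lambda>S. e' S * X1 S) S +
        star m e' (\<lambda>S. e1 S * X1 S) S + star m (\<lambda>_. 1) (\<lambda>S. ee S * X1 S) S)"
      by (intro inA_add star good) (auto intro!: IH_X1)
    then show "inA k (\<lambda>S. ee S * star m (\<lambda>_. 1) X1 S)"
    proof (rule inA_cong)
      fix S assume S: "gen S" "card S = k"
      have "ee S = ee I + e1 I * e' (S - I) + e' I * e1 (S - I) + ee (S - I)" if "I \<subseteq> S" for I
        unfolding ee_def e_split[OF gen_finite[OF S(1)] that] by (simp add: algebra_simps)
      then show "star m ee (\<lambda>S. 1 * X1 S) S + star m e1 (\<lambda>S. e' S * X1 S) S +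
        star m e' (\<lambda>S. e1 S * X1 S) S + star m (\<lambda>_. 1) (\<lambda>S. ee S * X1 S) S =
        ee S * star m (\<lambda>_. 1) X1 S"
        unfolding star_def sum_distrib_left sum.distrib[symmetric]
        by (intro sum.cong refl) (auto simp: algebra_simps)
    qed
  qed
qed

lemma one_minus_p': "1 - p' ^ k \<noteq> 0" "1 - p' ^ k \<in> C" "(1 - p') ^ k \<noteq> 0" "(1 - p') ^ k \<in> C"
proof -
  have "p' ^ k \<noteq> 1" "p' \<noteq> 1" using p'_power[OF k] p'_power[of 1] by simp_all
  then show "1 - p' ^ k \<noteq> 0" "(1 - p') ^ k \<noteq> 0" by simp_all
  show "1 - p' ^ k \<in> C" "(1 - p') ^ k \<in> C" by (intro C_diff C_power C_1 p'_C)+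
qed

lemma chain_const_C: "chain_const k \<in> C"
  unfolding chain_const_def by (intro C_sum C_mult C_power C_inverse p_C)

text \<open>Both 1 and \<open>ee\<close> are related to their products with \<open>X1\<close> by the
  same two constants, so \<open>X1\<close> can be eliminated. Neither 1 nor \<open>X1\<close> in k
  variables is known to lie in the span at this point.\<close>

lemma ee_minus_chain_const: "inA k (\<lambda>S. ee S - chain_const k)"
proof -
  have "inA k (\<lambda>S. \<Sum>i<k. \<Sum>j<k. X (\<lambda>l. l ! i * inverse (l ! j)) S - inverse p ^ i * p ^ j * X1 S)"
    by (intro inA_sum X_ratio) auto
  then have 1: "inA k (\<lambda>S. ee S * X1 S - chain_const k * X1 S)"
    by (rule inA_cong) (auto simp: ee_X1 gen_finite chain_const_def sum_subtractf sum_distrib_right)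
  have "inA k (\<lambda>S. ((1 - p' ^ k) * ee S - (1 - p') ^ k * (ee S * X1 S)) +
      (1 - p') ^ k * (ee S * X1 S - chain_const k * X1 S) - chain_const k * ((1 - p' ^ k) - (1 - p') ^ k * X1 S))"
    by (intro inA_add inA_diff inA_scale inA_reduce_cases 1 chain_const_C one_minus_p')
  then have "inA k (\<lambda>S. (1 - p' ^ k) * (ee S - chain_const k))"
    by (rule inA_cong) (simp add: algebra_simps)
  then show ?thesis by (rule inA_scaleD) (use one_minus_p' in auto)
qed

text \<open>The reductions are read backwards: 1, \<open>e1\<close> and \<open>e'\<close> yield
  \<open>X1\<close> and the sums of the chains with one letter, and the geometric relations then
  isolate the single terms.\<close>

lemma inA_chain_step:
  assumes "inA k (\<lambda>_. 1)" "inA k e1" "inA k e'"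
  shows "inA_chain k"
proof -
  have X: "inA k (\<lambda>S. F S * X1 S)"
    if "inA k F" "inA k (\<lambda>S. (1 - p' ^ k) * F S - (1 - p') ^ k * (F S * X1 S))" for F
  proof -
    have "inA k (\<lambda>S. (1 - p' ^ k) * F S - ((1 - p' ^ k) * F S - (1 - p') ^ k * (F S * X1 S)))"
      by (intro inA_diff inA_scale that one_minus_p')
    then have "inA k (\<lambda>S. (1 - p') ^ k * (F S * X1 S))" by simp
    then show ?thesis by (rule inA_scaleD) (use one_minus_p' in auto)
  qed
  have X1: "inA k X1" using X[of "\<lambda>_. 1"] assms(1) inA_reduce_cases(1) by simp
  have "inA k (\<lambda>S. \<Sum>i<k. X (\<lambda>l. l ! i) S)"
    by (rule inA_cong[OF X[OF assms(2) inA_reduce_cases(2)]]) (auto simp: e1_X1 gen_finite)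
  then have 1: "inA k (X (\<lambda>l. l ! i))" if "i < k" for i
    using inA_geometric_sum[of k k "\<lambda>i. X (\<lambda>l. l ! i)" p i] X_letter p_C p_nz sum_powers_nz[OF k] that
    by blast
  have "inA k (\<lambda>S. \<Sum>i<k. X (\<lambda>l. inverse (l ! i)) S)"
    by (rule inA_cong[OF X[OF assms(3) inA_reduce_cases(3)]]) (auto simp: e'_X1 gen_finite)
  then have 2: "inA k (X (\<lambda>l. inverse (l ! i)))" if "i < k" for i
    using inA_geometric_sum[of k k "\<lambda>i. X (\<lambda>l. inverse (l ! i))" "inverse p" i] X_inverse_letter
      C_inverse[OF p_C] p_nz sum_powers_nz[OF k] that
    by simp
  have 3: "inA k (X (\<lambda>l. l ! i * inverse (l ! j)))" if "i < k" "j < k" for i j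
  proof -
    have "inA k (\<lambda>S. (X (\<lambda>l. l ! i * inverse (l ! j)) S - inverse p ^ i * p ^ j * X1 S) +
        (inverse p ^ i * p ^ j) * X1 S)"
      by (intro inA_add inA_scale X_ratio X1 that C_mult C_power C_inverse p_C)
    then show ?thesis by simp
  qed
  show ?thesis using X1 1 2 3 by (simp add: inA_chain_def)
qed

end

end

text \<open>
  The two values \<open>chain_const k\<close> and \<open>sw.chain_const k\<close> of \<open>ee\<close> modulo the span of the monomials differ,
  which forces the constant \<open>1\<close> to lie in that span.
\<close>

locale two_chains = chain C q s p p' for C :: "'a::field set" and q s p p' +
  assumes chain_const_neq: "\<And>k. k \<ge> 2 \<Longrightarrow>
    (\<Sum>i<k. \<Sum>j<k. inverse p ^ i * p ^ j) \<noteq> (\<Sum>i<k. \<Sum>j<k. inverse p' ^ i * p' ^ j)"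
begin

sublocale sw: chain C q s p' p
proof unfold_locales
  show "s = p' + p" by (subst s_eq) (rule add.commute)
  show "p' * p * q = 1" by (subst ppq[symmetric]) (simp only: mult_ac)
qed (fact p_C p'_C p_power p'_power)+

lemma inA_elementary_inA_chain: "k \<ge> 1 \<Longrightarrow> inA_elementary k \<and> inA_chain k \<and> sw.inA_chain k"
proof (induction k rule: less_induct)
  case (less k)
  have IH: "inA_elementary m \<and> inA_chain m" "inA_elementary m \<and> sw.inA_chain m" if "1 \<le> m" "m < k" for m
    using less.IH[of m] that by auto
  \<comment> \<open>In one variable both constants are 1 and their comparison says nothing; there
    the three functions are single letters.\<close>
  have base: "inA k (\<lambda>_. 1) \<and> inA k e1 \<and> inA k e'"
  proof (cases "k = 1")
    case True
    then show ?thesis using inA_base by simp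
  next
    case False
    then have k: "k \<ge> 2" "1 \<le> k - 1" "k - 1 < k" "Suc (k - 1) = k" using less.prems by auto
    then have "inA k e1" "inA k e'"
      using inA_e1_step[of "k - 1"] IH(1)[of "k - 1"] by (auto simp: inA_elementary_def)
    moreover have "inA k (\<lambda>S. (ee S - chain_const k) - (ee S - sw.chain_const k))"
      by (intro inA_diff ee_minus_chain_const sw.ee_minus_chain_const less.prems IH)
    then have "inA k (\<lambda>S. (sw.chain_const k - chain_const k) * 1)" by simp
    then have "inA k (\<lambda>_. 1)"
      by (rule inA_scaleD)
         (use chain_const_neq[OF k(1)] in \<open>auto simp: chain_const_def sw.chain_const_def intro!: C_diff C_sum C_mult C_power C_inverse p_C p'_C\<close>)
    ultimately show ?thesis by blast
  qed
  have "inA k (\<lambda>S. (ee S - chain_const k) + chain_const k * 1)"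
    by (intro inA_add inA_scale ee_minus_chain_const chain_const_C less.prems IH) (use base less.prems in auto)
  then have "inA_elementary k" using base by (simp add: inA_elementary_def)
  moreover have "inA_chain k" "sw.inA_chain k"
    by (intro inA_chain_step sw.inA_chain_step less.prems IH; use base in blast)+
  ultimately show ?case by blast
qed

theorem inA_one: "k \<ge> 1 \<Longrightarrow> inA k (\<lambda>_. 1)"
  using inA_elementary_inA_chain by (simp add: inA_elementary_def)

end

section \<open>Collisions of points\<close>

fun pair_prod :: "('a \<Rightarrow> 'a \<Rightarrow> 'b::comm_monoid_mult) \<Rightarrow> 'a list \<Rightarrow> 'b" where
  "pair_prod f [] = 1"
| "pair_prod f (x # l) = (\<Prod>y\<in>set l. f x y) * pair_prod f l"

lemma pair_prod_mult: "pair_prod (\<lambda>x y. f x y * g x y) l = pair_prod f l * pair_prod g l"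
  by (induction l) (auto simp: prod.distrib mult_ac)

lemma pair_prod_cong:
  "distinct l \<Longrightarrow> (\<And>x y. x \<in> set l \<Longrightarrow> y \<in> set l \<Longrightarrow> x \<noteq> y \<Longrightarrow> f x y = g x y) \<Longrightarrow> pair_prod f l = pair_prod g l"
proof (induction l)
  case (Cons x l)
  have "(\<Prod>y\<in>set l. f x y) = (\<Prod>y\<in>set l. g x y)"
    by (rule prod.cong) (use Cons in auto)
  moreover have "pair_prod f l = pair_prod g l" by (rule Cons.IH) (use Cons in auto)
  ultimately show ?case by simp
qed simp

text \<open>A factor symmetric in the pair gives the same product for every ordering, so clearing
  poles in this way multiplies all summands by one common number.\<close>

lemma pair_prod_symmetrized:
  "distinct l \<Longrightarrow> (\<And>x. h x x = 1) \<Longrightarrow>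
    pair_prod (\<lambda>x y. h x y * h y x) l = (\<Prod>x\<in>set l. \<Prod>y\<in>set l. h x y)"
  by (induction l) (auto simp: prod.distrib mult_ac)

lemma (in shuffle) Om_eq_pair_prod: "Om l = pair_prod om l"
  by (induction l) auto

lemma (in shuffle) Om_map: "inj_on z (set l) \<Longrightarrow> Om (map z l) = pair_prod (\<lambda>x y. om (z x) (z y)) l"
  by (induction l) (auto simp: prod.reindex inj_on_def)

text \<open>
  \<open>regular_value g v\<close>: away from finitely many arguments, \<open>g\<close> agrees with a rational function that is
  regular at \<open>0\<close> with value \<open>v\<close> there. This replaces limits over an arbitrary
  infinite field.
\<close>

definition regular_value :: "('a::field \<Rightarrow> 'a) \<Rightarrow> 'a \<Rightarrow> bool" where
  "regular_value g v \<longleftrightarrow> (\<exists>P Q. poly Q 0 \<noteq> 0 \<and> v = poly P 0 / poly Q 0 \<and>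
     (\<forall>\<^sub>F \<tau> in cofinite. g \<tau> = poly P \<tau> / poly Q \<tau>))"

lemma eventually_poly_nz:
  assumes "P \<noteq> 0"
  shows "\<forall>\<^sub>F \<tau> in cofinite. poly P \<tau> \<noteq> (0::'a::field)"
  using poly_roots_finite[OF assms] by (simp add: eventually_cofinite)

lemma regular_value_cong:
  assumes "regular_value g v" "\<forall>\<^sub>F \<tau> in cofinite. g \<tau> = h \<tau>"
  shows "regular_value h v"
proof -
  from assms(1) obtain P Q where PQ: "poly Q 0 \<noteq> 0" "v = poly P 0 / poly Q 0"
    "\<forall>\<^sub>F \<tau> in cofinite. g \<tau> = poly P \<tau> / poly Q \<tau>" unfolding regular_value_def by blast
  have "\<forall>\<^sub>F \<tau> in cofinite. h \<tau> = poly P \<tau> / poly Q \<tau>"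
    using PQ(3) assms(2) by eventually_elim simp
  with PQ show ?thesis unfolding regular_value_def by blast
qed

lemma regular_value_poly: "regular_value (poly P) (poly P 0)"
  unfolding regular_value_def by (intro exI[of _ P] exI[of _ 1]) auto

lemma regular_value_const: "regular_value (\<lambda>_. c) c"
  unfolding regular_value_def by (intro exI[of _ "[:c:]"] exI[of _ 1]) auto

lemma regular_value_if: "(b \<Longrightarrow> regular_value g v) \<Longrightarrow> (\<not> b \<Longrightarrow> regular_value h w) \<Longrightarrow> regular_value (\<lambda>\<tau>. if b then g \<tau> else h \<tau>) (if b then v else w)"
  by simp

lemma regular_value_binary:
  assumes "regular_value g v" "regular_value h w"
  obtains P Q R T where "poly Q 0 \<noteq> 0" "poly T 0 \<noteq> 0" "v = poly P 0 / poly Q 0" "w = poly R 0 / poly T 0"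
    "\<forall>\<^sub>F \<tau> in cofinite. g \<tau> = poly P \<tau> / poly Q \<tau> \<and> h \<tau> = poly R \<tau> / poly T \<tau> \<and>
       poly Q \<tau> \<noteq> 0 \<and> poly T \<tau> \<noteq> 0"
proof -
  from assms obtain P Q R T where *: "poly Q 0 \<noteq> 0" "v = poly P 0 / poly Q 0"
    "\<forall>\<^sub>F \<tau> in cofinite. g \<tau> = poly P \<tau> / poly Q \<tau>" "poly T 0 \<noteq> 0" "w = poly R 0 / poly T 0"
    "\<forall>\<^sub>F \<tau> in cofinite. h \<tau> = poly R \<tau> / poly T \<tau>" unfolding regular_value_def by blast
  then have "Q \<noteq> 0" "T \<noteq> 0" by auto
  then have "\<forall>\<^sub>F \<tau> in cofinite. g \<tau> = poly P \<tau> / poly Q \<tau> \<and> h \<tau> = poly R \<tau> / poly T \<tau> \<and>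
       poly Q \<tau> \<noteq> 0 \<and> poly T \<tau> \<noteq> 0"
    using *(3,6) eventually_poly_nz[of Q] eventually_poly_nz[of T] by (simp add: eventually_conj_iff)
  with * that show ?thesis by blast
qed

lemma regular_value_add:
  assumes "regular_value g v" "regular_value h w"
  shows "regular_value (\<lambda>\<tau>. g \<tau> + h \<tau>) (v + w)"
proof -
  from regular_value_binary[OF assms] obtain P Q R T where *: "poly Q 0 \<noteq> 0" "poly T 0 \<noteq> 0"
    "v = poly P 0 / poly Q 0" "w = poly R 0 / poly T 0"
    and ev: "\<forall>\<^sub>F \<tau> in cofinite. g \<tau> = poly P \<tau> / poly Q \<tau> \<and> h \<tau> = poly R \<tau> / poly T \<tau> \<and>
       poly Q \<tau> \<noteq> 0 \<and> poly T \<tau> \<noteq> 0" .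
  show ?thesis
    unfolding regular_value_def
  proof (rule exI[of _ "P * T + R * Q"], rule exI[of _ "Q * T"], intro conjI)
    show "\<forall>\<^sub>F \<tau> in cofinite. g \<tau> + h \<tau> = poly (P * T + R * Q) \<tau> / poly (Q * T) \<tau>"
      using ev by eventually_elim (simp add: add_frac_eq)
  qed (use * in \<open>auto simp: add_frac_eq\<close>)
qed

lemma regular_value_mult:
  assumes "regular_value g v" "regular_value h w"
  shows "regular_value (\<lambda>\<tau>. g \<tau> * h \<tau>) (v * w)"
proof -
  from regular_value_binary[OF assms] obtain P Q R T where *: "poly Q 0 \<noteq> 0" "poly T 0 \<noteq> 0"
    "v = poly P 0 / poly Q 0" "w = poly R 0 / poly T 0"
    and ev: "\<forall>\<^sub>F \<tau> in cofinite. g \<tau> = poly P \<tau> / poly Q \<tau> \<and> h \<tau> = poly R \<tau> / poly T \<tau> \<and>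
       poly Q \<tau> \<noteq> 0 \<and> poly T \<tau> \<noteq> 0" .
  show ?thesis
    unfolding regular_value_def
  proof (rule exI[of _ "P * R"], rule exI[of _ "Q * T"], intro conjI)
    show "\<forall>\<^sub>F \<tau> in cofinite. g \<tau> * h \<tau> = poly (P * R) \<tau> / poly (Q * T) \<tau>"
      using ev by eventually_elim simp
  qed (use * in auto)
qed

lemma regular_value_inverse:
  assumes "regular_value g v" "v \<noteq> 0"
  shows "regular_value (\<lambda>\<tau>. inverse (g \<tau>)) (inverse v)"
proof -
  from assms(1) obtain P Q where PQ: "poly Q 0 \<noteq> 0" "v = poly P 0 / poly Q 0"
    "\<forall>\<^sub>F \<tau> in cofinite. g \<tau> = poly P \<tau> / poly Q \<tau>" unfolding regular_value_def by blast
  then have "\<forall>\<^sub>F \<tau> in cofinite. inverse (g \<tau>) = poly Q \<tau> / poly P \<tau>"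
    by (auto elim!: eventually_mono)
  with PQ assms(2) show ?thesis unfolding regular_value_def by (intro exI[of _ Q] exI[of _ P]) auto
qed

lemma regular_value_diff: "regular_value g v \<Longrightarrow> regular_value h w \<Longrightarrow> regular_value (\<lambda>\<tau>. g \<tau> - h \<tau>) (v - w)"
  using regular_value_add[OF _ regular_value_mult[OF regular_value_const[of "-1"]], of g v h w] by simp

lemma regular_value_divide: "regular_value g v \<Longrightarrow> regular_value h w \<Longrightarrow> w \<noteq> 0 \<Longrightarrow> regular_value (\<lambda>\<tau>. g \<tau> / h \<tau>) (v / w)"
  unfolding divide_inverse by (intro regular_value_mult regular_value_inverse)

lemma regular_value_power: "regular_value g v \<Longrightarrow> regular_value (\<lambda>\<tau>. g \<tau> ^ n) (v ^ n)"
  by (induction n) (auto intro: regular_value_const regular_value_mult)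

lemma regular_value_powi: "regular_value g v \<Longrightarrow> v \<noteq> 0 \<Longrightarrow> regular_value (\<lambda>\<tau>. g \<tau> powi n) (v powi n)"
  by (cases "n \<ge> 0") (auto simp: power_int_def intro: regular_value_power regular_value_inverse)

lemma regular_value_sum: "(\<And>x. x \<in> A \<Longrightarrow> regular_value (g x) (v x)) \<Longrightarrow> regular_value (\<lambda>\<tau>. \<Sum>x\<in>A. g x \<tau>) (\<Sum>x\<in>A. v x)"
  by (induction A rule: infinite_finite_induct) (auto intro: regular_value_const regular_value_add)

lemma regular_value_prod: "(\<And>x. x \<in> A \<Longrightarrow> regular_value (g x) (v x)) \<Longrightarrow> regular_value (\<lambda>\<tau>. \<Prod>x\<in>A. g x \<tau>) (\<Prod>x\<in>A. v x)"
  by (induction A rule: infinite_finite_induct) (auto intro: regular_value_const regular_value_mult)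

lemma regular_value_pair_prod:
  assumes "\<And>x y. x \<in> set l \<Longrightarrow> y \<in> set l \<Longrightarrow> x \<noteq> y \<Longrightarrow> regular_value (\<lambda>\<tau>. f \<tau> x y) (v x y)" "distinct l"
  shows "regular_value (\<lambda>\<tau>. pair_prod (f \<tau>) l) (pair_prod v l)"
  using assms
proof (induction l)
  case Nil
  then show ?case by (simp add: regular_value_const)
next
  case (Cons x l)
  have "regular_value (\<lambda>\<tau>. \<Prod>y\<in>set l. f \<tau> x y) (\<Prod>y\<in>set l. v x y)"
    by (rule regular_value_prod) (use Cons.prems in auto)
  moreover have "regular_value (\<lambda>\<tau>. pair_prod (f \<tau>) l) (pair_prod v l)"
    by (rule Cons.IH) (use Cons.prems in auto)
  ultimately show ?case by (simp add: regular_value_mult)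
qed

text \<open>Over an infinite field two quotients that agree off a finite set agree as rational
  functions, hence also at 0.\<close>

lemma regular_value_unique:
  fixes g :: "'a::field \<Rightarrow> 'a"
  assumes "regular_value g v" "regular_value g w" "infinite (UNIV :: 'a set)"
  shows "v = w"
proof -
  from regular_value_binary[OF assms(1,2)] obtain P Q R T where *: "poly Q 0 \<noteq> 0" "poly T 0 \<noteq> 0"
    "v = poly P 0 / poly Q 0" "w = poly R 0 / poly T 0"
    and ev: "\<forall>\<^sub>F \<tau> in cofinite. g \<tau> = poly P \<tau> / poly Q \<tau> \<and> g \<tau> = poly R \<tau> / poly T \<tau> \<and>
       poly Q \<tau> \<noteq> 0 \<and> poly T \<tau> \<noteq> 0" .
  have "P * T - R * Q = 0"
  proof (rule ccontr)
    assume "P * T - R * Q \<noteq> 0"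
    from eventually_poly_nz[OF this] ev have "\<forall>\<^sub>F \<tau>::'a in cofinite. False"
    proof eventually_elim
      case (elim \<tau>)
      then have "poly P \<tau> / poly Q \<tau> = poly R \<tau> / poly T \<tau>" by metis
      then have "poly P \<tau> * poly T \<tau> = poly R \<tau> * poly Q \<tau>" using elim by (simp add: frac_eq_eq)
      then show False using elim by simp
    qed
    then show False using assms(3) by (simp add: eventually_cofinite)
  qed
  then have "poly P 0 * poly T 0 = poly R 0 * poly Q 0"
    by (metis poly_mult eq_iff_diff_eq_0)
  then show ?thesis using * by (simp add: frac_eq_eq)
qed

context chain
begin

text \<open>
  If \<open>x\<close> and \<open>y = q x\<close> are both among the points, the pole of \<open>om x y\<close> has to be removed;
  clearing it annihilates the orders in which \<open>y\<close> precedes \<open>x\<close>, which no sequence of shifts produces.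
\<close>

definition om_collision :: "'a \<Rightarrow> 'a \<Rightarrow> 'a" where
  "om_collision x y = (if y = q * x then om_num x y / (x - y) else if x = q * y then 0 else om x y)"

text \<open>The points are deformed into general position, where the combination equals 1, and the
  poles are cleared. At parameter 0 the right-hand side is the product of the clearing factors, and
  the factor of the pair \<open>y0\<close>, \<open>q * y0\<close> vanishes.\<close>

lemma sum_om_collision_collision:
  fixes Y :: "'a set"
  assumes inf: "infinite (UNIV :: 'a set)" and q2: "q\<^sup>2 \<noteq> 1"
    and c: "\<And>S. gen S \<Longrightarrow> card S = k \<Longrightarrow> (\<Sum>w\<in>words k. c w * symm (mon w) S) = 1"
    and Y: "finite Y" "card Y = k" "0 \<notin> Y" and y0: "y0 \<in> Y" "q * y0 \<in> Y"
  shows "(\<Sum>w\<in>words k. c w * (\<Sum>l\<in>permutations_of_set Y. mon w l * pair_prod om_collision l)) = 0"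
proof -
  \<comment> \<open>The quadratic term destroys every proportionality: x = b y together with x^2 = b
    y^2, for nonzero x and y, forces b = 1 and x = y. A common rescaling of the points would
    preserve y = q x.\<close>
  define z :: "'a \<Rightarrow> 'a \<Rightarrow> 'a" where "z = (\<lambda>\<tau> y. y + \<tau> * y\<^sup>2)"
  \<comment> \<open>\<open>h\<close> clears the pole of \<open>om\<close> at y = q x. It enters
    \<open>f\<close> in both orders of the pair, so that all orderings receive the same factor; the
    clause \<open>x \<noteq> y\<close> makes it 1 on the diagonal.\<close>
  define h where "h = (\<lambda>\<tau> x y. if y = q * x \<and> x \<noteq> y then z \<tau> x - z \<tau> y / q else 1)"
  define f where "f = (\<lambda>\<tau> x y. om (z \<tau> x) (z \<tau> y) * (h \<tau> x y * h \<tau> y x))"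
  have regular_value_z: "regular_value (\<lambda>\<tau>. z \<tau> y) y" for y
    by (rule regular_value_cong[OF regular_value_poly[of "[:y, y\<^sup>2:]", simplified poly_pCons mult_zero_left add_0_right]])
       (simp add: z_def)
  have ev: "\<forall>\<^sub>F \<tau> in cofinite. z \<tau> x \<noteq> b * z \<tau> y" if "x \<in> Y" "y \<in> Y" "x \<noteq> y" for x y b
  proof -
    have "[:x - b * y, x\<^sup>2 - b * y\<^sup>2:] \<noteq> 0"
    proof
      assume "[:x - b * y, x\<^sup>2 - b * y\<^sup>2:] = 0"
      then have *: "x = b * y" "x\<^sup>2 = b * y\<^sup>2" by auto
      then have "b * (b - 1) * y\<^sup>2 = 0" by (simp add: power2_eq_square algebra_simps)
      moreover have "y \<noteq> 0" "x \<noteq> 0" using that Y by auto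
      ultimately show False using * that by auto
    qed
    from eventually_poly_nz[OF this] show ?thesis
      by eventually_elim (auto simp: z_def algebra_simps)
  qed
  have ev0: "\<forall>\<^sub>F \<tau> in cofinite. z \<tau> x \<noteq> 0" if "x \<in> Y" for x
  proof -
    have "[:x, x\<^sup>2:] \<noteq> 0" using that Y by auto
    from eventually_poly_nz[OF this] show ?thesis by (simp add: z_def)
  qed
  have "\<forall>\<^sub>F \<tau> in cofinite. \<forall>x\<in>Y. \<forall>y\<in>Y. x \<noteq> y \<longrightarrow> z \<tau> x \<noteq> 1 * z \<tau> y \<and> z \<tau> x \<noteq> q * z \<tau> y \<and>
      z \<tau> x \<noteq> p * z \<tau> y \<and> z \<tau> x \<noteq> p' * z \<tau> y"
  proof (intro eventually_ball_finite ballI Y(1))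
    fix x y assume xy: "x \<in> Y" "y \<in> Y"
    show "\<forall>\<^sub>F \<tau> in cofinite. x \<noteq> y \<longrightarrow> z \<tau> x \<noteq> 1 * z \<tau> y \<and> z \<tau> x \<noteq> q * z \<tau> y \<and>
      z \<tau> x \<noteq> p * z \<tau> y \<and> z \<tau> x \<noteq> p' * z \<tau> y"
    proof (cases "x = y")
      case False
      then have "\<forall>\<^sub>F \<tau> in cofinite. z \<tau> x \<noteq> 1 * z \<tau> y \<and> z \<tau> x \<noteq> q * z \<tau> y \<and>
        z \<tau> x \<noteq> p * z \<tau> y \<and> z \<tau> x \<noteq> p' * z \<tau> y"
        by (intro eventually_conj ev xy)
      then show ?thesis by eventually_elim blast
    qed simp
  qed
  moreover have "\<forall>\<^sub>F \<tau> in cofinite. \<forall>x\<in>Y. z \<tau> x \<noteq> 0"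
    by (intro eventually_ball_finite ballI Y(1) ev0)
  ultimately have generic: "\<forall>\<^sub>F \<tau> in cofinite. inj_on (z \<tau>) Y \<and> gen (z \<tau> ` Y)"
  proof eventually_elim
    case (elim \<tau>)
    show ?case
    proof
      show "inj_on (z \<tau>) Y"
      proof (rule inj_onI)
        fix x y assume "x \<in> Y" "y \<in> Y" "z \<tau> x = z \<tau> y"
        then show "x = y" using elim(1) by auto
      qed
      show "gen (z \<tau> ` Y)"
        unfolding gen_def om_num_factor
      proof (intro conjI ballI impI)
        show "finite (z \<tau> ` Y)" using Y by simp
        show "0 \<notin> z \<tau> ` Y" using elim(2) by auto
        fix u v assume "u \<in> z \<tau> ` Y" "v \<in> z \<tau> ` Y" "u \<noteq> v"
        then obtain x y where "x \<in> Y" "y \<in> Y" "u = z \<tau> x" "v = z \<tau> y" "x \<noteq> y" by auto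
        with elim(1) show "u \<noteq> q * v" "(u - p * v) * (u - p' * v) \<noteq> 0" by auto
      qed
    qed
  qed
  define D where "D = (\<lambda>\<tau>. \<Prod>x\<in>Y. \<Prod>y\<in>Y. h \<tau> x y)"
  have "\<forall>\<^sub>F \<tau> in cofinite. (\<Sum>w\<in>words k. c w * (\<Sum>l\<in>permutations_of_set Y. mon w (map (z \<tau>) l) * pair_prod (f \<tau>) l)) = D \<tau>"
    using generic
  proof eventually_elim
    case (elim \<tau>)
    have l: "pair_prod (f \<tau>) l = Om (map (z \<tau>) l) * D \<tau>" if "l \<in> permutations_of_set Y" for l
    proof -
      have "set l = Y" "distinct l" using that by (auto simp: permutations_of_set_def)
      then show ?thesis
        using elim pair_prod_symmetrized[of l "h \<tau>"]
        by (simp add: f_def pair_prod_mult Om_map D_def h_def)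
    qed
    have symm: "symm (mon w) (z \<tau> ` Y) = (\<Sum>l\<in>permutations_of_set Y. mon w (map (z \<tau>) l) * Om (map (z \<tau>) l))" for w
    proof -
      have "inj_on (map (z \<tau>)) (permutations_of_set Y)"
      proof (rule inj_on_subset)
        show "inj_on (map (z \<tau>)) (lists Y)" using elim by (intro inj_on_mapI) (auto simp: inj_on_def)
      qed (auto simp: permutations_of_set_def)
      then show ?thesis
        using elim unfolding symm_def
        by (simp add: permutations_of_set_image_inj sum.reindex)
    qed
    have "(\<Sum>w\<in>words k. c w * symm (mon w) (z \<tau> ` Y)) = 1"
      by (rule c) (use elim Y in \<open>auto simp: card_image\<close>)
    then have "D \<tau> = (\<Sum>w\<in>words k. c w * symm (mon w) (z \<tau> ` Y)) * D \<tau>" by simp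
    also have "\<dots> = (\<Sum>w\<in>words k. c w * (\<Sum>l\<in>permutations_of_set Y. mon w (map (z \<tau>) l) * pair_prod (f \<tau>) l))"
      unfolding symm sum_distrib_right sum_distrib_left
      by (intro sum.cong refl) (simp add: l mult_ac)
    finally show ?case ..
  qed
  moreover have "regular_value (\<lambda>\<tau>. \<Sum>w\<in>words k. c w * (\<Sum>l\<in>permutations_of_set Y. mon w (map (z \<tau>) l) * pair_prod (f \<tau>) l))
     (\<Sum>w\<in>words k. c w * (\<Sum>l\<in>permutations_of_set Y. mon w l * pair_prod om_collision l))"
  proof (intro regular_value_sum regular_value_mult[OF regular_value_const] regular_value_mult)
    fix w l assume l: "l \<in> permutations_of_set Y"
    then have l': "set l = Y" "distinct l" by (auto simp: permutations_of_set_def)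
    have mon: "regular_value (\<lambda>\<tau>. mon w (map (z \<tau>) l)) (mon w l)" if "0 \<notin> set l" for w l
      using that
    proof (induction l arbitrary: w)
      case (Cons y l)
      show ?case
      proof (cases w)
        case (Cons a w')
        have "regular_value (\<lambda>\<tau>. z \<tau> y powi a * mon w' (map (z \<tau>) l)) (y powi a * mon w' l)"
          by (intro regular_value_mult regular_value_powi regular_value_z Cons.IH) (use Cons.prems in auto)
        then show ?thesis using Cons by (simp add: mon_def)
      qed (simp add: mon_def regular_value_const)
    qed (simp add: mon_def regular_value_const)
    show "regular_value (\<lambda>\<tau>. mon w (map (z \<tau>) l)) (mon w l)" by (rule mon) (use l' Y in auto)
    show "regular_value (\<lambda>\<tau>. pair_prod (f \<tau>) l) (pair_prod om_collision l)"
    proof (rule regular_value_pair_prod[OF _ l'(2)])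
      fix x y assume xy: "x \<in> set l" "y \<in> set l" "x \<noteq> y"
      then have xy0: "x \<noteq> 0" "y \<noteq> 0" using l' Y by auto
      have om_num: "regular_value (\<lambda>\<tau>. om_num (z \<tau> x) (z \<tau> y)) (om_num x y)"
        unfolding om_num_def by (intro regular_value_add regular_value_diff regular_value_mult regular_value_power regular_value_divide regular_value_const regular_value_z q_nz)
      have om: "regular_value (\<lambda>\<tau>. om (z \<tau> x) (z \<tau> y)) (om x y)" if "y \<noteq> q * x"
      proof -
        have "x - y / q \<noteq> 0" using that q_nz by (auto simp: field_simps)
        then show ?thesis
          unfolding om_def using xy q_nz by (intro regular_value_divide om_num regular_value_mult regular_value_diff regular_value_z regular_value_const) auto
      qed
      show "regular_value (\<lambda>\<tau>. f \<tau> x y) (om_collision x y)"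
      proof (cases "y = q * x")
        case yx: True
        have "x \<noteq> q * y"
        proof
          assume "x = q * y"
          then have "(q\<^sup>2 - 1) * x = 0" using yx by (simp add: power2_eq_square algebra_simps)
          then show False using q2 xy0 by simp
        qed
        then have hxy: "h \<tau> x y = z \<tau> x - z \<tau> y / q" "h \<tau> y x = 1" for \<tau>
          using yx xy by (auto simp: h_def)
        have "regular_value (\<lambda>\<tau>. om_num (z \<tau> x) (z \<tau> y) / (z \<tau> x - z \<tau> y)) (om_num x y / (x - y))"
          using xy by (intro regular_value_divide om_num regular_value_diff regular_value_z) auto
        moreover have "\<forall>\<^sub>F \<tau> in cofinite. om_num (z \<tau> x) (z \<tau> y) / (z \<tau> x - z \<tau> y) = f \<tau> x y"
        proof -
          have "\<forall>\<^sub>F \<tau> in cofinite. z \<tau> y \<noteq> q * z \<tau> x" using ev xy l' by auto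
          then show ?thesis
          proof eventually_elim
            case (elim \<tau>)
            then have "z \<tau> x - z \<tau> y / q \<noteq> 0" using q_nz by (auto simp: field_simps)
            then show ?case unfolding f_def hxy om_def by simp
          qed
        qed
        ultimately show ?thesis using yx by (simp add: om_collision_def regular_value_cong)
      next
        case yx: False
        show ?thesis
        proof (cases "x = q * y")
          case True
          then have hxy: "h \<tau> x y = 1" "h \<tau> y x = z \<tau> y - z \<tau> x / q" for \<tau>
            using yx xy by (auto simp: h_def)
          have "regular_value (\<lambda>\<tau>. om (z \<tau> x) (z \<tau> y) * (1 * (z \<tau> y - z \<tau> x / q))) (om x y * (1 * (y - x / q)))"
            by (intro regular_value_mult om yx regular_value_diff regular_value_z regular_value_divide regular_value_const q_nz)
          moreover have "y - x / q = 0" using True q_nz by simp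
          ultimately show ?thesis using True yx unfolding f_def hxy om_collision_def by simp
        next
          case False
          then have "h \<tau> x y = 1" "h \<tau> y x = 1" for \<tau> using yx by (auto simp: h_def)
          then show ?thesis using om[OF yx] yx False by (simp add: f_def om_collision_def)
        qed
      qed
    qed
  qed
  ultimately have 1: "regular_value D (\<Sum>w\<in>words k. c w * (\<Sum>l\<in>permutations_of_set Y. mon w l * pair_prod om_collision l))"
    by (rule regular_value_cong[rotated])
  have "regular_value D (\<Prod>x\<in>Y. \<Prod>y\<in>Y. if y = q * x \<and> x \<noteq> y then x - y / q else 1)"
    unfolding D_def h_def
    by (intro regular_value_prod regular_value_if regular_value_const regular_value_diff regular_value_z regular_value_divide q_nz)
  moreover have "y0 \<noteq> q * y0" using y0 Y q_1 by auto
  then have "(\<Prod>x\<in>Y. \<Prod>y\<in>Y. if y = q * x \<and> x \<noteq> y then x - y / q else 1) = 0"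
    using y0 Y q_nz by (intro prod_zero bexI[of _ y0] bexI[of _ "q * y0"]) auto
  ultimately have "regular_value D 0" by (simp only:)
  then show ?thesis by (rule regular_value_unique[OF 1 _ inf])
qed

end

section \<open>Coefficients of products of first-order operators\<close>

lemma prod_pairs_remove:
  fixes f :: "'b \<Rightarrow> 'b \<Rightarrow> 'c::comm_monoid_mult"
  assumes "finite A" "i \<in> A"
  shows "(\<Prod>j\<in>A. \<Prod>k\<in>A - {j}. f j k) =
    (\<Prod>k\<in>A - {i}. f i k) * (\<Prod>k\<in>A - {i}. f k i) * (\<Prod>j\<in>A - {i}. \<Prod>k\<in>A - {i} - {j}. f j k)"
proof -
  have "(\<Prod>k\<in>A - {j}. f j k) = f j i * (\<Prod>k\<in>A - {i} - {j}. f j k)" if "j \<in> A - {i}" for j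
  proof -
    have "(\<Prod>k\<in>A - {j}. f j k) = f j i * (\<Prod>k\<in>A - {j} - {i}. f j k)"
      by (rule prod.remove) (use assms that in auto)
    then show ?thesis by (simp add: Diff_insert2[symmetric] Diff_insert[symmetric] insert_commute)
  qed
  then have "(\<Prod>j\<in>A - {i}. \<Prod>k\<in>A - {j}. f j k) =
     (\<Prod>j\<in>A - {i}. f j i) * (\<Prod>j\<in>A - {i}. \<Prod>k\<in>A - {i} - {j}. f j k)"
    by (simp add: prod.distrib)
  then show ?thesis
    using prod.remove[OF assms, of "\<lambda>j. \<Prod>k\<in>A - {j}. f j k"] by (simp add: mult_ac)
qed

text \<open>\<open>q_powers\<close> keeps the points x, q x, q^2 x, ... of a string distinct, and
  \<open>th_q_powers\<close> keeps \<open>om_num\<close> nonzero between a point and the later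
  points of its string.\<close>

locale macdonald = two_chains C q s p p' for C :: "'a::field set" and q s p p' +
  fixes th :: 'a and N :: nat
  assumes p_th: "p = inverse (th\<^sup>2)" and p'_th: "p' = th\<^sup>2 / q" and th_nz: "th \<noteq> 0"
    and q_powers: "\<And>r. r \<ge> 1 \<Longrightarrow> q ^ r \<noteq> 1"
    and th_q_powers: "\<And>r. th\<^sup>2 \<noteq> q ^ r" "\<And>r. th\<^sup>2 * q ^ r \<noteq> 1"
    and infinite_field: "infinite (UNIV :: 'a set)"
begin

definition pair_factor :: "'a \<Rightarrow> 'a \<Rightarrow> 'a" where
  "pair_factor x y = (th * x - inverse th * y) / (x - y)"

text \<open>This is where \<open>om\<close> comes from. If the shift of x acts to the left of the
  shift of y, the left operator contributes \<open>pair_factor x y\<close>, and the right one, in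
  which x has become \<open>q * x\<close>, contributes \<open>pair_factor y (q * x)\<close>.\<close>

lemma om_eq_pair_factor: "om x y = pair_factor x y * pair_factor y (q * x)"
proof -
  have "om_num x y = (x - inverse (th\<^sup>2) * y) * (x - th\<^sup>2 / q * y)"
    by (simp add: om_num_factor p_th p'_th)
  also have "\<dots> = (th * x - inverse th * y) * (th * y - inverse th * (q * x)) * (- 1 / q)"
    using th_nz q_nz by (simp add: field_simps power2_eq_square)
  finally have "om x y = (th * x - inverse th * y) * (th * y - inverse th * (q * x)) * (- 1 / q) /
      ((x - y) * (x - y / q))" by (simp add: om_def)
  also have "x - y / q = (y - q * x) * (- 1 / q)" using q_nz by (simp add: field_simps)
  finally show ?thesis
    using q_nz by (simp add: pair_factor_def)
qed

text \<open>All powers of \<open>q\<close> are quantified so that the condition survives the shifts;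
  the inequality with \<open>th\<close> says that the numerators of \<open>pair_factor\<close> do
  not vanish.\<close>

definition indep :: "(nat \<Rightarrow> 'a) \<Rightarrow> bool" where
  "indep x \<longleftrightarrow> (\<forall>i\<in>{1..N}. x i \<noteq> 0) \<and>
    (\<forall>i\<in>{1..N}. \<forall>j\<in>{1..N}. i \<noteq> j \<longrightarrow> (\<forall>m n. q ^ m * x i \<noteq> q ^ n * x j \<and> th\<^sup>2 * (q ^ m * x i) \<noteq> q ^ n * x j))"

lemma indep_update: "indep x \<Longrightarrow> indep (x(i := q * x i))"
proof -
  assume x: "indep x"
  have *: "q ^ m * (q * y) = q ^ Suc m * y" for m y by (simp add: mult_ac)
  show ?thesis
    using x q_nz unfolding indep_def fun_upd_apply
    by (simp only: * if_distrib[of "\<lambda>z. q ^ _ * z"] split: if_splits) (auto split: if_splits simp del: power_Suc)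
qed

lemma pair_factor_nz:
  assumes "indep x" "i \<in> {1..N}" "j \<in> {1..N}" "i \<noteq> j"
  shows "pair_factor (q ^ m * x i) (q ^ n * x j) \<noteq> 0"
proof -
  have "q ^ m * x i \<noteq> q ^ n * x j" "th\<^sup>2 * (q ^ m * x i) \<noteq> q ^ n * x j"
    using assms unfolding indep_def by blast+
  moreover have "th * (th * (q ^ m * x i) - inverse th * (q ^ n * x j)) = th\<^sup>2 * (q ^ m * x i) - q ^ n * x j"
    using th_nz by (simp add: right_diff_distrib power2_eq_square mult.assoc[symmetric])
  ultimately show ?thesis by (auto simp: pair_factor_def)
qed

lemma q_inj: "q ^ m = q ^ n \<longleftrightarrow> m = n"
proof
  have *: "False" if "q ^ m = q ^ n" "m < n" for m n
  proof -
    have "q ^ n = q ^ m * q ^ (n - m)" using that(2) by (simp flip: power_add)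
    then have "q ^ m * (q ^ (n - m) - 1) = 0" using that(1) by (simp add: right_diff_distrib)
    then show False using q_nz q_powers[of "n - m"] that(2) by simp
  qed
  assume "q ^ m = q ^ n"
  then show "m = n" using *[of m n] *[of n m] by (metis linorder_neqE_nat)
qed simp

text \<open>Guarantees that the reciprocals in \<open>chain_corr\<close> are genuine. The case
  \<open>c = 1\<close> is the one in which a pole has been cleared.\<close>

lemma om_collision_chain_nz:
  assumes "x \<noteq> 0" "c \<ge> 1"
  shows "om_collision x (q ^ c * x) \<noteq> 0"
proof -
  have "p * q ^ c \<noteq> 1" "p' * q ^ c \<noteq> 1"
  proof -
    show "p * q ^ c \<noteq> 1"
      using th_q_powers(1)[of c] th_nz by (auto simp: p_th field_simps)
    have "q ^ c = q * q ^ (c - 1)" using assms(2) by (simp flip: power_Suc)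
    then show "p' * q ^ c \<noteq> 1"
      using th_q_powers(2)[of "c - 1"] q_nz by (auto simp: p'_th)
  qed
  moreover have "om_num x (q ^ c * x) = (1 - p * q ^ c) * (1 - p' * q ^ c) * x\<^sup>2"
    by (simp add: om_num_factor power2_eq_square algebra_simps)
  ultimately have om_num: "om_num x (q ^ c * x) \<noteq> 0" using assms by simp
  have ne: "x \<noteq> q ^ c * x" using q_powers[OF assms(2)] assms(1) by auto
  have "x \<noteq> q * (q ^ c * x)"
    using q_powers[of "Suc c"] assms(1) by (auto simp flip: mult.assoc power_Suc)
  moreover have "x - q ^ c * x / q \<noteq> 0" if "q ^ c * x \<noteq> q * x"
    using that q_nz by (auto simp: field_simps)
  ultimately show ?thesis
    using om_num ne by (cases "q ^ c * x = q * x") (simp_all only: om_collision_def om_def if_True if_False, auto)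
qed

lemma om_collision_indep:
  assumes "indep x" "i \<in> {1..N}" "j \<in> {1..N}" "i \<noteq> j"
  shows "om_collision (x i) (q ^ n * x j) = pair_factor (x i) (q ^ n * x j) * pair_factor (q ^ n * x j) (q * x i)"
proof -
  have "q ^ 1 * x i \<noteq> q ^ n * x j" "q ^ 0 * x i \<noteq> q ^ Suc n * x j"
    using assms unfolding indep_def by blast+
  then have "q ^ n * x j \<noteq> q * x i" "x i \<noteq> q * (q ^ n * x j)" by (auto simp: mult_ac)
  then show ?thesis by (simp add: om_collision_def om_eq_pair_factor)
qed

section \<open>Coefficients of words of shifts\<close>

definition row_factor :: "(nat \<Rightarrow> 'a) \<Rightarrow> nat \<Rightarrow> 'a" where
  "row_factor x i = (\<Prod>j\<in>{1..N} - {i}. pair_factor (x i) (x j))"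

text \<open>The coefficient of the product of the shifts in \<open>M\<close> in the composite of
  degree-one operators with exponents \<open>w\<close>. The leftmost operator contributes the shift
  \<open>i\<close>, which rescales \<open>x i\<close> in all coefficients to its right.\<close>

fun word_coeff :: "(nat \<Rightarrow> 'a) \<Rightarrow> int list \<Rightarrow> nat multiset \<Rightarrow> 'a" where
  "word_coeff x [] M = (if M = {#} then 1 else 0)"
| "word_coeff x (b # w) M = (\<Sum>i\<in>set_mset M. x i powi b * row_factor x i * word_coeff (x(i := q * x i)) w (M - {#i#}))"

text \<open>The values at which the shifts act: by its turn number c + 1, the variable j has become
  \<open>q ^ c * x j\<close>.\<close>

definition shift_points :: "(nat \<Rightarrow> 'a) \<Rightarrow> nat multiset \<Rightarrow> 'a set" where
  "shift_points x M = (\<Union>j\<in>{1..N}. (\<lambda>c. q ^ c * x j) ` {..<count M j})"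

text \<open>Consider the shift at a = \<open>q ^ c * u\<close> and let d of the n shifts of v
  precede it. Its own coefficient contains \<open>pair_factor a (q ^ d * v)\<close>. The
  \<open>om\<close> factors between a and the points of v contain
  \<open>pair_factor a (q ^ e * v)\<close> for e = 1..d from the preceding points and for e = d..n-1
  from the following ones. The quotient of the two, \<open>pair_factor a v\<close> over the product
  for e < n, is independent of d.\<close>

definition pair_corr :: "'a \<Rightarrow> nat \<Rightarrow> 'a \<Rightarrow> nat \<Rightarrow> 'a" where
  "pair_corr u m v n = (\<Prod>c<m. pair_factor (q ^ c * u) v / (\<Prod>c'<n. pair_factor (q ^ c * u) (q ^ c' * v)))"

text \<open>A row factor contains no pair from within one string, so the factors
  \<open>om_collision\<close> of the only surviving order of that string are divided out.\<close>

definition chain_corr :: "'a \<Rightarrow> nat \<Rightarrow> 'a" where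
  "chain_corr u m = (\<Prod>c<m. \<Prod>c'\<in>{c<..<m}. 1 / om_collision (q ^ c * u) (q ^ c' * u))"

text \<open>
  The factor of the coefficient of \<open>\<Prod>i. \<Gamma>\<^sub>i ^ count M i\<close> that does not depend on the order in
  which the shifts are applied.
\<close>

definition coeff_factor :: "(nat \<Rightarrow> 'a) \<Rightarrow> nat multiset \<Rightarrow> 'a" where
  "coeff_factor x M = (\<Prod>i\<in>{1..N}. \<Prod>j\<in>{1..N} - {i}. pair_corr (x i) (count M i) (x j) (count M j)) *
     (\<Prod>i\<in>{1..N}. chain_corr (x i) (count M i))"

lemma prod_shift_points:
  assumes "indep x"
  shows "(\<Prod>y\<in>shift_points x M. f y) = (\<Prod>j\<in>{1..N}. \<Prod>c<count M j. f (q ^ c * x j))"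
proof -
  have "(\<Prod>y\<in>shift_points x M. f y) = (\<Prod>j\<in>{1..N}. \<Prod>y\<in>(\<lambda>c. q ^ c * x j) ` {..<count M j}. f y)"
    unfolding shift_points_def
    by (rule prod.UNION_disjoint) (use assms in \<open>auto simp: indep_def\<close>)
  also have "\<dots> = (\<Prod>j\<in>{1..N}. \<Prod>c<count M j. f (q ^ c * x j))"
  proof (intro prod.cong refl)
    fix j assume "j \<in> {1..N}"
    then have "inj_on (\<lambda>c. q ^ c * x j) {..<count M j}"
      using assms by (auto simp: inj_on_def indep_def q_inj)
    then show "(\<Prod>y\<in>(\<lambda>c. q ^ c * x j) ` {..<count M j}. f y) = (\<Prod>c<count M j. f (q ^ c * x j))"
      by (simp add: prod.reindex)
  qed
  finally show ?thesis .
qed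

lemma card_shift_points:
  assumes "indep x" "set_mset M \<subseteq> {1..N}"
  shows "card (shift_points x M) = size M"
proof -
  have "card (shift_points x M) = (\<Sum>j\<in>{1..N}. card ((\<lambda>c. q ^ c * x j) ` {..<count M j}))"
    unfolding shift_points_def
    by (rule card_UN_disjoint) (use assms in \<open>auto simp: indep_def\<close>)
  also have "\<dots> = (\<Sum>j\<in>{1..N}. count M j)"
  proof (intro sum.cong refl)
    fix j assume "j \<in> {1..N}"
    then have "inj_on (\<lambda>c. q ^ c * x j) {..<count M j}"
      using assms by (auto simp: inj_on_def indep_def q_inj)
    then show "card ((\<lambda>c. q ^ c * x j) ` {..<count M j}) = count M j"
      by (simp add: card_image)
  qed
  also have "\<dots> = size M"
    unfolding size_multiset_overloaded_eq
    by (rule sum.mono_neutral_right) (use assms(2) in \<open>auto simp: not_in_iff\<close>)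
  finally show ?thesis .
qed

lemma finite_shift_points: "finite (shift_points x M)"
  by (simp add: shift_points_def)

lemma zero_notin_shift_points: "indep x \<Longrightarrow> 0 \<notin> shift_points x M"
  using q_nz by (auto simp: shift_points_def indep_def)

lemma shift_points_remove:
  assumes "indep x" "i \<in># M" "i \<in> {1..N}"
  shows "shift_points x M - {x i} = shift_points (x(i := q * x i)) (M - {#i#})" (is "_ = shift_points ?x ?M")
proof -
  obtain m where m: "count M i = Suc m" using assms(2) by (metis count_greater_zero_iff gr0_implies_Suc)
  have 1: "(\<lambda>c. q ^ c * ?x j) ` {..<count ?M j} = (\<lambda>c. q ^ c * x j) ` {..<count M j}" if "j \<noteq> i" for j
    using that by simp
  have "(\<lambda>c. q ^ c * ?x i) ` {..<count ?M i} = (\<lambda>c. q ^ c * x i) ` Suc ` {..<m}"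
    unfolding image_image using m by (intro image_cong) (auto simp: mult_ac)
  also have "Suc ` {..<m} = {..<count M i} - {0}"
    unfolding m by (auto simp: image_iff less_Suc_eq_0_disj)
  finally have 2: "(\<lambda>c. q ^ c * ?x i) ` {..<count ?M i} = (\<lambda>c. q ^ c * x i) ` ({..<count M i} - {0})" .
  have "x i \<noteq> 0" using assms by (auto simp: indep_def)
  then have 3: "(\<lambda>c. q ^ c * x i) ` ({..<count M i} - {0}) = (\<lambda>c. q ^ c * x i) ` {..<count M i} - {x i}"
    by (subst inj_on_image_set_diff[of _ UNIV]) (auto simp: inj_on_def q_inj)
  have 4: "x i \<notin> (\<lambda>c. q ^ c * x j) ` {..<count M j}" if "j \<noteq> i" "j \<in> {1..N}" for j
  proof
    assume "x i \<in> (\<lambda>c. q ^ c * x j) ` {..<count M j}"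
    then obtain c where "q ^ 0 * x i = q ^ c * x j" by auto
    moreover have "q ^ 0 * x i \<noteq> q ^ c * x j"
      using assms(1,3) that unfolding indep_def by (metis (full_types))
    ultimately show False by blast
  qed
  have "shift_points ?x ?M = (\<Union>j\<in>{1..N}. (\<lambda>c. q ^ c * x j) ` {..<count M j} - {x i})"
    unfolding shift_points_def
  proof (intro SUP_cong refl)
    fix j assume "j \<in> {1..N}"
    show "(\<lambda>c. q ^ c * ?x j) ` {..<count ?M j} = (\<lambda>c. q ^ c * x j) ` {..<count M j} - {x i}"
    proof (cases "j = i")
      case True
      show ?thesis unfolding True 2 3 ..
    next
      case False
      show ?thesis
        unfolding 1[OF False] using 4[OF False \<open>j \<in> {1..N}\<close>] by blast
    qed
  qed
  then show ?thesis by (auto simp: shift_points_def)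
qed

lemma pair_corr_Suc_left:
  "pair_corr u (Suc m) v n = pair_factor u v / (\<Prod>c'<n. pair_factor u (q ^ c' * v)) * pair_corr (q * u) m v n"
proof -
  have *: "q ^ Suc c * u = q ^ c * (q * u)" for c by (simp add: mult_ac)
  show ?thesis unfolding pair_corr_def prod.lessThan_Suc_shift * by simp
qed

lemma pair_corr_Suc_right:
  assumes "\<And>c. c < m \<Longrightarrow> pair_factor (q ^ c * u) v \<noteq> 0" "\<And>c. c < m \<Longrightarrow> pair_factor (q ^ c * u) (q * v) \<noteq> 0"
  shows "pair_corr u m v (Suc n) * (\<Prod>c<m. pair_factor (q ^ c * u) (q * v)) = pair_corr u m (q * v) n"
proof -
  have *: "q ^ Suc c * v = q ^ c * (q * v)" for c by (simp add: mult_ac)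
  show ?thesis
    unfolding pair_corr_def prod.distrib[symmetric] prod.lessThan_Suc_shift *
    by (intro prod.cong refl) (use assms in simp)
qed

lemma chain_corr_Suc: "chain_corr u (Suc m) = (\<Prod>c<m. 1 / om_collision u (q ^ Suc c * u)) * chain_corr (q * u) m"
proof -
  have *: "q ^ Suc c * u = q ^ c * (q * u)" for c by (simp add: mult_ac)
  have 1: "{0<..<Suc m} = Suc ` {..<m}" "\<And>c. {Suc c<..<Suc m} = Suc ` {c<..<m}"
  proof -
    show "{0<..<Suc m} = Suc ` {..<m}"
    proof (rule set_eqI)
      show "y \<in> {0<..<Suc m} \<longleftrightarrow> y \<in> Suc ` {..<m}" for y by (cases y) auto
    qed
    show "{Suc c<..<Suc m} = Suc ` {c<..<m}" for c
    proof (rule set_eqI)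
      show "y \<in> {Suc c<..<Suc m} \<longleftrightarrow> y \<in> Suc ` {c<..<m}" for y by (cases y) auto
    qed
  qed
  show ?thesis
    unfolding chain_corr_def prod.lessThan_Suc_shift 1 prod.reindex[OF inj_Suc[THEN inj_on_subset, OF subset_UNIV]]
    by (simp add: * del: power_Suc)
qed

text \<open>The point \<open>x i\<close> is removed from the front. Pairs with \<open>i\<close> on
  the left release the row factor, pairs with \<open>i\<close> on the right absorb the second half
  of \<open>om\<close> when the base point moves to \<open>q * x i\<close>, and the string of
  \<open>i\<close> loses its first element.\<close>

lemma coeff_factor_step:
  assumes x: "indep x" and i: "i \<in># M" "i \<in> {1..N}"
  shows "coeff_factor x M * (\<Prod>y\<in>shift_points x M - {x i}. om_collision (x i) y) = row_factor x i * coeff_factor (x(i := q * x i)) (M - {#i#})"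
    (is "_ = _ * coeff_factor ?x ?M")
proof -
  let ?A = "{1..N}"
  obtain m where m: "count M i = Suc m" using i(1) by (metis count_greater_zero_iff gr0_implies_Suc)
  have cnt: "count ?M j = (if j = i then m else count M j)" for j using m by simp
  have nz: "pair_factor (q ^ c * x j) (q ^ d * x k) \<noteq> 0" if "j \<in> ?A" "k \<in> ?A" "j \<noteq> k" for j k c d
    using pair_factor_nz[OF x that] .
  have xi: "x i \<noteq> 0" using x i by (auto simp: indep_def)
  have O: "(\<Prod>y\<in>shift_points x M - {x i}. om_collision (x i) y) =
     (\<Prod>c<m. om_collision (x i) (q ^ Suc c * x i)) *
     ((\<Prod>j\<in>?A - {i}. \<Prod>c<count M j. pair_factor (x i) (q ^ c * x j)) *
      (\<Prod>j\<in>?A - {i}. \<Prod>c<count M j. pair_factor (q ^ c * x j) (q * x i)))"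
  proof -
    have "(\<Prod>y\<in>shift_points x M - {x i}. om_collision (x i) y) = (\<Prod>j\<in>?A. \<Prod>c<count ?M j. om_collision (x i) (q ^ c * ?x j))"
      unfolding shift_points_remove[OF x i] by (rule prod_shift_points[OF indep_update[OF x]])
    also have "\<dots> = (\<Prod>c<count ?M i. om_collision (x i) (q ^ c * ?x i)) *
        (\<Prod>j\<in>?A - {i}. \<Prod>c<count ?M j. om_collision (x i) (q ^ c * ?x j))"
      by (rule prod.remove) (use i in auto)
    also have "(\<Prod>c<count ?M i. om_collision (x i) (q ^ c * ?x i)) = (\<Prod>c<m. om_collision (x i) (q ^ Suc c * x i))"
      by (intro prod.cong) (auto simp: m mult_ac)
    also have "(\<Prod>j\<in>?A - {i}. \<Prod>c<count ?M j. om_collision (x i) (q ^ c * ?x j)) =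
        (\<Prod>j\<in>?A - {i}. \<Prod>c<count M j. pair_factor (x i) (q ^ c * x j) * pair_factor (q ^ c * x j) (q * x i))"
      by (intro prod.cong refl) (use om_collision_indep[OF x i(2)] in \<open>auto simp: cnt\<close>)
    finally show ?thesis by (simp only: prod.distrib)
  qed
  define R where "R = (\<Prod>j\<in>?A - {i}. \<Prod>k\<in>?A - {i} - {j}. pair_corr (x j) (count M j) (x k) (count M k))"
  define T where "T = (\<Prod>j\<in>?A - {i}. chain_corr (x j) (count M j))"
  have B1: "coeff_factor x M = (\<Prod>k\<in>?A - {i}. pair_corr (x i) (Suc m) (x k) (count M k)) *
      (\<Prod>k\<in>?A - {i}. pair_corr (x k) (count M k) (x i) (Suc m)) * R * (chain_corr (x i) (Suc m) * T)"
    unfolding coeff_factor_def prod_pairs_remove[OF finite_atLeastAtMost i(2)]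
      prod.remove[OF finite_atLeastAtMost i(2), of "\<lambda>i. chain_corr (x i) (count M i)"] m R_def T_def by simp
  have B2: "coeff_factor ?x ?M = (\<Prod>k\<in>?A - {i}. pair_corr (q * x i) m (x k) (count M k)) *
      (\<Prod>k\<in>?A - {i}. pair_corr (x k) (count M k) (q * x i) m) * R * (chain_corr (q * x i) m * T)"
  proof -
    have "(\<Prod>k\<in>?A - {i}. pair_corr (?x i) (count ?M i) (?x k) (count ?M k)) = (\<Prod>k\<in>?A - {i}. pair_corr (q * x i) m (x k) (count M k))"
      "(\<Prod>k\<in>?A - {i}. pair_corr (?x k) (count ?M k) (?x i) (count ?M i)) = (\<Prod>k\<in>?A - {i}. pair_corr (x k) (count M k) (q * x i) m)"
      "(\<Prod>j\<in>?A - {i}. \<Prod>k\<in>?A - {i} - {j}. pair_corr (?x j) (count ?M j) (?x k) (count ?M k)) = R"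
      "(\<Prod>j\<in>?A - {i}. chain_corr (?x j) (count ?M j)) = T"
      unfolding R_def T_def by (intro prod.cong refl; simp add: m)+
    then show ?thesis
      unfolding coeff_factor_def prod_pairs_remove[OF finite_atLeastAtMost i(2)]
        prod.remove[OF finite_atLeastAtMost i(2), of "\<lambda>i. chain_corr (?x i) (count ?M i)"]
      by (simp add: m)
  qed
  have 1: "(\<Prod>k\<in>?A - {i}. pair_corr (x i) (Suc m) (x k) (count M k)) * (\<Prod>j\<in>?A - {i}. \<Prod>c<count M j. pair_factor (x i) (q ^ c * x j)) =
     row_factor x i * (\<Prod>k\<in>?A - {i}. pair_corr (q * x i) m (x k) (count M k))"
    unfolding row_factor_def prod.distrib[symmetric]
  proof (intro prod.cong refl)
    fix k assume k: "k \<in> ?A - {i}"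
    have "(\<Prod>c<count M k. pair_factor (x i) (q ^ c * x k)) \<noteq> 0"
      using nz[of i k 0] k i by (auto simp: prod_zero_iff)
    then show "pair_corr (x i) (Suc m) (x k) (count M k) * (\<Prod>c<count M k. pair_factor (x i) (q ^ c * x k)) =
       pair_factor (x i) (x k) * pair_corr (q * x i) m (x k) (count M k)"
      by (simp add: pair_corr_Suc_left)
  qed
  have 2: "(\<Prod>k\<in>?A - {i}. pair_corr (x k) (count M k) (x i) (Suc m)) * (\<Prod>j\<in>?A - {i}. \<Prod>c<count M j. pair_factor (q ^ c * x j) (q * x i)) =
     (\<Prod>k\<in>?A - {i}. pair_corr (x k) (count M k) (q * x i) m)"
    unfolding prod.distrib[symmetric]
  proof (intro prod.cong refl pair_corr_Suc_right)
    fix k c assume "k \<in> ?A - {i}"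
    then show "pair_factor (q ^ c * x k) (x i) \<noteq> 0" "pair_factor (q ^ c * x k) (q * x i) \<noteq> 0"
      using nz[of k i c 0] nz[of k i c 1] i by auto
  qed
  have 3: "chain_corr (x i) (Suc m) * (\<Prod>c<m. om_collision (x i) (q ^ Suc c * x i)) = chain_corr (q * x i) m"
  proof -
    have "(\<Prod>c<m. 1 / om_collision (x i) (q ^ Suc c * x i)) * (\<Prod>c<m. om_collision (x i) (q ^ Suc c * x i)) = 1"
      unfolding prod.distrib[symmetric]
      by (intro prod.neutral ballI) (use om_collision_chain_nz[OF xi, of "Suc _"] in simp)
    then show ?thesis unfolding chain_corr_Suc by (simp only: mult_ac) (simp only: mult.assoc[symmetric] mult_1_left)
  qed
  have alg: "(a * b * r * (d * t)) * (o' * (u * v)) = (a * u) * (b * v) * r * ((d * o') * t)"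
    for a b r d t o' u v :: 'a by (simp only: mult_ac)
  show ?thesis
    unfolding B1 B2 O alg 1 2 3 by (simp only: mult_ac)
qed

lemma word_coeff_eq:
  assumes "indep x" "set_mset M \<subseteq> {1..N}" "size M = length w"
  shows "word_coeff x w M = coeff_factor x M * (\<Sum>l\<in>permutations_of_set (shift_points x M). mon w l * pair_prod om_collision l)"
  using assms
proof (induction w arbitrary: x M)
  case Nil
  then have "M = {#}" by simp
  then show ?case by (simp add: shift_points_def coeff_factor_def pair_corr_def chain_corr_def mon_def)
next
  case (Cons b w)
  let ?T = "\<lambda>w Y. \<Sum>l\<in>permutations_of_set Y. mon w l * pair_prod om_collision l"
  have M: "i \<in> {1..N}" if "i \<in># M" for i using that Cons.prems by auto
  have inj: "inj_on x (set_mset M)"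
  proof (rule inj_onI)
    fix i j assume "i \<in># M" "j \<in># M" "x i = x j"
    moreover from this have "q ^ 0 * x i = q ^ 0 * x j" by simp
    ultimately show "i = j" using Cons.prems(1) M unfolding indep_def by blast
  qed
  have sub: "x ` set_mset M \<subseteq> shift_points x M"
  proof
    fix y assume "y \<in> x ` set_mset M"
    then obtain i where "y = x i" "i \<in># M" by auto
    then show "y \<in> shift_points x M" using M unfolding shift_points_def by (auto intro!: bexI[of _ i] image_eqI[of _ _ 0])
  qed
  have ne: "shift_points x M \<noteq> {}"
    using card_shift_points[OF Cons.prems(1,2)] Cons.prems(3) by auto
  have "?T (b # w) (shift_points x M) = (\<Sum>y\<in>shift_points x M. y powi b * (\<Prod>y'\<in>shift_points x M - {y}. om_collision y y') * ?T w (shift_points x M - {y}))"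
    unfolding sum_permutations_of_set_Cons[OF finite_shift_points ne] sum_distrib_left
    by (intro sum.cong refl) (auto simp: mon_def permutations_of_set_def mult_ac)
  also have "\<dots> = (\<Sum>y\<in>x ` set_mset M. y powi b * (\<Prod>y'\<in>shift_points x M - {y}. om_collision y y') * ?T w (shift_points x M - {y}))"
  proof (rule sum.mono_neutral_right[OF finite_shift_points sub], intro ballI)
    \<comment> \<open>If an ordering starts inside a string, the predecessor y/q comes later, and
      this pair contributes 0. Only the first points of the strings can come first, just as the
      first operator can only act at some \<open>x i\<close>.\<close>
    fix y assume y: "y \<in> shift_points x M - x ` set_mset M"
    then obtain j c where jc: "j \<in> {1..N}" "c < count M j" "y = q ^ c * x j" by (auto simp: shift_points_def)
    then have "j \<in># M" by (auto simp: not_in_iff intro: ccontr)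
    then have "c \<noteq> 0" using y jc by auto
    then obtain c' where c': "c = Suc c'" by (cases c) auto
    let ?y = "q ^ c' * x j"
    have yq: "y = q * ?y" using jc c' by (simp add: mult_ac)
    have y0: "?y \<noteq> 0" using Cons.prems(1) jc q_nz by (auto simp: indep_def)
    have "?y \<in> shift_points x M"
      unfolding shift_points_def using jc c' by (intro UN_I[of j] image_eqI[of _ _ c']) auto
    moreover have "?y \<noteq> y" using yq y0 q_1 by auto
    moreover have "?y \<noteq> q * y"
    proof
      assume "?y = q * y"
      then have "(1 - q\<^sup>2) * ?y = 0" using yq by (simp add: power2_eq_square algebra_simps)
      then show False using y0 q_powers[of 2] by simp
    qed
    then have "om_collision y ?y = 0" unfolding om_collision_def by (simp only: if_not_P if_P[OF yq] if_False)
    ultimately have "(\<Prod>y'\<in>shift_points x M - {y}. om_collision y y') = 0"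
      using finite_shift_points by (intro prod_zero bexI[of _ ?y]) auto
    then show "y powi b * (\<Prod>y'\<in>shift_points x M - {y}. om_collision y y') * ?T w (shift_points x M - {y}) = 0" by simp
  qed
  also have "\<dots> = (\<Sum>i\<in>set_mset M. x i powi b * (\<Prod>y'\<in>shift_points x M - {x i}. om_collision (x i) y') * ?T w (shift_points x M - {x i}))"
    by (simp add: sum.reindex[OF inj])
  finally have "coeff_factor x M * ?T (b # w) (shift_points x M) =
      (\<Sum>i\<in>set_mset M. x i powi b * (coeff_factor x M * (\<Prod>y'\<in>shift_points x M - {x i}. om_collision (x i) y')) * ?T w (shift_points x M - {x i}))"
    by (simp only: sum_distrib_left mult_ac)
  also have "\<dots> = word_coeff x (b # w) M"
    unfolding word_coeff.simps
  proof (intro sum.cong refl)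
    fix i assume i: "i \<in># M"
    have "word_coeff (x(i := q * x i)) w (M - {#i#}) =
        coeff_factor (x(i := q * x i)) (M - {#i#}) * ?T w (shift_points (x(i := q * x i)) (M - {#i#}))"
    proof (rule Cons.IH)
      show "indep (x(i := q * x i))" by (rule indep_update[OF Cons.prems(1)])
    qed (use Cons.prems i in \<open>auto simp: size_Diff_singleton dest: in_diffD\<close>)
    then show "x i powi b * (coeff_factor x M * (\<Prod>y'\<in>shift_points x M - {x i}. om_collision (x i) y')) * ?T w (shift_points x M - {x i}) =
      x i powi b * row_factor x i * word_coeff (x(i := q * x i)) w (M - {#i#})"
      unfolding coeff_factor_step[OF Cons.prems(1) i M[OF i]] by (simp add: shift_points_remove[OF Cons.prems(1) i M[OF i]] mult_ac)
  qed
  finally show ?case ..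
qed

end

section \<open>From words of shifts to a single operator\<close>

context macdonald
begin

text \<open>The extra factor is a power of the product of all points. It is the same for every
  ordering, which reduces arbitrary \<open>n\<close> to the constant function 1.\<close>

lemma mon_shift:
  assumes "length l = length w" "0 \<notin> set l" "distinct l"
  shows "mon (map (\<lambda>a. a + n) w) l = (\<Prod>y\<in>set l. y) powi n * mon w l"
  using assms
proof (induction w arbitrary: l)
  case (Cons a w)
  then obtain y l' where l: "l = y # l'" by (cases l) auto
  have y: "y \<noteq> 0" "y \<notin> set l'" using Cons.prems l by auto
  have "mon (map (\<lambda>a. a + n) w) l' = (\<Prod>y\<in>set l'. y) powi n * mon w l'"
    by (rule Cons.IH) (use Cons.prems l in auto)
  moreover have "mon (map (\<lambda>a. a + n) (a # w)) l = y powi (a + n) * mon (map (\<lambda>a. a + n) w) l'"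
    "mon (a # w) l = y powi a * mon w l'" by (simp_all add: mon_def l)
  ultimately show ?case
    using y by (simp add: l power_int_add power_int_mult_distrib mult_ac)
qed (simp add: mon_def)

text \<open>For distinct shifts, \<open>pair_corr\<close> has equal numerator and denominator when
  both indices are shifted and is empty when the first is not. Only pairs from the set to its
  complement remain.\<close>

lemma coeff_factor_set:
  assumes "indep x" "set_mset M \<subseteq> {1..N}" "\<And>i. count M i \<le> 1"
  shows "coeff_factor x M = (\<Prod>i\<in>set_mset M. \<Prod>j\<in>{1..N} - set_mset M. pair_factor (x i) (x j))"
proof -
  let ?M = "set_mset M"
  have cnt: "count M i = (if i \<in> ?M then 1 else 0)" for i
    using assms(3)[of i] by (auto simp: not_in_iff simp flip: count_greater_zero_iff)
  have pair_corr: "pair_corr (x i) (count M i) (x j) (count M j) = (if i \<in> ?M \<and> j \<notin> ?M then pair_factor (x i) (x j) else 1)"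
    if "i \<in> {1..N}" "j \<in> {1..N}" "i \<noteq> j" for i j
    using pair_factor_nz[OF assms(1) that, of 0 0] unfolding pair_corr_def cnt by auto
  have "coeff_factor x M = (\<Prod>i\<in>{1..N}. \<Prod>j\<in>{1..N} - {i}. if i \<in> ?M \<and> j \<notin> ?M then pair_factor (x i) (x j) else 1)"
  proof -
    have "chain_corr (x i) (count M i) = 1" for i unfolding chain_corr_def cnt by auto
    moreover have "(\<Prod>i\<in>{1..N}. \<Prod>j\<in>{1..N} - {i}. pair_corr (x i) (count M i) (x j) (count M j)) =
        (\<Prod>i\<in>{1..N}. \<Prod>j\<in>{1..N} - {i}. if i \<in> ?M \<and> j \<notin> ?M then pair_factor (x i) (x j) else 1)"
      by (intro prod.cong refl pair_corr) auto
    ultimately show ?thesis by (simp add: coeff_factor_def)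
  qed
  also have "\<dots> = (\<Prod>i\<in>?M. \<Prod>j\<in>{1..N} - {i}. if i \<in> ?M \<and> j \<notin> ?M then pair_factor (x i) (x j) else 1)"
    by (rule prod.mono_neutral_right) (use assms(2) in \<open>auto intro: prod.neutral\<close>)
  also have "\<dots> = (\<Prod>i\<in>?M. \<Prod>j\<in>{1..N} - ?M. pair_factor (x i) (x j))"
  proof (rule prod.cong[OF refl])
    fix i assume i: "i \<in> ?M"
    have "(\<Prod>j\<in>{1..N} - {i}. if i \<in> ?M \<and> j \<notin> ?M then pair_factor (x i) (x j) else 1) =
        (\<Prod>j\<in>{1..N} - ?M. if i \<in> ?M \<and> j \<notin> ?M then pair_factor (x i) (x j) else 1)"
      by (rule prod.mono_neutral_right) (use i in auto)
    also have "\<dots> = (\<Prod>j\<in>{1..N} - ?M. pair_factor (x i) (x j))"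
      by (intro prod.cong refl) (use i in auto)
    finally show "(\<Prod>j\<in>{1..N} - {i}. if i \<in> ?M \<and> j \<notin> ?M then pair_factor (x i) (x j) else 1) =
       (\<Prod>j\<in>{1..N} - ?M. pair_factor (x i) (x j))" .
  qed
  finally show ?thesis .
qed

lemma gen_image:
  assumes "indep x" "J \<subseteq> {1..N}"
  shows "gen (x ` J)" "inj_on x J"
proof -
  have neq: "q ^ m * x i \<noteq> q ^ n * x j" "th\<^sup>2 * (q ^ m * x i) \<noteq> q ^ n * x j"
    if "i \<in> J" "j \<in> J" "i \<noteq> j" for i j m n
    using assms that unfolding indep_def by blast+
  show inj: "inj_on x J"
  proof (rule inj_onI, rule ccontr)
    fix i j assume "i \<in> J" "j \<in> J" "x i = x j" "i \<noteq> j"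
    with neq(1)[of i j 0 0] show False by simp
  qed
  show "gen (x ` J)"
    unfolding gen_def
  proof (intro conjI ballI impI)
    show "finite (x ` J)" using assms(2) by (auto intro: finite_subset)
    show "0 \<notin> x ` J" using assms by (auto simp: indep_def)
    fix u v assume "u \<in> x ` J" "v \<in> x ` J" "u \<noteq> v"
    then obtain i j where ij: "i \<in> J" "j \<in> J" "i \<noteq> j" "u = x i" "v = x j" by auto
    show "u \<noteq> q * v" using neq(1)[of i j 0 1] ij by auto
    have "u \<noteq> p * v"
      using neq(2)[of i j 0 0] ij th_nz by (auto simp: p_th field_simps)
    moreover have "u \<noteq> p' * v"
      using neq(2)[of j i 0 1] ij q_nz by (auto simp: p'_th field_simps)
    ultimately show "om_num u v \<noteq> 0" by (simp add: om_num_factor)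
  qed
qed

text \<open>The coefficients representing the constant 1 serve all \<open>n\<close>,
  \<open>x\<close> and \<open>M\<close> at once, since everything else is independent of the
  ordering. Without repetitions in \<open>M\<close> the remaining sum is 1; a repetition puts both
  \<open>x i\<close> and \<open>q * x i\<close> among the points and makes it 0.\<close>

theorem sum_word_coeff:
  assumes "k \<ge> 1"
  shows "\<exists>c. (\<forall>w. c w \<in> C) \<and> (\<forall>x M n. indep x \<longrightarrow> set_mset M \<subseteq> {1..N} \<longrightarrow> size M = k \<longrightarrow>
    (\<Sum>w\<in>words k. c w * word_coeff x (map (\<lambda>a. a + n) w) M) =
    (if \<forall>i. count M i \<le> 1 then (\<Prod>i\<in>set_mset M. x i) powi n *
       (\<Prod>i\<in>set_mset M. \<Prod>j\<in>{1..N} - set_mset M. pair_factor (x i) (x j)) else 0))"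
proof -
  from inA_one[OF assms] obtain c where c: "\<And>w. c w \<in> C"
    "\<And>S. gen S \<Longrightarrow> card S = k \<Longrightarrow> (\<Sum>w\<in>words k. c w * symm (mon w) S) = 1"
    unfolding inA_def by metis
  have "(\<Sum>w\<in>words k. c w * word_coeff x (map (\<lambda>a. a + n) w) M) =
    (if \<forall>i. count M i \<le> 1 then (\<Prod>i\<in>set_mset M. x i) powi n *
       (\<Prod>i\<in>set_mset M. \<Prod>j\<in>{1..N} - set_mset M. pair_factor (x i) (x j)) else 0)"
    if x: "indep x" and M: "set_mset M \<subseteq> {1..N}" "size M = k" for x M n
  proof -
    let ?Y = "shift_points x M"
    let ?T = "\<Sum>w\<in>words k. c w * (\<Sum>l\<in>permutations_of_set ?Y. mon w l * pair_prod om_collision l)"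
    have Y: "finite ?Y" "card ?Y = k" "0 \<notin> ?Y"
      using card_shift_points[OF x M(1)] M(2) finite_shift_points zero_notin_shift_points[OF x] by auto
    have "(\<Sum>w\<in>words k. c w * word_coeff x (map (\<lambda>a. a + n) w) M) =
        (\<Sum>w\<in>words k. coeff_factor x M * (\<Prod>y\<in>?Y. y) powi n * (c w * (\<Sum>l\<in>permutations_of_set ?Y. mon w l * pair_prod om_collision l)))"
    proof (intro sum.cong refl)
      fix w assume "w \<in> words k"
      then have w: "length w = k" by (simp add: words_def)
      have "word_coeff x (map (\<lambda>a. a + n) w) M = coeff_factor x M * (\<Sum>l\<in>permutations_of_set ?Y. mon (map (\<lambda>a. a + n) w) l * pair_prod om_collision l)"
        by (rule word_coeff_eq) (use x M w in auto)
      also have "(\<Sum>l\<in>permutations_of_set ?Y. mon (map (\<lambda>a. a + n) w) l * pair_prod om_collision l) =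
         (\<Sum>l\<in>permutations_of_set ?Y. (\<Prod>y\<in>?Y. y) powi n * (mon w l * pair_prod om_collision l))"
      proof (intro sum.cong refl)
        fix l assume "l \<in> permutations_of_set ?Y"
        then have l: "set l = ?Y" "distinct l" by (auto simp: permutations_of_set_def)
        then have "length l = length w" using w Y by (metis distinct_card)
        then show "mon (map (\<lambda>a. a + n) w) l * pair_prod om_collision l = (\<Prod>y\<in>?Y. y) powi n * (mon w l * pair_prod om_collision l)"
          using mon_shift[of l w n] l Y by simp
      qed
      finally show "c w * word_coeff x (map (\<lambda>a. a + n) w) M =
         coeff_factor x M * (\<Prod>y\<in>?Y. y) powi n * (c w * (\<Sum>l\<in>permutations_of_set ?Y. mon w l * pair_prod om_collision l))"
        by (simp only: sum_distrib_left[symmetric]) (simp only: mult_ac)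
    qed
    then have *: "(\<Sum>w\<in>words k. c w * word_coeff x (map (\<lambda>a. a + n) w) M) = coeff_factor x M * (\<Prod>y\<in>?Y. y) powi n * ?T"
      by (simp only: sum_distrib_left)
    show ?thesis
    proof (cases "\<forall>i. count M i \<le> 1")
      case True
      have YM: "?Y = x ` set_mset M"
      proof -
        have "(\<lambda>c. q ^ c * x j) ` {..<count M j} = (if j \<in># M then {x j} else {})" for j
        proof -
          have "count M j = (if j \<in># M then 1 else 0)"
            using True[rule_format, of j] by (auto simp: not_in_iff simp flip: count_greater_zero_iff)
          then show ?thesis by auto
        qed
        then show ?thesis unfolding shift_points_def using M(1) by auto
      qed
      note g = gen_image[OF x M(1)]
      have "pair_prod om_collision l = Om l" if "l \<in> permutations_of_set ?Y" for l
      proof -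
        have l: "set l = ?Y" "distinct l" using that by (auto simp: permutations_of_set_def)
        show ?thesis
          unfolding Om_eq_pair_prod
        proof (rule pair_prod_cong[OF l(2)])
          fix u v assume "u \<in> set l" "v \<in> set l" and "u \<noteq> v"
          then have "u \<noteq> q * v" "v \<noteq> q * u" using g(1) l unfolding YM gen_def by metis+
          then show "om_collision u v = om u v" by (simp add: om_collision_def)
        qed
      qed
      then have "?T = (\<Sum>w\<in>words k. c w * symm (mon w) ?Y)" by (simp add: symm_def)
      also have "\<dots> = 1" by (rule c(2)) (use g Y YM in auto)
      finally have "?T = 1" .
      moreover have "(\<Prod>y\<in>?Y. y) = (\<Prod>i\<in>set_mset M. x i)"
        unfolding YM by (simp add: prod.reindex[OF g(2)])
      ultimately show ?thesis
        unfolding * using True coeff_factor_set[OF x M(1)] by (simp add: mult_ac)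
    next
      case False
      then obtain i where i: "count M i \<ge> 2" by (metis not_less_eq_eq one_add_one plus_1_eq_Suc)
      then have "i \<in># M" by (metis count_greater_zero_iff less_le_trans pos2)
      then have iN: "i \<in> {1..N}" using M by auto
      have "q ^ 0 * x i \<in> ?Y" "q ^ 1 * x i \<in> ?Y"
        unfolding shift_points_def using i by (rule_tac UN_I[OF iN], intro imageI lessThan_iff[THEN iffD2], linarith)+
      then have "x i \<in> ?Y" "q * x i \<in> ?Y" by simp_all
      then have "?T = 0"
        by (intro sum_om_collision_collision[OF infinite_field _ c(2)] Y) (use q_powers[of 2] in auto)
      then show ?thesis unfolding * if_not_P[OF False] by simp
    qed
  qed
  with c(1) show ?thesis by blast
qed

text \<open>Meant for \<open>h = qshift i\<close>, which fixes q and theta: moving a shift to the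
  right past a coefficient evaluates that coefficient at the rescaled variables.\<close>

lemma word_coeff_hom:
  fixes h :: "'a \<Rightarrow> 'a"
  assumes add: "\<And>u v. h (u + v) = h u + h v" and mult: "\<And>u v. h (u * v) = h u * h v"
    and inv: "\<And>u. h (inverse u) = inverse (h u)" and one: "h 1 = 1" and zero: "h 0 = 0"
    and q: "h q = q" and th: "h th = th"
  shows "h (word_coeff x w M) = word_coeff (\<lambda>i. h (x i)) w M"
proof -
  have minus: "h (- u) = - h u" for u using add[of u "- u"] zero by (simp add: eq_neg_iff_add_eq_0 add.commute)
  have sum: "h (sum f A) = (\<Sum>y\<in>A. h (f y))" for f :: "nat \<Rightarrow> 'a" and A
    by (induction A rule: infinite_finite_induct) (auto simp: zero add)
  have prod: "h (prod f A) = (\<Prod>y\<in>A. h (f y))" for f :: "nat \<Rightarrow> 'a" and A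
    by (induction A rule: infinite_finite_induct) (auto simp: one mult)
  have power: "h (u ^ n) = h u ^ n" for u n by (induction n) (auto simp: one mult)
  have powi: "h (u powi b) = h u powi b" for u b by (auto simp: power_int_def power inv)
  have diff: "h (u - v) = h u - h v" for u v using add[of u "- v"] minus by simp
  have pair_factor: "h (pair_factor u v) = pair_factor (h u) (h v)" for u v
    by (simp add: pair_factor_def divide_inverse mult inv diff th)
  show ?thesis
  proof (induction w arbitrary: x M)
    case Nil
    then show ?case by (simp add: one zero)
  next
    case (Cons b w)
    have "(\<lambda>j. h ((x(i := q * x i)) j)) = (\<lambda>j. h (x j))(i := q * h (x i))" for i
      by (auto simp: mult q)
    then show ?case
      by (simp only: word_coeff.simps sum mult powi row_factor_def prod pair_factor Cons.IH)
  qed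
qed

end

section \<open>The operators on rational functions\<close>

lemma qt_subfieldI: "b \<noteq> 0 \<Longrightarrow> Fract (pcompose a (monom 1 2)) (pcompose b (monom 1 2)) \<in> qt_subfield"
  unfolding qt_subfield_def by blast

lemma pcompose_monom_2_eq_0: "pcompose b (monom 1 2) = 0 \<longleftrightarrow> b = (0 :: complex poly poly)"
  by (rule pcompose_eq_0_iff) (simp add: degree_monom_eq)

lemma qt_subfield_closed:
  shows "1 \<in> qt_subfield" "qq \<in> qt_subfield" "theta\<^sup>2 \<in> qt_subfield"
    and "x \<in> qt_subfield \<Longrightarrow> y \<in> qt_subfield \<Longrightarrow> x + y \<in> qt_subfield"
    and "x \<in> qt_subfield \<Longrightarrow> y \<in> qt_subfield \<Longrightarrow> x * y \<in> qt_subfield"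
    and "x \<in> qt_subfield \<Longrightarrow> - x \<in> qt_subfield"
    and "x \<in> qt_subfield \<Longrightarrow> inverse x \<in> qt_subfield"
proof -
  show "1 \<in> qt_subfield" using qt_subfieldI[of 1 1] by (simp add: One_fract_def pcompose_1)
  show "qq \<in> qt_subfield" using qt_subfieldI[of 1 "[:[:0, 1:]:]"] by (simp add: qq_def pcompose_1)
  have "monom (1 :: complex poly) 2 = [:0, 0, 1:]"
    by (simp add: numeral_2_eq_2 monom_Suc monom_0)
  then have "theta\<^sup>2 = Fract (monom 1 2) 1"
    by (simp add: theta_def power2_eq_square)
  then show "theta\<^sup>2 \<in> qt_subfield"
    using qt_subfieldI[of 1 "[:0, 1:]"] by (simp add: pcompose_pCons pcompose_1)
  assume "x \<in> qt_subfield"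
  then obtain a b where x: "b \<noteq> 0" "x = Fract (pcompose a (monom 1 2)) (pcompose b (monom 1 2))"
    unfolding qt_subfield_def by blast
  show "- x \<in> qt_subfield"
    using qt_subfieldI[of b "- a"] x by (simp add: pcompose_uminus)
  show "inverse x \<in> qt_subfield"
  proof (cases "a = 0")
    case True
    then show ?thesis using qt_subfieldI[of 1 0] x by (simp add: fract_collapse pcompose_1)
  next
    case False
    then show ?thesis using qt_subfieldI[of a b] x by simp
  qed
  assume "y \<in> qt_subfield"
  then obtain c d where y: "d \<noteq> 0" "y = Fract (pcompose c (monom 1 2)) (pcompose d (monom 1 2))"
    unfolding qt_subfield_def by blast
  show "x + y \<in> qt_subfield"
    using qt_subfieldI[of "b * d" "a * d + c * b"] x y
    by (simp add: pcompose_add pcompose_mult pcompose_monom_2_eq_0)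
  show "x * y \<in> qt_subfield"
    using qt_subfieldI[of "b * d" "a * c"] x y
    by (simp add: pcompose_mult)
qed

lemma rconst_hom:
  "rconst (a + b) = rconst a + rconst b" "rconst (a * b) = rconst a * rconst b"
  "rconst 0 = 0" "rconst 1 = 1" "rconst (- a) = - rconst a"
  "rconst (inverse a) = inverse (rconst a)" "rconst a = rconst b \<longleftrightarrow> a = b"
proof -
  have p1: "pconst 1 = 1" by (simp add: pconst_def)
  show add: "rconst (a + b) = rconst a + rconst b" for a b by (simp add: rconst_def pconst_add)
  show mult: "rconst (a * b) = rconst a * rconst b" for a b by (simp add: rconst_def pconst_mult)
  show zero: "rconst 0 = 0" by (simp add: rconst_def pconst_def fract_collapse)
  show one: "rconst 1 = 1" by (simp add: rconst_def p1 flip: One_fract_def)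
  show "rconst (- a) = - rconst a" using add[of a "- a"] zero by (simp add: eq_neg_iff_add_eq_0 add.commute)
  show "rconst (inverse a) = inverse (rconst a)"
  proof (cases "a = 0")
    case False
    then have "rconst a * rconst (inverse a) = 1" by (simp flip: mult one)
    then show ?thesis by (metis inverse_unique)
  qed (simp add: zero)
  show "rconst a = rconst b \<longleftrightarrow> a = b"
    by (auto simp: rconst_def eq_fract pconst_def dest: injD[OF inj_single])
qed

lemma rconst_power: "rconst (a ^ n) = rconst a ^ n"
  by (induction n) (auto simp: rconst_hom)

section \<open>Separating expressions in q and theta by specialisation\<close>

definition poly_emb :: "complex poly poly \<Rightarrow> ratfun" where
  "poly_emb P = rconst (Fract P 1)"

lemma poly_emb_hom:
  "poly_emb (P + R) = poly_emb P + poly_emb R" "poly_emb (P * R) = poly_emb P * poly_emb R"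
  "poly_emb 0 = 0" "poly_emb 1 = 1" "poly_emb P = poly_emb R \<longleftrightarrow> P = R"
proof -
  show "poly_emb (P + R) = poly_emb P + poly_emb R" "poly_emb (P * R) = poly_emb P * poly_emb R"
    by (simp_all add: poly_emb_def flip: rconst_hom)
  show "poly_emb 0 = 0" "poly_emb 1 = 1"
    by (simp_all add: poly_emb_def rconst_hom flip: Zero_fract_def One_fract_def)
  show "poly_emb P = poly_emb R \<longleftrightarrow> P = R" by (simp add: poly_emb_def rconst_hom eq_fract)
qed

lemma poly_emb_power: "poly_emb (P ^ n) = poly_emb P ^ n"
  by (induction n) (auto simp: poly_emb_hom)

lemma poly_emb_sum: "poly_emb (sum f A) = (\<Sum>x\<in>A. poly_emb (f x))"
  by (induction A rule: infinite_finite_induct) (auto simp: poly_emb_hom)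

lemma poly_emb_qq: "rconst qq = poly_emb [:[:0, 1:]:]"
  and poly_emb_theta: "rconst theta = poly_emb [:0, 1:]"
  by (simp_all add: poly_emb_def qq_def theta_def)

text \<open>The outer polynomial variable is theta and the inner one is q, so theta is specialised
  to \<open>a\<close> and q to \<open>b\<close>. Inequalities of expressions in q and theta are
  thereby tested at one point.\<close>

lemma poly_emb_eqD:
  assumes "poly_emb P = poly_emb R"
  shows "poly (poly P [:a:]) b = poly (poly R [:a:]) b"
  using assms by (simp add: poly_emb_hom)

lemmas poly_emb_simps = poly_emb_qq poly_emb_theta poly_emb_power[symmetric] poly_emb_hom(1,2,4)[symmetric]
  poly_emb_sum[symmetric]

lemma rconst_qq_nz: "rconst qq \<noteq> 0" and rconst_theta_nz: "rconst theta \<noteq> 0"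
  using rconst_hom(7)[of qq 0] rconst_hom(7)[of theta 0] by (auto simp: rconst_hom(3))

lemma rconst_qq_power: "r \<ge> 1 \<Longrightarrow> rconst qq ^ r \<noteq> 1"
  unfolding poly_emb_simps by (auto simp: power_0_left dest!: poly_emb_eqD[where a = 0 and b = 0])

lemma rconst_theta_qq_power: "(rconst theta)\<^sup>2 \<noteq> rconst qq ^ r" "(rconst theta)\<^sup>2 * rconst qq ^ r \<noteq> 1"
  unfolding poly_emb_simps by (auto dest!: poly_emb_eqD[where a = 0 and b = 1])

lemma rconst_theta_power:
  assumes "k \<ge> 1"
  shows "inverse ((rconst theta)\<^sup>2) ^ k \<noteq> 1" "((rconst theta)\<^sup>2 / rconst qq) ^ k \<noteq> 1"
proof -
  have "((rconst theta)\<^sup>2) ^ k \<noteq> 1"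
    unfolding poly_emb_simps using assms by (auto simp: power_0_left dest!: poly_emb_eqD[where a = 0 and b = 1])
  then show "inverse ((rconst theta)\<^sup>2) ^ k \<noteq> 1"
    by (simp add: power_inverse)
  have "((rconst theta)\<^sup>2) ^ k \<noteq> rconst qq ^ k"
    unfolding poly_emb_simps using assms by (auto simp: power_0_left dest!: poly_emb_eqD[where a = 0 and b = 1])
  then show "((rconst theta)\<^sup>2 / rconst qq) ^ k \<noteq> 1"
    using rconst_qq_nz by (simp add: power_divide)
qed

lemma sum_ratio_powers:
  fixes x :: "'a::field"
  assumes "x \<noteq> 0"
  shows "(\<Sum>i<k. \<Sum>j<k. inverse x ^ i * x ^ j) * x ^ (k - 1) = (\<Sum>j<k. x ^ j)\<^sup>2"
proof -
  have "(\<Sum>i<k. inverse x ^ i) * x ^ (k - 1) = (\<Sum>i<k. x ^ (k - Suc i))"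
    unfolding sum_distrib_right
    by (intro sum.cong refl) (use assms in \<open>auto simp: power_inverse power_diff field_simps\<close>)
  also have "\<dots> = (\<Sum>i<k. x ^ i)" by (rule sum.nat_diff_reindex)
  finally have *: "(\<Sum>i<k. inverse x ^ i) * x ^ (k - 1) = (\<Sum>i<k. x ^ i)" .
  have "(\<Sum>i<k. \<Sum>j<k. inverse x ^ i * x ^ j) * x ^ (k - 1) =
      (\<Sum>i<k. inverse x ^ i) * x ^ (k - 1) * (\<Sum>j<k. x ^ j)"
    unfolding sum_product[symmetric] by (simp only: mult_ac)
  then show ?thesis unfolding * power2_eq_square .
qed

lemma rconst_theta_sums:
  assumes "k \<ge> 2"
  defines "p \<equiv> inverse ((rconst theta)\<^sup>2)" and "p' \<equiv> (rconst theta)\<^sup>2 / rconst qq"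
  shows "(\<Sum>i<k. \<Sum>j<k. inverse p ^ i * p ^ j) \<noteq> (\<Sum>i<k. \<Sum>j<k. inverse p' ^ i * p' ^ j)"
proof
  let ?t = "(rconst theta)\<^sup>2" and ?q = "rconst qq"
  have nz: "?t \<noteq> 0" "?q \<noteq> 0" "p' \<noteq> 0" using rconst_qq_nz rconst_theta_nz by (auto simp: p'_def)
  assume eq: "(\<Sum>i<k. \<Sum>j<k. inverse p ^ i * p ^ j) = (\<Sum>i<k. \<Sum>j<k. inverse p' ^ i * p' ^ j)"
  \<comment> \<open>The double sum does not change when its argument is inverted, so
    \<open>p\<close> may be replaced by t.\<close>
  have "(\<Sum>i<k. \<Sum>j<k. inverse p ^ i * p ^ j) = (\<Sum>i<k. \<Sum>j<k. inverse ?t ^ i * ?t ^ j)"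
    by (subst sum.swap) (simp add: p_def mult.commute)
  then have 1: "(\<Sum>i<k. \<Sum>j<k. inverse p' ^ i * p' ^ j) * ?t ^ (k - 1) = (\<Sum>j<k. ?t ^ j)\<^sup>2"
    using sum_ratio_powers[OF nz(1), of k] eq by simp
  have tq: "?t ^ (k - 1) = p' ^ (k - 1) * ?q ^ (k - 1)"
    using nz by (simp add: p'_def power_divide)
  have "?q ^ (k - 1) * (\<Sum>j<k. ?t ^ j)\<^sup>2 = (?q ^ (k - 1) * (\<Sum>j<k. p' ^ j))\<^sup>2"
    unfolding 1[symmetric] tq power_mult_distrib sum_ratio_powers[OF nz(3), symmetric]
    by (simp add: power2_eq_square mult_ac)
  also have "?q ^ (k - 1) * (\<Sum>j<k. p' ^ j) = (\<Sum>j<k. ?t ^ j * ?q ^ (k - 1 - j))"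
    unfolding sum_distrib_left
    by (intro sum.cong refl) (use nz in \<open>auto simp: p'_def power_divide power_diff field_simps\<close>)
  finally have *: "?q ^ (k - 1) * (\<Sum>j<k. ?t ^ j)\<^sup>2 = (\<Sum>j<k. ?t ^ j * ?q ^ (k - 1 - j))\<^sup>2" .
  obtain n where k: "k = Suc (Suc n)" using assms(1) by (metis add_2_eq_Suc le_Suc_ex)
  \<comment> \<open>At theta = 1 and q = 0 the left side of \<open>*\<close> vanishes because
    \<open>k \<ge> 2\<close>, while on the right only the term j = k - 1 remains.\<close>
  have "0 = (\<Sum>j<k. (0::complex) ^ (k - 1 - j))"
    using *[unfolded poly_emb_simps, THEN poly_emb_eqD, where a = 1 and b = 0] k
    by (simp add: poly_sum)
  also have "\<dots> = 1" unfolding k by (simp add: power_0_left)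
  finally show False by simp
qed

lemma inj_rvar: "inj rvar"
  by (simp add: inj_def rvar_eq_iff)

text \<open>The abstract field is the field of rational functions in the variables, so the variables
  themselves serve as points. Both roots lie in the coefficient field because they contain theta
  only through its square.\<close>

interpretation rf: macdonald "rconst ` qt_subfield" "rconst qq"
  "inverse ((rconst theta)\<^sup>2) + (rconst theta)\<^sup>2 / rconst qq"
  "inverse ((rconst theta)\<^sup>2)" "(rconst theta)\<^sup>2 / rconst qq" "rconst theta" N for N
proof
  let ?C = "rconst ` qt_subfield"
  have C: "rconst 1 \<in> ?C" "rconst qq \<in> ?C" "rconst (theta\<^sup>2) \<in> ?C"
    "rconst (inverse (theta\<^sup>2)) \<in> ?C" "rconst (theta\<^sup>2 * inverse qq) \<in> ?C"
    by (intro imageI qt_subfield_closed)+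
  then show "1 \<in> ?C" "rconst qq \<in> ?C" "inverse ((rconst theta)\<^sup>2) \<in> ?C" "(rconst theta)\<^sup>2 / rconst qq \<in> ?C"
    by (simp_all add: rconst_hom rconst_power divide_inverse)
  show "x + y \<in> ?C" "x * y \<in> ?C" if "x \<in> ?C" "y \<in> ?C" for x y
    using that qt_subfield_closed by (auto simp flip: rconst_hom)
  show "- x \<in> ?C" "inverse x \<in> ?C" if "x \<in> ?C" for x
    using that qt_subfield_closed by (auto simp flip: rconst_hom)
  show "rconst qq \<noteq> 0" "rconst qq \<noteq> 1" "rconst theta \<noteq> 0"
    using rconst_qq_nz rconst_theta_nz rconst_qq_power[of 1] by auto
  show "inverse ((rconst theta)\<^sup>2) * ((rconst theta)\<^sup>2 / rconst qq) * rconst qq = 1"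
    using rconst_qq_nz rconst_theta_nz by simp
  show "infinite (UNIV :: ratfun set)"
    using inj_rvar finite_subset[OF subset_UNIV[of "range rvar"]] by (auto dest: finite_imageD)
qed (use rconst_theta_power rconst_theta_sums rconst_qq_power rconst_theta_qq_power in blast)+

lemma rconst_rvar_eq:
  assumes "c \<noteq> 0" "i \<noteq> j"
  shows "rconst c * rvar i \<noteq> rconst d * rvar j"
proof
  have single: "pconst c * pvar i = Poly_Mapping.single (Poly_Mapping.single i 1) c" for c i
    by (simp add: pconst_def pvar_def mult_single)
  assume "rconst c * rvar i = rconst d * rvar j"
  then have "pconst c * pvar i = pconst d * pvar j"
    by (simp add: rconst_def rvar_def eq_fract)
  then have "Poly_Mapping.lookup (Poly_Mapping.single (Poly_Mapping.single i (1::nat)) c) (Poly_Mapping.single i 1) =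
     Poly_Mapping.lookup (Poly_Mapping.single (Poly_Mapping.single j (1::nat)) d) (Poly_Mapping.single i 1)"
    unfolding single by simp
  moreover have "Poly_Mapping.single j (1::nat) \<noteq> Poly_Mapping.single i 1"
    using assms(2) by (metis lookup_single_eq lookup_single_not_eq zero_neq_one)
  ultimately show False using assms(1) by (simp add: lookup_single_not_eq)
qed

lemma indep_rvar: "rf.indep N rvar"
proof -
  have "rvar i \<noteq> 0" for i
    using rconst_rvar_eq[of 1 i "Suc i" 0] by (simp add: rconst_hom)
  moreover have "rconst qq ^ m * rvar i \<noteq> rconst qq ^ n * rvar j"
    "(rconst theta)\<^sup>2 * (rconst qq ^ m * rvar i) \<noteq> rconst qq ^ n * rvar j" if "i \<noteq> j" for i j m n
    using rconst_rvar_eq[OF _ that, of "qq ^ m" "qq ^ n"] rconst_rvar_eq[OF _ that, of "theta\<^sup>2 * qq ^ m" "qq ^ n"]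
    by (simp_all add: rconst_hom rconst_power mult.assoc)
  ultimately show ?thesis unfolding rf.indep_def by blast
qed

lemma qshift_hom:
  "qshift i (f + g) = qshift i f + qshift i g" "qshift i (f * g) = qshift i f * qshift i g"
  "qshift i (inverse f) = inverse (qshift i f)" "qshift i (rconst c) = rconst c"
proof -
  let ?s = "psubst (\<lambda>j. if j = i then pconst qq * pvar j else pvar j)"
  have nz: "?s b = 0 \<longleftrightarrow> b = 0" for b
    using psubst_nonzero[OF inj_psubst_qshift] by auto
  obtain a b c d where f: "f = Fract a b" "b \<noteq> 0" and g: "g = Fract c d" "d \<noteq> 0"
    by (metis Fract_cases)
  show "qshift i (f + g) = qshift i f + qshift i g" "qshift i (f * g) = qshift i f * qshift i g"
    using f g by (simp_all add: qshift_Fract psubst_add psubst_mult nz)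
  show "qshift i (rconst c) = rconst c" for c
    by (simp add: rconst_def qshift_Fract)
  show "qshift i (inverse f) = inverse (qshift i f)"
  proof (cases "a = 0")
    case True
    have "qshift i (Fract 0 1) = Fract 0 1" by (subst qshift_Fract) auto
    then show ?thesis using f True by (simp add: fract_collapse)
  next
    case False
    then show ?thesis using f by (simp add: qshift_Fract nz)
  qed
qed

lemma qshift_sum: "qshift i (sum f A) = (\<Sum>x\<in>A. qshift i (f x))"
  using qshift_hom(4)[of i 0]
  by (induction A rule: infinite_finite_induct) (auto simp: qshift_hom rconst_hom)

interpretation qshift: comp_fun_commute qshift
  by standard (auto simp: fun_eq_iff qshift_commute)

lemma foldr_qshift: "foldr qshift l f = fold_mset qshift f (mset l)"
  by (induction l) auto

lemma qshift_word_coeff: "qshift i (rf.word_coeff N rvar w M) = rf.word_coeff N (rvar(i := rconst qq * rvar i)) w M"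
proof -
  have "qshift i (rf.word_coeff N rvar w M) = rf.word_coeff N (\<lambda>j. qshift i (rvar j)) w M"
    using qshift_hom(4)[of i 0] qshift_hom(4)[of i 1]
    by (intro rf.word_coeff_hom) (auto simp: qshift_hom rconst_hom)
  also have "(\<lambda>j. qshift i (rvar j)) = rvar(i := rconst qq * rvar i)"
    by (auto simp: qshift_rvar)
  finally show ?thesis .
qed

lemma pair_factor_rvar: "(rconst theta * rvar i - rconst (inverse theta) * rvar j) / (rvar i - rvar j) =
    rf.pair_factor (rvar i) (rvar j)"
  by (simp add: rf.pair_factor_def rconst_hom)

lemma DD_1: "DD N 1 b f = (\<Sum>i\<in>{1..N}. rvar i powi b * rf.row_factor N rvar i * qshift i f)"
proof -
  have *: "{I. I \<subseteq> {1..N} \<and> card I = 1} = (\<lambda>i. {i}) ` {1..N}" by (auto simp: card_1_singleton_iff)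
  show ?thesis
    unfolding DD_def * by (simp add: sum.reindex rf.row_factor_def pair_factor_rvar del: One_nat_def)
qed

text \<open>Normal ordering: every shift is moved to the right of all coefficients, and the
  commuting shifts are collected by their multiset.\<close>

lemma foldr_DD_1:
  "foldr (DD N 1) w f = (\<Sum>M\<in>multisets_of_size {1..N} (length w). rf.word_coeff N rvar w M * fold_mset qshift f M)"
proof (induction w)
  case Nil
  have "multisets_of_size {1..N} 0 = {{#}}" by (auto simp: multisets_of_size_def)
  then show ?case by simp
next
  case (Cons b w)
  let ?MM = "multisets_of_size {1..N}"
  let ?c = "\<lambda>i M. rvar i powi b * rf.row_factor N rvar i * rf.word_coeff N (rvar(i := rconst qq * rvar i)) w M"
  have fin: "finite (?MM k)" for k by (intro finite_multisets_of_size) simp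
  have "foldr (DD N 1) (b # w) f =
      (\<Sum>i\<in>{1..N}. \<Sum>M\<in>?MM (length w). ?c i M * fold_mset qshift f (add_mset i M))"
    by (simp add: DD_1[simplified] Cons.IH[simplified] qshift_sum qshift_hom qshift_word_coeff sum_distrib_left mult_ac
        del: fun_upd_apply)
  also have "\<dots> = (\<Sum>(i, M)\<in>{1..N} \<times> ?MM (length w). ?c i M * fold_mset qshift f (add_mset i M))"
    by (simp only: sum.cartesian_product)
  \<comment> \<open>A first shift together with the multiset of the others is a multiset with one
    marked element, which matches the recursion of \<open>word_coeff\<close>.\<close>
  also have "\<dots> = (\<Sum>(M, i)\<in>(SIGMA M:?MM (Suc (length w)). set_mset M). ?c i (M - {#i#}) * fold_mset qshift f M)"
    by (rule sum.reindex_bij_witness[where i = "\<lambda>(M, i). (i, M - {#i#})" and j = "\<lambda>(i, M). (add_mset i M, i)"])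
       (auto simp: multisets_of_size_def size_Diff_singleton dest: in_diffD)
  also have "\<dots> = (\<Sum>M\<in>?MM (Suc (length w)). \<Sum>i\<in>set_mset M. ?c i (M - {#i#}) * fold_mset qshift f M)"
    by (subst sum.Sigma) (use fin in auto)
  also have "\<dots> = (\<Sum>M\<in>?MM (length (b # w)). rf.word_coeff N rvar (b # w) M * fold_mset qshift f M)"
    by (simp only: rf.word_coeff.simps sum_distrib_right list.size add_0_right add_Suc_right)
  finally show ?case .
qed

theorem theorem6p3:
  fixes N \<alpha> :: nat and n :: int
  assumes "1 \<le> \<alpha>" and "\<alpha> \<le> N"
  shows "homogeneous_ncpoly_in (sym_rat_funs N) qt_subfield \<alpha> {n - 1, n, n + 1} (DD N 1) (DD N \<alpha> n)"
proof -
  obtain c where c: "\<And>w. c w \<in> rconst ` qt_subfield"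
    "\<And>M. set_mset M \<subseteq> {1..N} \<Longrightarrow> size M = \<alpha> \<Longrightarrow>
      (\<Sum>w\<in>rf.words \<alpha>. c w * rf.word_coeff N rvar (map (\<lambda>a. a + n) w) M) =
      (if \<forall>i. count M i \<le> 1 then (\<Prod>i\<in>set_mset M. rvar i) powi n *
       (\<Prod>i\<in>set_mset M. \<Prod>j\<in>{1..N} - set_mset M. rf.pair_factor (rvar i) (rvar j)) else 0)"
    using rf.sum_word_coeff[OF assms(1), of N] indep_rvar by blast
  \<comment> \<open>The coefficients obtained are constant rational functions; they are pulled back
    to elements of the ground field.\<close>
  have "\<forall>w. \<exists>a. a \<in> qt_subfield \<and> c w = rconst a" using c(1) by blast
  then obtain d where d: "\<And>w. d w \<in> qt_subfield" "\<And>w. c w = rconst (d w)"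
    by (auto dest!: choice)
  let ?W = "{w. set w \<subseteq> {n - 1, n, n + 1} \<and> length w = \<alpha>}"
  let ?MM = "multisets_of_size {1..N} \<alpha>"
  let ?sh = "\<lambda>w. map (\<lambda>a. a + n) w"
  let ?D = "\<lambda>I. (\<Prod>i\<in>I. rvar i) powi n * (\<Prod>i\<in>I. \<Prod>j\<in>{1..N} - I. rf.pair_factor (rvar i) (rvar j))"
  have "DD N \<alpha> n f = (\<Sum>w\<in>?W. rconst (d (map (\<lambda>a. a - n) w)) * foldr (DD N 1) w f)" for f
  proof -
    have "(\<Sum>w\<in>?W. rconst (d (map (\<lambda>a. a - n) w)) * foldr (DD N 1) w f) =
        (\<Sum>w\<in>rf.words \<alpha>. c w * foldr (DD N 1) (?sh w) f)"
      by (rule sum.reindex_bij_witness[where i = ?sh and j = "\<lambda>w. map (\<lambda>a. a - n) w"])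
         (auto simp: rf.words_def d(2) o_def)
    also have "\<dots> = (\<Sum>w\<in>rf.words \<alpha>. \<Sum>M\<in>?MM. c w * rf.word_coeff N rvar (?sh w) M * fold_mset qshift f M)"
    proof (intro sum.cong refl)
      fix w assume "w \<in> rf.words \<alpha>"
      then have "length (?sh w) = \<alpha>" by (simp add: rf.words_def)
      then show "c w * foldr (DD N 1) (?sh w) f = (\<Sum>M\<in>?MM. c w * rf.word_coeff N rvar (?sh w) M * fold_mset qshift f M)"
        unfolding foldr_DD_1 by (simp only: sum_distrib_left mult.assoc)
    qed
    also have "\<dots> = (\<Sum>M\<in>?MM. (\<Sum>w\<in>rf.words \<alpha>. c w * rf.word_coeff N rvar (?sh w) M) * fold_mset qshift f M)"
      by (subst sum.swap) (simp only: sum_distrib_right)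
    \<comment> \<open>Repeated shifts drop out here. A multiset without repetitions is a set
      \<open>I\<close>, and \<open>?D I\<close> is its coefficient in
      \<open>DD N \<alpha> n\<close>.\<close>
    also have "\<dots> = (\<Sum>M\<in>?MM. if \<forall>i. count M i \<le> 1 then ?D (set_mset M) * fold_mset qshift f M else 0)"
      by (intro sum.cong refl) (auto simp: c(2) multisets_of_size_def)
    also have "\<dots> = (\<Sum>M\<in>{M\<in>?MM. \<forall>i. count M i \<le> 1}. ?D (set_mset M) * fold_mset qshift f M)"
      by (intro sum.inter_filter[symmetric] finite_multisets_of_size) simp
    also have "\<dots> = (\<Sum>I | I \<subseteq> {1..N} \<and> card I = \<alpha>. ?D I * fold_mset qshift f (mset_set I))"
    proof (rule sum.reindex_bij_witness[where i = mset_set and j = set_mset])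
      fix M assume M: "M \<in> {M\<in>?MM. \<forall>i. count M i \<le> 1}"
      show eq: "mset_set (set_mset M) = M"
      proof (rule multiset_eqI)
        fix i
        show "count (mset_set (set_mset M)) i = count M i"
        proof (cases "i \<in># M")
          case True
          then have "count M i > 0" by (simp only: count_greater_zero_iff)
          moreover have "count M i \<le> 1" using M by blast
          ultimately have "count M i = 1" by linarith
          then show ?thesis using True by simp
        qed (simp add: not_in_iff)
      qed
      have "size M = card (set_mset M)" by (subst eq[symmetric]) simp
      with M show "set_mset M \<in> {I. I \<subseteq> {1..N} \<and> card I = \<alpha>}" by (auto simp: multisets_of_size_def)
      show "?D (set_mset M) * fold_mset qshift f (mset_set (set_mset M)) = ?D (set_mset M) * fold_mset qshift f M"
        by (simp only: eq)
    next
      fix I assume I: "I \<in> {I. I \<subseteq> {1..N} \<and> card I = \<alpha>}"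
      then have fin: "finite I" by (auto intro: finite_subset)
      then show "set_mset (mset_set I) = I" by simp
      show "mset_set I \<in> {M\<in>?MM. \<forall>i. count M i \<le> 1}"
        using I fin by (auto simp: multisets_of_size_def count_mset_set')
    qed
    also have "\<dots> = DD N \<alpha> n f"
      unfolding DD_def foldr_qshift pair_factor_rvar
      by (intro sum.cong refl) (simp flip: sorted_list_of_mset_set)
    finally show ?thesis ..
  qed
  then show ?thesis
    unfolding homogeneous_ncpoly_in_def
    using d(1) by (intro exI[of _ "\<lambda>w. d (map (\<lambda>a. a - n) w)"]) auto
qed

end
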